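(* Suppose $Q\subseteq\mathbb{R}^m$ is a tractable binary polytope, i.e. $\mathrm{vert}(Q)\subseteq\{0,1\}^m$ and both separation and linear optimization over $Q$ can be done in polynomial time with respect to $m$. Then the inequalities $$x^\top A y+k\,\bar a^\top x\geq kb \qquad \forall\, y\in Y_{k,Q}$$ can be separated in polynomial time.
   Context: The data are a set $X\subseteq\mathbb{R}^n$, a matrix $A\in\mathbb{R}^{n\times m}$, a vector $\bar a\in\mathbb{R}^n$, a scalar $b\in\mathbb{R}$ and a positive integer $k$ (rational data for complexity purposes). $\mathrm{vert}(Q)$ is the set of vertices of $Q$. $L_{k,m}$ is the set of $k\times m$ binary matrices $[z_1,\ldots,z_k]^\top$ whose rows $z_i\in\{0,1\}^m$ are in strictly increasing lexicographical order (in particular pairwise distinct). $L_{k,Q}:=L_{k,m}\cap Q^k$ is the set of those matrices all of whose rows lie in $Q$, and $$Y_{k,Q}:=\Big\{y\in\mathbb{Z}_+^m:\ y=\sum_{i=1}^k z_i\ \text{for some}\ [z_1,\ldots,z_k]^\top\in L_{k,Q}\Big\}.$$ Separating the family of inequalities means: given $x\in X$, decide whether $x$ satisfies $x^\top A y+k\bar a^\top x\geq kb$ for every $y\in Y_{k,Q}$, and if not, return some $y\in Y_{k,Q}$ whose inequality is violated by $x$. Linear optimization over $Q$ means: given an objective vector, find a point of $Q$ (which may be taken to be a vertex) minimizing it; separation over $Q$ means: given a point, decide whether it belongs to $Q$ and otherwise return a hyperplane separating it from $Q$. Polynomial time for separating the family is understood as polynomial in $k$, $m$, $n$ and the encoding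 size of the rational data $A,\bar a,b,x$. *)

theory Defs
  imports
    "HOL-Analysis.Analysis"
    "HOL-Computational_Algebra.Polynomial"
    "HOL-Library.Function_Algebras"
    "HOL-Library.Fun_Lexorder"
    "HOL-Library.Log_Nat"
begin

section \<open>Vectors, matrices and polytopes in variable dimension\<close>

text \<open>
  The dimension has to be a variable that ranges over all natural numbers, so it cannot be a type.
  A vector of dimension \<open>n\<close> is a function on \<^typ>\<open>nat\<close> that vanishes outside \<open>{..<n}\<close>. The
  pointwise vector space structure below makes convex hull, polytope and extreme point of the
  library available for sets of such vectors.
\<close>

instantiation "fun" :: (type, real_vector) real_vector
begin

definition scaleR_fun :: "real \<Rightarrow> ('a \<Rightarrow> 'b) \<Rightarrow> 'a \<Rightarrow> 'b"
  where "scaleR_fun c f = (\<lambda>x. c *\<^sub>R f x)"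

instance
  by standard (simp_all add: scaleR_fun_def fun_eq_iff scaleR_add_right scaleR_add_left)

end

definition vecs :: "nat \<Rightarrow> (nat \<Rightarrow> 'a::zero) set"
  where "vecs n = {v. \<forall>i\<ge>n. v i = 0}"

definition mats :: "nat \<Rightarrow> nat \<Rightarrow> (nat \<Rightarrow> nat \<Rightarrow> 'a::zero) set"
  where "mats n m = {M. \<forall>i j. i \<ge> n \<or> j \<ge> m \<longrightarrow> M i j = 0}"

definition dot :: "nat \<Rightarrow> (nat \<Rightarrow> 'a) \<Rightarrow> (nat \<Rightarrow> 'a) \<Rightarrow> 'a::comm_semiring_1"
  where "dot n u v = (\<Sum>i<n. u i * v i)"

definition mat_vec :: "nat \<Rightarrow> (nat \<Rightarrow> nat \<Rightarrow> 'a) \<Rightarrow> (nat \<Rightarrow> 'a) \<Rightarrow> nat \<Rightarrow> 'a::comm_semiring_1"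
  where "mat_vec m M v = (\<lambda>i. dot m (M i) v)"

definition real_vec :: "(nat \<Rightarrow> rat) \<Rightarrow> nat \<Rightarrow> real"
  where "real_vec v = (\<lambda>i. of_rat (v i))"

definition vert :: "(nat \<Rightarrow> real) set \<Rightarrow> (nat \<Rightarrow> real) set"
  where "vert Q = {v. v extreme_point_of Q}"

definition binary_polytope :: "nat \<Rightarrow> (nat \<Rightarrow> real) set \<Rightarrow> bool"
  where "binary_polytope m Q \<longleftrightarrow>
    Q \<subseteq> vecs m \<and> polytope Q \<and> vert Q \<subseteq> {v \<in> vecs m. \<forall>j<m. v j \<in> {0, 1}}"


section \<open>The sets of lexicographically ordered binary matrices and of their row sums\<close>

definition L_mats :: "nat \<Rightarrow> nat \<Rightarrow> (nat \<Rightarrow> nat \<Rightarrow> nat) set"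
  where "L_mats k m = {z \<in> mats k m.
    (\<forall>i<k. \<forall>j<m. z i j \<in> {0, 1}) \<and>
    (\<forall>i i'. i < i' \<and> i' < k \<longrightarrow> less_fun (z i) (z i'))}"

definition L_Q :: "nat \<Rightarrow> nat \<Rightarrow> (nat \<Rightarrow> real) set \<Rightarrow> (nat \<Rightarrow> nat \<Rightarrow> nat) set"
  where "L_Q k m Q = {z \<in> L_mats k m. \<forall>i<k. (\<lambda>j. real (z i j)) \<in> Q}"

definition Y_Q :: "nat \<Rightarrow> nat \<Rightarrow> (nat \<Rightarrow> real) set \<Rightarrow> (nat \<Rightarrow> nat) set"
  where "Y_Q k m Q = {y \<in> vecs m. \<exists>z \<in> L_Q k m Q. \<forall>j. y j = (\<Sum>i<k. z i j)}"

definition satisfies_ineq ::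
  "nat \<Rightarrow> nat \<Rightarrow> nat \<Rightarrow> (nat \<Rightarrow> nat \<Rightarrow> rat) \<Rightarrow> (nat \<Rightarrow> rat) \<Rightarrow> rat \<Rightarrow> (nat \<Rightarrow> rat) \<Rightarrow> (nat \<Rightarrow> nat) \<Rightarrow> bool"
  where "satisfies_ineq n m k A a b x y \<longleftrightarrow>
    dot n x (mat_vec m A (\<lambda>j. of_nat (y j))) + of_nat k * dot n a x \<ge> of_nat k * b"


section \<open>Model of computation\<close>

text \<open>
  Programs are written in a while language over binary trees with integer leaves, under a
  logarithmic cost measure: evaluating an expression costs the total number of bits of all values
  produced on the way, including the values read from variables. Every value that is read, copied
  or built is therefore paid for in full, and the running time is polynomially related to that of
  a Turing machine.
\<close>

datatype val = Atom int | Cell val val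

fun val_size :: "val \<Rightarrow> nat"
  where
    "val_size (Atom i) = 1 + floorlog 2 (nat \<bar>i\<bar>)"
  | "val_size (Cell u v) = 1 + val_size u + val_size v"

fun atom_of :: "val \<Rightarrow> int"
  where
    "atom_of (Atom i) = i"
  | "atom_of (Cell u v) = 0"

fun left_of :: "val \<Rightarrow> val"
  where
    "left_of (Atom i) = Atom 0"
  | "left_of (Cell u v) = u"

fun right_of :: "val \<Rightarrow> val"
  where
    "right_of (Atom i) = Atom 0"
  | "right_of (Cell u v) = v"

datatype expr =
    Var nat
  | Const int
  | Add expr expr
  | Sub expr expr
  | Mul expr expr
  | Less expr expr
  | MkCell expr expr
  | Left expr
  | Right expr
  | IsCell expr

type_synonym store = "nat \<Rightarrow> val"

fun eval_expr :: "expr \<Rightarrow> store \<Rightarrow> val"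
  where
    "eval_expr (Var i) s = s i"
  | "eval_expr (Const c) s = Atom c"
  | "eval_expr (Add e f) s = Atom (atom_of (eval_expr e s) + atom_of (eval_expr f s))"
  | "eval_expr (Sub e f) s = Atom (atom_of (eval_expr e s) - atom_of (eval_expr f s))"
  | "eval_expr (Mul e f) s = Atom (atom_of (eval_expr e s) * atom_of (eval_expr f s))"
  | "eval_expr (Less e f) s =
      Atom (if atom_of (eval_expr e s) < atom_of (eval_expr f s) then 1 else 0)"
  | "eval_expr (MkCell e f) s = Cell (eval_expr e s) (eval_expr f s)"
  | "eval_expr (Left e) s = left_of (eval_expr e s)"
  | "eval_expr (Right e) s = right_of (eval_expr e s)"
  | "eval_expr (IsCell e) s = Atom (case eval_expr e s of Cell _ _ \<Rightarrow> 1 | Atom _ \<Rightarrow> 0)"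

fun cost :: "expr \<Rightarrow> store \<Rightarrow> nat"
  where
    "cost (Var i) s = val_size (s i)"
  | "cost (Const c) s = val_size (Atom c)"
  | "cost (Add e f) s = cost e s + cost f s + val_size (eval_expr (Add e f) s)"
  | "cost (Sub e f) s = cost e s + cost f s + val_size (eval_expr (Sub e f) s)"
  | "cost (Mul e f) s = cost e s + cost f s + val_size (eval_expr (Mul e f) s)"
  | "cost (Less e f) s = cost e s + cost f s + val_size (eval_expr (Less e f) s)"
  | "cost (MkCell e f) s = cost e s + cost f s + val_size (eval_expr (MkCell e f) s)"
  | "cost (Left e) s = cost e s + val_size (eval_expr (Left e) s)"
  | "cost (Right e) s = cost e s + val_size (eval_expr (Right e) s)"
  | "cost (IsCell e) s = cost e s + val_size (eval_expr (IsCell e) s)"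

text \<open>\<open>Call i p e\<close> runs \<open>p\<close> on the value of \<open>e\<close> in a fresh store; programs being finite trees,
  there is no recursion.\<close>

datatype com =
    Assign nat expr
  | Seq com com
  | Cond expr com com
  | While expr com
  | Call nat com expr

definition init_store :: "val \<Rightarrow> store"
  where "init_store v = (\<lambda>_. Atom 0)(0 := v)"

text \<open>\<open>exec p s t s'\<close>: started in store \<open>s\<close>, program \<open>p\<close> halts in store \<open>s'\<close> after time \<open>t\<close>.\<close>

inductive exec :: "com \<Rightarrow> store \<Rightarrow> nat \<Rightarrow> store \<Rightarrow> bool"
  where
    Assign: "exec (Assign i e) s (1 + cost e s) (s(i := eval_expr e s))"
  | Seq: "exec p s t s' \<Longrightarrow> exec q s' t' s'' \<Longrightarrow> exec (Seq p q) s (1 + t + t') s''"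
  | CondTrue: "eval_expr e s \<noteq> Atom 0 \<Longrightarrow> exec p s t s' \<Longrightarrow>
      exec (Cond e p q) s (1 + cost e s + t) s'"
  | CondFalse: "eval_expr e s = Atom 0 \<Longrightarrow> exec q s t s' \<Longrightarrow>
      exec (Cond e p q) s (1 + cost e s + t) s'"
  | WhileTrue: "eval_expr e s \<noteq> Atom 0 \<Longrightarrow> exec p s t s' \<Longrightarrow> exec (While e p) s' t' s'' \<Longrightarrow>
      exec (While e p) s (1 + cost e s + t + t') s''"
  | WhileFalse: "eval_expr e s = Atom 0 \<Longrightarrow> exec (While e p) s (1 + cost e s) s"
  | Call: "exec p (init_store (eval_expr e s)) t s' \<Longrightarrow>
      exec (Call i p e) s (1 + cost e s + t + val_size (s' 0)) (s(i := s' 0))"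

inductive_cases exec_elims:
  "exec (Assign i e) s t s'"
  "exec (Seq p q) s t s'"
  "exec (Cond e p q) s t s'"
  "exec (While e p) s t s'"
  "exec (Call i p e) s t s'"

lemma exec_deterministic:
  "exec p s t s' \<Longrightarrow> exec p s u s'' \<Longrightarrow> u = t \<and> s'' = s'"
proof (induction arbitrary: u s'' rule: exec.induct)
  case Assign
  from Assign.prems show ?case by (rule exec_elims(1)) simp
next
  case (Seq p s t s' q t' s1)
  from Seq.prems show ?case
  proof (rule exec_elims(2))
    fix v r v' assume *: "u = Suc (v + v')" "exec p s v r" "exec q r v' s''"
    from Seq.IH(1)[OF *(2)] Seq.IH(2)[of v' s''] * show ?case by simp
  qed
next
  case (CondTrue e s p t s' q)
  from CondTrue.prems show ?case
  proof (rule exec_elims(3))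
    fix v assume "u = Suc (cost e s + v)" "exec p s v s''"
    with CondTrue.IH[of v s''] show ?case by simp
  qed (use CondTrue.hyps(1) in simp_all)
next
  case (CondFalse e s q t s' p)
  from CondFalse.prems show ?case
  proof (rule exec_elims(3))
    fix v assume "u = Suc (cost e s + v)" "exec q s v s''"
    with CondFalse.IH[of v s''] show ?case by simp
  qed (use CondFalse.hyps(1) in simp_all)
next
  case (WhileTrue e s p t s' t' s1)
  from WhileTrue.prems show ?case
  proof (rule exec_elims(4))
    fix v r v' assume *: "u = Suc (cost e s + v + v')" "exec p s v r" "exec (While e p) r v' s''"
    from WhileTrue.IH(1)[OF *(2)] WhileTrue.IH(2)[of v' s''] * show ?case by simp
  qed (use WhileTrue.hyps(1) in simp_all)
next
  case (WhileFalse e s p)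
  from WhileFalse.prems show ?case
    by (rule exec_elims(4)) (use WhileFalse.hyps in simp_all)
next
  case (Call p e s t s' i)
  from Call.prems show ?case
  proof (rule exec_elims(5))
    fix v r assume *: "u = Suc (cost e s + v + val_size (r 0))" "s'' = s(i := r 0)"
      "exec p (init_store (eval_expr e s)) v r"
    from Call.IH[OF *(3)] * show ?case by simp
  qed
qed

text \<open>
  A search problem is a set of triples \<open>(v, N, R)\<close>: on input \<open>v\<close> some element of \<open>R\<close> has to be
  returned, in time polynomial in \<open>N\<close>. Input and output are held in variable 0. Since \<open>exec\<close>
  is deterministic, the existential quantifier over runs speaks about the only run.
\<close>

definition poly_time_solvable :: "(val \<times> nat \<times> val set) set \<Rightarrow> bool"
  where "poly_time_solvable P \<longleftrightarrow>
    (\<exists>p (f :: nat poly). \<forall>(v, N, R) \<in> P.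
      \<exists>t s. exec p (init_store v) t s \<and> t \<le> poly f N \<and> s 0 \<in> R)"


section \<open>Encodings\<close>

definition enc_nat :: "nat \<Rightarrow> val"
  where "enc_nat n = Atom (int n)"

definition enc_rat :: "rat \<Rightarrow> val"
  where "enc_rat r = Cell (Atom (fst (quotient_of r))) (Atom (snd (quotient_of r)))"

fun enc_list :: "val list \<Rightarrow> val"
  where
    "enc_list [] = Atom 0"
  | "enc_list (v # vs) = Cell v (enc_list vs)"

definition enc_vec :: "('a \<Rightarrow> val) \<Rightarrow> nat \<Rightarrow> (nat \<Rightarrow> 'a) \<Rightarrow> val"
  where "enc_vec enc n v = enc_list (map (\<lambda>i. enc (v i)) [0..<n])"

definition enc_mat :: "('a \<Rightarrow> val) \<Rightarrow> nat \<Rightarrow> nat \<Rightarrow> (nat \<Rightarrow> nat \<Rightarrow> 'a) \<Rightarrow> val"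
  where "enc_mat enc n m M = enc_vec (enc_vec enc m) n M"

fun enc_option :: "val option \<Rightarrow> val"
  where
    "enc_option None = Atom 0"
  | "enc_option (Some v) = Cell (Atom 1) v"


section \<open>The algorithmic problems\<close>

text \<open>
  Polynomial time in the dimension only makes sense for a family of polytopes. The member \<open>Q d\<close>
  lies in dimension \<open>m d\<close> and is presented to algorithms through the code word \<open>code d\<close>.
  A sequence with one polytope in each dimension is the case \<open>m d = d\<close>, \<open>code d = enc_nat d\<close>;
  for polytopes given by combinatorial objects, such as graphs, \<open>code d\<close> describes the object.

  In both problems over \<open>Q d\<close> running time is measured in the dimension and the encoding size of
  the rational input vector.
\<close>

definition polytope_separation ::
  "('d \<Rightarrow> (nat \<Rightarrow> real) set) \<Rightarrow> ('d \<Rightarrow> nat) \<Rightarrow> ('d \<Rightarrow> val) \<Rightarrow> (val \<times> nat \<times> val set) set"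
  where "polytope_separation Q m code =
    {(enc_list [code d, enc_vec enc_rat (m d) u],
      m d + val_size (enc_vec enc_rat (m d) u),
      {w. if real_vec u \<in> Q d then w = enc_option None
          else \<exists>c \<in> vecs (m d). \<exists>\<beta>.
            w = enc_option (Some (enc_list [enc_vec enc_rat (m d) c, enc_rat \<beta>])) \<and>
            dot (m d) c u < \<beta> \<and>
            (\<forall>q \<in> Q d. of_rat \<beta> \<le> dot (m d) (real_vec c) q)}) | d u. u \<in> vecs (m d)}"

text \<open>On an empty polytope the optimization algorithm has to report that there is no point. The
  returned minimizer need not be a vertex, which makes the assumption weaker.\<close>

definition polytope_optimization ::
  "('d \<Rightarrow> (nat \<Rightarrow> real) set) \<Rightarrow> ('d \<Rightarrow> nat) \<Rightarrow> ('d \<Rightarrow> val) \<Rightarrow> (val \<times> nat \<times> val set) set"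
  where "polytope_optimization Q m code =
    {(enc_list [code d, enc_vec enc_rat (m d) c],
      m d + val_size (enc_vec enc_rat (m d) c),
      {w. if Q d = {} then w = enc_option None
          else \<exists>u \<in> vecs (m d).
            w = enc_option (Some (enc_vec enc_rat (m d) u)) \<and>
            real_vec u \<in> Q d \<and>
            (\<forall>q \<in> Q d. dot (m d) (real_vec c) (real_vec u) \<le> dot (m d) (real_vec c) q)}) |
      d c. c \<in> vecs (m d)}"

text \<open>The bound on the length of code words is part of polynomiality in the dimension alone:
  otherwise an algorithm could not even read \<open>code d\<close> within the allowed time.\<close>

definition tractable ::
  "('d \<Rightarrow> (nat \<Rightarrow> real) set) \<Rightarrow> ('d \<Rightarrow> nat) \<Rightarrow> ('d \<Rightarrow> val) \<Rightarrow> bool"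
  where "tractable Q m code \<longleftrightarrow>
    (\<exists>f :: nat poly. \<forall>d. val_size (code d) \<le> poly f (m d)) \<and>
    poly_time_solvable (polytope_separation Q m code) \<and>
    poly_time_solvable (polytope_optimization Q m code)"

text \<open>The set \<open>X\<close> is not part of the input; it only restricts the points that have to be handled.\<close>

definition family_separation ::
  "('d \<Rightarrow> (nat \<Rightarrow> real) set) \<Rightarrow> ('d \<Rightarrow> nat) \<Rightarrow> ('d \<Rightarrow> val) \<Rightarrow> (val \<times> nat \<times> val set) set"
  where "family_separation Q m code =
    {(enc_list [code d, enc_nat n, enc_nat (m d), enc_nat k,
        enc_mat enc_rat n (m d) A, enc_vec enc_rat n a, enc_rat b, enc_vec enc_rat n x],
      k + m d + n + val_size (enc_list
        [enc_mat enc_rat n (m d) A, enc_vec enc_rat n a, enc_rat b, enc_vec enc_rat n x]),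
      {w. if \<forall>y \<in> Y_Q k (m d) (Q d). satisfies_ineq n (m d) k A a b x y
          then w = enc_option None
          else \<exists>y \<in> Y_Q k (m d) (Q d).
            w = enc_option (Some (enc_vec enc_nat (m d) y)) \<and>
            \<not> satisfies_ineq n (m d) k A a b x y}) |
      d n k A a b x X.
      k \<ge> 1 \<and> A \<in> mats n (m d) \<and> a \<in> vecs n \<and> X \<subseteq> vecs n \<and> x \<in> vecs n \<and> real_vec x \<in> X}"

end

theory Submission
  imports Defs
begin

text \<open>
  For a fixed point $x$ the inequality is affine in $y$ with cost vector $c = A^T x$, so it is
  enough to minimize $c^T y$ over $Y_{k,Q}$. Its elements are exactly the sums of $k$ distinct binary
  points of $Q$ (\<open>Y_Q_iff\<close>), hence a minimizer is the sum of the $k$ cheapest binary points of $Q$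
  with respect to $c$.

  These are found by a beam search over prefixes. The value of a 0/1 prefix of length $j$
  is the least cost of a binary point of $Q$ that extends it. Passing from $j$ to $j + 1$, every kept
  prefix is extended in both ways, and among the extensions that occur in $Q$ at most $k$ of least
  value are kept. Discarding a prefix is harmless: it happens only if $k$ prefixes of no greater
  value are kept, these are extended by $k$ distinct points, and each of these points is at most as
  expensive as any point with a discarded prefix, so they can be exchanged for such points
  (\<open>beam_invariant\<close>). After the last coordinate the kept prefixes are the $k$ cheapest points, and
  fewer than $k$ remain only if $Q$ has fewer than $k$ binary points (\<open>beam_best\<close>).

  The value of a prefix takes one call of the optimization oracle for $Q$. On binary points the
  Hamming distance to the prefix is an affine function; adding it to the cost with a factor larger
  than the spread of all costs makes the minimum reveal both whether the prefix occurs and what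
  its value is (\<open>node_value_extensions\<close>). The oracle may return a point that is not a vertex, but only
  its objective value is used, and that value is attained at a vertex, which is binary
  (\<open>min_at_binary_point\<close>, \<open>node_num_eq\<close>).

  The programming language has integers without division. Costs are therefore scaled to integers by
  the product of all denominators (\<open>coef_eq\<close>), and the values returned by the oracle are compared as
  unreduced fractions (\<open>ptime_select_indices\<close>).

  For the running time, \<open>ptime D N e g\<close> says that \<open>g x\<close> can be computed from \<open>e x\<close> in polynomial
  time, uniformly in \<open>x\<close>. This relation is closed under composition, arithmetic, case distinction
  and loops with polynomially bounded states (\<open>ptime_loop\<close>), and running time bounds output size
  (\<open>exec_size\<close>). With sums, products, table construction and table lookup derived from
  it, the bound for the algorithm follows the structure of its defining formulas. Intermediate
  results are recomputed wherever they are needed, so that a loop body depends on nothing but the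
  input, the loop counters and the current state.
\<close>

section \<open>Polynomial bounds\<close>

lemma poly_nat_mono: "a \<le> b \<Longrightarrow> poly (F :: nat poly) a \<le> poly F b"
  by (induction F) (auto intro!: add_mono mult_mono)

text \<open>
  A function is measured against another function \<open>\<mu>\<close> on the instances in
  \<open>D\<close>; composing the bounding polynomials gives transitivity, so bounds may be
  chained through any intermediate quantity.
\<close>

definition poly_bounded :: "'x set \<Rightarrow> ('x \<Rightarrow> nat) \<Rightarrow> ('x \<Rightarrow> nat) \<Rightarrow> bool"
  where "poly_bounded D \<mu> h \<longleftrightarrow> (\<exists>F. \<forall>x\<in>D. h x \<le> poly F (\<mu> x))"

lemma poly_bounded_const: "poly_bounded D \<mu> (\<lambda>_. c)"
  unfolding poly_bounded_def by (rule exI[of _ "[:c:]"]) simp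

lemma poly_bounded_measure: "poly_bounded D \<mu> \<mu>"
  unfolding poly_bounded_def by (rule exI[of _ "[:0, 1:]"]) simp

lemma poly_bounded_add:
  "poly_bounded D \<mu> g \<Longrightarrow> poly_bounded D \<mu> h \<Longrightarrow> poly_bounded D \<mu> (\<lambda>x. g x + h x)"
  unfolding poly_bounded_def by (metis add_mono poly_add)

lemma poly_bounded_mult:
  "poly_bounded D \<mu> g \<Longrightarrow> poly_bounded D \<mu> h \<Longrightarrow> poly_bounded D \<mu> (\<lambda>x. g x * h x)"
  unfolding poly_bounded_def by (metis mult_le_mono poly_mult)

lemma poly_bounded_le:
  "poly_bounded D \<mu> h \<Longrightarrow> (\<And>x. x \<in> D \<Longrightarrow> g x \<le> h x) \<Longrightarrow> poly_bounded D \<mu> g"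
  unfolding poly_bounded_def by (meson order_trans)

lemma poly_bounded_trans:
  assumes "poly_bounded D \<mu> \<nu>" "poly_bounded D \<nu> h"
  shows "poly_bounded D \<mu> h"
proof -
  obtain F G where F: "\<forall>x\<in>D. \<nu> x \<le> poly F (\<mu> x)" and G: "\<forall>x\<in>D. h x \<le> poly G (\<nu> x)"
    using assms unfolding poly_bounded_def by blast
  have "h x \<le> poly (G \<circ>\<^sub>p F) (\<mu> x)" if "x \<in> D" for x
    using F G that poly_nat_mono[of "\<nu> x" "poly F (\<mu> x)" G] by (auto simp: poly_pcompose intro: order_trans)
  then show ?thesis unfolding poly_bounded_def by blast
qed

lemma poly_bounded_reindex:
  assumes "poly_bounded D \<mu> h" "\<And>y. y \<in> D' \<Longrightarrow> r y \<in> D" "\<And>y. y \<in> D' \<Longrightarrow> \<mu> (r y) \<le> \<mu>' y"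
  shows "poly_bounded D' \<mu>' (\<lambda>y. h (r y))"
proof -
  obtain F where F: "\<forall>x\<in>D. h x \<le> poly F (\<mu> x)"
    using assms unfolding poly_bounded_def by blast
  have "h (r y) \<le> poly F (\<mu>' y)" if "y \<in> D'" for y
    using F assms(2,3)[OF that] poly_nat_mono[of "\<mu> (r y)" "\<mu>' y" F] by (meson order_trans)
  then show ?thesis unfolding poly_bounded_def by blast
qed

lemmas poly_bounded_intros = poly_bounded_const poly_bounded_measure poly_bounded_add poly_bounded_mult

section \<open>Sizes of numbers and of stored values\<close>

lemma floorlog_add_le: "floorlog 2 (a + b) \<le> floorlog 2 a + floorlog 2 b + 1"
proof -
  have "a < 2 ^ floorlog 2 a" "b < 2 ^ floorlog 2 b"
    by (rule floorlog_leD; simp)+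
  moreover have "2 ^ floorlog 2 a \<le> (2 :: nat) ^ (floorlog 2 a + floorlog 2 b)"
    and "2 ^ floorlog 2 b \<le> (2 :: nat) ^ (floorlog 2 a + floorlog 2 b)"
    by (simp_all add: power_increasing)
  ultimately have "a + b < 2 * 2 ^ (floorlog 2 a + floorlog 2 b)"
    by linarith
  then have "a + b < 2 ^ (floorlog 2 a + floorlog 2 b + 1)"
    by simp
  then show ?thesis by (simp add: floorlog_leI)
qed

lemma floorlog_mult_le: "floorlog 2 (a * b) \<le> floorlog 2 a + floorlog 2 b"
proof -
  have "a < 2 ^ floorlog 2 a" "b < 2 ^ floorlog 2 b"
    by (rule floorlog_leD; simp)+
  then have "a * b < 2 ^ (floorlog 2 a + floorlog 2 b)"
    by (simp add: power_add mult_strict_mono)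
  then show ?thesis by (simp add: floorlog_leI)
qed

lemma val_size_Atom_add: "val_size (Atom (a + b)) \<le> val_size (Atom a) + val_size (Atom b)"
proof -
  have "floorlog 2 (nat \<bar>a + b\<bar>) \<le> floorlog 2 (nat \<bar>a\<bar> + nat \<bar>b\<bar>)"
    by (intro floorlog_mono) linarith
  also have "\<dots> \<le> floorlog 2 (nat \<bar>a\<bar>) + floorlog 2 (nat \<bar>b\<bar>) + 1"
    by (rule floorlog_add_le)
  finally show ?thesis by simp
qed

lemma val_size_Atom_diff: "val_size (Atom (a - b)) \<le> val_size (Atom a) + val_size (Atom b)"
  using val_size_Atom_add[of a "- b"] by simp

lemma val_size_Atom_mult: "val_size (Atom (a * b)) \<le> val_size (Atom a) + val_size (Atom b)"
  using floorlog_mult_le[of "nat \<bar>a\<bar>" "nat \<bar>b\<bar>"] by (simp add: abs_mult nat_mult_distrib)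

lemma floorlog_0: "floorlog 2 0 = 0"
  by (simp add: floorlog_def)

lemma floorlog_1: "floorlog 2 (Suc 0) = 1"
  by (simp add: floorlog_def)

lemma val_size_Atom_nat: "val_size (Atom (int n)) \<le> n + 1"
  using less_exp[of n] by (simp add: floorlog_le_iff)

lemma val_size_eval_le_cost: "val_size (eval_expr a s) \<le> cost a s"
  by (cases a) auto

text \<open>
  A step pays for every value that it writes. Hence running time bounds the size of the output,
  and a polynomial-time program has polynomially sized results without a separate proof.
\<close>

lemma exec_size: "exec p s t s' \<Longrightarrow> val_size (s' i) \<le> val_size (s i) + t"
proof (induction arbitrary: i rule: exec.induct)
  case (Assign j a s)
  then show ?case using val_size_eval_le_cost[of a s] by auto
next
  case (Seq p s t s' q t' s'')
  then show ?case by (smt (verit) add.assoc le_add2 add.commute add_le_mono1 order_trans)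
next
  case (CondTrue e s p t s' q)
  then show ?case by (meson add_left_mono le_add2 order_trans)
next
  case (CondFalse e s q t s' p)
  then show ?case by (meson add_left_mono le_add2 order_trans)
next
  case (WhileTrue e s p t s' t' s'')
  have "val_size (s'' i) \<le> val_size (s' i) + t'" "val_size (s' i) \<le> val_size (s i) + t"
    using WhileTrue by blast+
  then show ?case by linarith
qed auto

section \<open>Polynomial-time computability\<close>

text \<open>
  One program and one polynomial serve all instances \<open>x\<close> in \<open>D\<close>: from
  the encoding \<open>e x\<close> the program computes \<open>g x\<close>. Both are functions of
  an instance of arbitrary type, so that intermediate results and loop variables enter as
  further components of the instance. The budget is polynomial in \<open>N x + val_size (e
  x)\<close>; the extra summand \<open>N x\<close> accounts for numbers such as \<open>k\<close>, which are
  written in binary but may be counted up to.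
\<close>

definition ptime :: "'x set \<Rightarrow> ('x \<Rightarrow> nat) \<Rightarrow> ('x \<Rightarrow> val) \<Rightarrow> ('x \<Rightarrow> val) \<Rightarrow> bool"
  where "ptime D N e g \<longleftrightarrow> (\<exists>p T. poly_bounded D (\<lambda>x. N x + val_size (e x)) T \<and>
    (\<forall>x\<in>D. \<exists>s. exec p (init_store (e x)) (T x) s \<and> s 0 = g x))"

lemma ptimeE:
  assumes "ptime D N e g"
  obtains p T where "poly_bounded D (\<lambda>x. N x + val_size (e x)) T"
    and "\<And>x. x \<in> D \<Longrightarrow> \<exists>s. exec p (init_store (e x)) (T x) s \<and> s 0 = g x"
proof -
  obtain p T where "poly_bounded D (\<lambda>x. N x + val_size (e x)) T"
    "\<forall>x\<in>D. \<exists>s. exec p (init_store (e x)) (T x) s \<and> s 0 = g x"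
    using assms unfolding ptime_def by blast
  then show ?thesis by (intro that) auto
qed

lemma ptimeI:
  assumes "poly_bounded D (\<lambda>x. N x + val_size (e x)) T"
    and "\<And>x. x \<in> D \<Longrightarrow> \<exists>t s. exec p (init_store (e x)) t s \<and> t \<le> T x \<and> s 0 = g x"
  shows "ptime D N e g"
proof -
  obtain t where t: "\<forall>x\<in>D. \<exists>s. exec p (init_store (e x)) (t x) s \<and> t x \<le> T x \<and> s 0 = g x"
    using assms(2) by (metis (no_types, lifting))
  then have "poly_bounded D (\<lambda>x. N x + val_size (e x)) t"
    using poly_bounded_le[OF assms(1)] by blast
  then show ?thesis unfolding ptime_def using t by blast
qed

lemma ptime_size:
  assumes "ptime D N e g"
  shows "poly_bounded D (\<lambda>x. N x + val_size (e x)) (\<lambda>x. val_size (g x))"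
proof -
  obtain p T where T: "poly_bounded D (\<lambda>x. N x + val_size (e x)) T"
    and p: "\<And>x. x \<in> D \<Longrightarrow> \<exists>s. exec p (init_store (e x)) (T x) s \<and> s 0 = g x"
    using assms by (rule ptimeE) blast
  show ?thesis
  proof (rule poly_bounded_le)
    show "poly_bounded D (\<lambda>x. N x + val_size (e x)) (\<lambda>x. (N x + val_size (e x)) + T x)"
      by (intro poly_bounded_intros T)
    show "val_size (g x) \<le> (N x + val_size (e x)) + T x" if "x \<in> D" for x
      using p[OF that] exec_size[of p "init_store (e x)" "T x" _ 0]
      by (fastforce simp: init_store_def)
  qed
qed

lemma exec_Call:
  assumes "\<exists>s'. exec p (init_store (eval_expr a s)) t s' \<and> s' 0 = v"
  shows "exec (Call i p a) s (1 + cost a s + t + val_size v) (s(i := v))"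
  using assms exec.Call by blast

lemma ptime_env: "ptime D N e e"
proof (rule ptimeI[where p = "Assign 0 (Var 0)" and T = "\<lambda>x. 1 + (N x + val_size (e x))"])
  show "poly_bounded D (\<lambda>x. N x + val_size (e x)) (\<lambda>x. 1 + (N x + val_size (e x)))"
    by (intro poly_bounded_intros)
  show "\<exists>t s. exec (Assign 0 (Var 0)) (init_store (e x)) t s \<and> t \<le> 1 + (N x + val_size (e x)) \<and> s 0 = e x" for x
    using exec.Assign[of 0 "Var 0" "init_store (e x)"] by (force simp: init_store_def)
qed

lemma ptime_cong:
  "ptime D N e g \<Longrightarrow> (\<And>x. x \<in> D \<Longrightarrow> g x = g' x) \<Longrightarrow> ptime D N e g'"
  unfolding ptime_def by metis

lemma ptime_const: "ptime D N e (\<lambda>_. Atom c)"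
proof (rule ptimeI[where p = "Assign 0 (Const c)" and T = "\<lambda>x. 1 + val_size (Atom c)"])
  show "poly_bounded D (\<lambda>x. N x + val_size (e x)) (\<lambda>x. 1 + val_size (Atom c))"
    by (intro poly_bounded_intros)
  show "\<exists>t s. exec (Assign 0 (Const c)) (init_store (e x)) t s \<and> t \<le> 1 + val_size (Atom c) \<and> s 0 = Atom c" for x
    using exec.Assign[of 0 "Const c" "init_store (e x)"] by (force simp: init_store_def)
qed

lemma ptime_trans:
  assumes "ptime D N e g" "ptime D N g h"
  shows "ptime D N e h"
proof -
  let ?\<mu> = "\<lambda>x. N x + val_size (e x)"
  obtain p T where T: "poly_bounded D ?\<mu> T"
    and p: "\<And>x. x \<in> D \<Longrightarrow> \<exists>s. exec p (init_store (e x)) (T x) s \<and> s 0 = g x"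
    using assms(1) by (rule ptimeE) blast
  obtain q U where U: "poly_bounded D (\<lambda>x. N x + val_size (g x)) U"
    and q: "\<And>x. x \<in> D \<Longrightarrow> \<exists>s. exec q (init_store (g x)) (U x) s \<and> s 0 = h x"
    using assms(2) by (rule ptimeE) blast
  have sg: "poly_bounded D ?\<mu> (\<lambda>x. val_size (g x))"
    using assms(1) by (rule ptime_size)
  have "poly_bounded D ?\<mu> (\<lambda>x. ?\<mu> x + val_size (g x))"
    by (intro poly_bounded_intros sg)
  then have "poly_bounded D ?\<mu> (\<lambda>x. N x + val_size (g x))"
    by (rule poly_bounded_le) simp
  then have U': "poly_bounded D ?\<mu> U" and sh: "poly_bounded D ?\<mu> (\<lambda>x. val_size (h x))"
    using U ptime_size[OF assms(2)] by (blast intro: poly_bounded_trans)+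
  show ?thesis
  proof (rule ptimeI)
    show "poly_bounded D ?\<mu> (\<lambda>x. 3 + ?\<mu> x + 2 * val_size (g x) + val_size (h x) + T x + U x)"
      by (intro poly_bounded_intros T U' sg sh)
    fix x assume x: "x \<in> D"
    let ?s = "(init_store (e x))(0 := g x)"
    have "exec (Call 0 p (Var 0)) (init_store (e x)) (1 + cost (Var 0) (init_store (e x)) + T x + val_size (g x)) ?s"
      using p[OF x] by (intro exec_Call) (simp add: init_store_def)
    moreover have "exec (Call 0 q (Var 0)) ?s (1 + cost (Var 0) ?s + U x + val_size (h x)) (?s(0 := h x))"
      using q[OF x] by (intro exec_Call) simp
    ultimately show "\<exists>t s. exec (Seq (Call 0 p (Var 0)) (Call 0 q (Var 0))) (init_store (e x)) t s \<and>
        t \<le> 3 + ?\<mu> x + 2 * val_size (g x) + val_size (h x) + T x + U x \<and> s 0 = h x"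
      by (intro exI conjI, rule exec.Seq) (auto simp: init_store_def)
  qed
qed

lemma ptime_reindex:
  assumes "ptime D N e g" "\<And>y. y \<in> D' \<Longrightarrow> r y \<in> D" "\<And>y. y \<in> D' \<Longrightarrow> N (r y) \<le> N' y"
  shows "ptime D' N' (\<lambda>y. e (r y)) (\<lambda>y. g (r y))"
proof -
  obtain p T where T: "poly_bounded D (\<lambda>x. N x + val_size (e x)) T"
    and p: "\<And>x. x \<in> D \<Longrightarrow> \<exists>s. exec p (init_store (e x)) (T x) s \<and> s 0 = g x"
    using assms(1) by (rule ptimeE) blast
  have "poly_bounded D' (\<lambda>y. N' y + val_size (e (r y))) (\<lambda>y. T (r y))"
    by (rule poly_bounded_reindex[OF T]) (use assms(2,3) in auto)
  then show ?thesis unfolding ptime_def using p assms(2) by blast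
qed

text \<open>
  The workhorse for moving a computation into another environment: whenever the environment
  \<open>e'\<close> suffices to compute the input \<open>e (r y)\<close>, it suffices to compute
  the result for \<open>r y\<close>.
\<close>

lemma ptime_subst:
  assumes "ptime D N e g" "ptime D' N' e' (\<lambda>y. e (r y))"
    "\<And>y. y \<in> D' \<Longrightarrow> r y \<in> D" "\<And>y. y \<in> D' \<Longrightarrow> N (r y) \<le> N' y"
  shows "ptime D' N' e' (\<lambda>y. g (r y))"
  by (rule ptime_trans[OF assms(2) ptime_reindex[OF assms(1,3,4)]])

text \<open>
  The conditions bound the cost of a single expression in variable 0 by the sizes of its
  argument and value, which all unary operations satisfy.
\<close>

lemma ptime_unary:
  assumes "\<And>x. x \<in> D \<Longrightarrow> eval_expr a (init_store (e x)) = g x"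
    "\<And>x. x \<in> D \<Longrightarrow> cost a (init_store (e x)) \<le> val_size (e x) + val_size (g x)"
    "\<And>x. x \<in> D \<Longrightarrow> val_size (g x) \<le> val_size (e x) + 2"
  shows "ptime D N e g"
proof (rule ptimeI[where p = "Assign 0 a" and T = "\<lambda>x. 3 + 2 * (N x + val_size (e x))"])
  show "poly_bounded D (\<lambda>x. N x + val_size (e x)) (\<lambda>x. 3 + 2 * (N x + val_size (e x)))"
    by (intro poly_bounded_intros)
  show "\<exists>t s. exec (Assign 0 a) (init_store (e x)) t s \<and> t \<le> 3 + 2 * (N x + val_size (e x)) \<and> s 0 = g x"
    if "x \<in> D" for x
    by (intro exI conjI, rule exec.Assign) (use assms[OF that] in auto)
qed

lemma ptime_left:
  assumes "ptime D N e (\<lambda>x. Cell (g x) (h x))"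
  shows "ptime D N e g"
  by (rule ptime_trans[OF assms], rule ptime_unary[where a = "Left (Var 0)"]) (auto simp: init_store_def)

lemma ptime_right:
  assumes "ptime D N e (\<lambda>x. Cell (g x) (h x))"
  shows "ptime D N e h"
  by (rule ptime_trans[OF assms], rule ptime_unary[where a = "Right (Var 0)"]) (auto simp: init_store_def)

lemma val_size_right_of: "val_size (right_of v) \<le> val_size v"
  by (cases v) (auto simp: floorlog_def)

lemma ptime_right_of:
  assumes "ptime D N e g"
  shows "ptime D N e (\<lambda>x. right_of (g x))"
  by (rule ptime_trans[OF assms], rule ptime_unary[where a = "Right (Var 0)"])
    (use val_size_right_of in \<open>auto simp: init_store_def intro: le_SucI\<close>)

lemma ptime_is_cell:
  assumes "ptime D N e g"
  shows "ptime D N e (\<lambda>x. Atom (of_bool (\<exists>u v. g x = Cell u v)))"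
  by (rule ptime_trans[OF assms], rule ptime_unary[where a = "IsCell (Var 0)"])
    (auto simp: init_store_def floorlog_0 floorlog_1 split: val.split)

text \<open>
  The two arguments are computed into variables 1 and 2 by separate calls, both on the untouched
  input in variable 0.
\<close>

lemma ptime_binary:
  assumes g: "ptime D N e g" and h: "ptime D N e h"
    and cost: "\<And>s. cost a s = val_size (s 1) + val_size (s 2) + val_size (eval_expr a s)"
    and eval: "\<And>x s. x \<in> D \<Longrightarrow> s 1 = g x \<Longrightarrow> s 2 = h x \<Longrightarrow> eval_expr a s = f x"
    and size: "\<And>x. x \<in> D \<Longrightarrow> val_size (f x) \<le> 2 + val_size (g x) + val_size (h x)"
  shows "ptime D N e f"
proof -
  let ?\<mu> = "\<lambda>x. N x + val_size (e x)"
  obtain p T where T: "poly_bounded D ?\<mu> T"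
    and p: "\<And>x. x \<in> D \<Longrightarrow> \<exists>s. exec p (init_store (e x)) (T x) s \<and> s 0 = g x"
    using g by (rule ptimeE) blast
  obtain q U where U: "poly_bounded D ?\<mu> U"
    and q: "\<And>x. x \<in> D \<Longrightarrow> \<exists>s. exec q (init_store (e x)) (U x) s \<and> s 0 = h x"
    using h by (rule ptimeE) blast
  show ?thesis
  proof (rule ptimeI)
    show "poly_bounded D ?\<mu> (\<lambda>x. 7 + 2 * ?\<mu> x + 3 * (val_size (g x) + val_size (h x)) + T x + U x)"
      by (intro poly_bounded_intros T U ptime_size g h)
    fix x assume x: "x \<in> D"
    let ?s1 = "(init_store (e x))(1 := g x)"
    let ?s2 = "?s1(2 := h x)"
    have "exec (Call 1 p (Var 0)) (init_store (e x)) (1 + cost (Var 0) (init_store (e x)) + T x + val_size (g x)) ?s1"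
      using p[OF x] by (intro exec_Call) (simp add: init_store_def)
    moreover have "exec (Call 2 q (Var 0)) ?s1 (1 + cost (Var 0) ?s1 + U x + val_size (h x)) ?s2"
      using q[OF x] by (intro exec_Call) (simp add: init_store_def)
    moreover have "exec (Assign 0 a) ?s2 (1 + cost a ?s2) (?s2(0 := eval_expr a ?s2))"
      by (rule exec.Assign)
    ultimately have "exec (Seq (Call 1 p (Var 0)) (Seq (Call 2 q (Var 0)) (Assign 0 a))) (init_store (e x))
      (1 + (1 + cost (Var 0) (init_store (e x)) + T x + val_size (g x)) +
       (1 + (1 + cost (Var 0) ?s1 + U x + val_size (h x)) + (1 + cost a ?s2))) (?s2(0 := eval_expr a ?s2))"
      by (intro exec.Seq)
    note run = this
    have "eval_expr a ?s2 = f x" using eval[OF x, of ?s2] by simp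
    with size[OF x] show "\<exists>t s. exec (Seq (Call 1 p (Var 0)) (Seq (Call 2 q (Var 0)) (Assign 0 a))) (init_store (e x)) t s \<and>
        t \<le> 7 + 2 * ?\<mu> x + 3 * (val_size (g x) + val_size (h x)) + T x + U x \<and> s 0 = f x"
      by - (intro exI conjI, rule run, auto simp: cost init_store_def)
  qed
qed

lemma ptime_Cell:
  "ptime D N e g \<Longrightarrow> ptime D N e h \<Longrightarrow> ptime D N e (\<lambda>x. Cell (g x) (h x))"
  by (erule (1) ptime_binary[where a = "MkCell (Var 1) (Var 2)"]) auto

lemma ptime_add:
  "ptime D N e (\<lambda>x. Atom (a x)) \<Longrightarrow> ptime D N e (\<lambda>x. Atom (b x)) \<Longrightarrow> ptime D N e (\<lambda>x. Atom (a x + b x))"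
  by (erule (1) ptime_binary[where a = "Add (Var 1) (Var 2)"])
    (auto simp del: val_size.simps intro: order_trans[OF val_size_Atom_add])

lemma ptime_diff:
  "ptime D N e (\<lambda>x. Atom (a x)) \<Longrightarrow> ptime D N e (\<lambda>x. Atom (b x)) \<Longrightarrow> ptime D N e (\<lambda>x. Atom (a x - b x))"
  by (erule (1) ptime_binary[where a = "Sub (Var 1) (Var 2)"])
    (auto simp del: val_size.simps intro: order_trans[OF val_size_Atom_diff])

lemma ptime_mult:
  "ptime D N e (\<lambda>x. Atom (a x)) \<Longrightarrow> ptime D N e (\<lambda>x. Atom (b x)) \<Longrightarrow> ptime D N e (\<lambda>x. Atom (a x * b x))"
  by (erule (1) ptime_binary[where a = "Mul (Var 1) (Var 2)"])
    (auto simp del: val_size.simps intro: order_trans[OF val_size_Atom_mult])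

lemma ptime_less:
  "ptime D N e (\<lambda>x. Atom (a x)) \<Longrightarrow> ptime D N e (\<lambda>x. Atom (b x)) \<Longrightarrow>
    ptime D N e (\<lambda>x. Atom (of_bool (a x < b x)))"
  by (erule (1) ptime_binary[where a = "Less (Var 1) (Var 2)"])
    (auto simp: floorlog_0 floorlog_1)

text \<open>
  Each branch has to be computable only on the instances that reach it. This matters for
  branches that consult the oracle or read a list entry, which are meaningful only there.
\<close>

lemma ptime_if:
  assumes P: "ptime D N e (\<lambda>x. Atom (of_bool (P x)))"
    and g: "ptime {x \<in> D. P x} N e g" and h: "ptime {x \<in> D. \<not> P x} N e h"
  shows "ptime D N e (\<lambda>x. if P x then g x else h x)"
proof -
  let ?\<mu> = "\<lambda>x. N x + val_size (e x)"
  obtain p T where T: "poly_bounded D ?\<mu> T"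
    and p: "\<And>x. x \<in> D \<Longrightarrow> \<exists>s. exec p (init_store (e x)) (T x) s \<and> s 0 = Atom (of_bool (P x))"
    using P by (rule ptimeE) blast
  obtain q U where U: "poly_bounded {x \<in> D. P x} ?\<mu> U"
    and q: "\<And>x. x \<in> {x \<in> D. P x} \<Longrightarrow> \<exists>s. exec q (init_store (e x)) (U x) s \<and> s 0 = g x"
    using g by (rule ptimeE) blast
  obtain r V where V: "poly_bounded {x \<in> D. \<not> P x} ?\<mu> V"
    and r: "\<And>x. x \<in> {x \<in> D. \<not> P x} \<Longrightarrow> \<exists>s. exec r (init_store (e x)) (V x) s \<and> s 0 = h x"
    using h by (rule ptimeE) blast
  have merge: "poly_bounded D ?\<mu> (\<lambda>x. if P x then u x else v x)"
    if uv: "poly_bounded {x \<in> D. P x} ?\<mu> u" "poly_bounded {x \<in> D. \<not> P x} ?\<mu> v" for u v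
  proof -
    obtain F where F: "\<forall>x\<in>{x \<in> D. P x}. u x \<le> poly F (?\<mu> x)"
      using uv(1) unfolding poly_bounded_def by blast
    obtain G where G: "\<forall>x\<in>{x \<in> D. \<not> P x}. v x \<le> poly G (?\<mu> x)"
      using uv(2) unfolding poly_bounded_def by blast
    from F G have "\<forall>x\<in>D. (if P x then u x else v x) \<le> poly (F + G) (?\<mu> x)"
      by (auto intro: trans_le_add1 trans_le_add2)
    then show ?thesis unfolding poly_bounded_def by blast
  qed
  let ?prog = "Seq (Call 1 p (Var 0)) (Cond (Var 1) (Call 0 q (Var 0)) (Call 0 r (Var 0)))"
  show ?thesis
  proof (rule ptimeI)
    show "poly_bounded D ?\<mu> (\<lambda>x. 8 + 2 * ?\<mu> x + T x + (if P x then U x + val_size (g x) else V x + val_size (h x)))"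
      by (intro poly_bounded_intros T merge U V ptime_size[OF g] ptime_size[OF h])
    fix x assume x: "x \<in> D"
    let ?s1 = "(init_store (e x))(1 := Atom (of_bool (P x)))"
    have 1: "exec (Call 1 p (Var 0)) (init_store (e x))
        (1 + cost (Var 0) (init_store (e x)) + T x + val_size (Atom (of_bool (P x)))) ?s1"
      using p[OF x] by (intro exec_Call) (simp add: init_store_def)
    show "\<exists>t s. exec ?prog (init_store (e x)) t s \<and>
        t \<le> 8 + 2 * ?\<mu> x + T x + (if P x then U x + val_size (g x) else V x + val_size (h x)) \<and>
        s 0 = (if P x then g x else h x)"
    proof (cases "P x")
      case True
      have "exec (Call 0 q (Var 0)) ?s1 (1 + cost (Var 0) ?s1 + U x + val_size (g x)) (?s1(0 := g x))"
        using q[of x] x True by (intro exec_Call) (simp add: init_store_def)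
      then have "exec (Cond (Var 1) (Call 0 q (Var 0)) (Call 0 r (Var 0))) ?s1
          (1 + cost (Var 1) ?s1 + (1 + cost (Var 0) ?s1 + U x + val_size (g x))) (?s1(0 := g x))"
        using True by (intro exec.CondTrue) auto
      from exec.Seq[OF 1 this] show ?thesis
        using True by - (intro exI conjI, assumption, auto simp: init_store_def floorlog_1)
    next
      case False
      have "exec (Call 0 r (Var 0)) ?s1 (1 + cost (Var 0) ?s1 + V x + val_size (h x)) (?s1(0 := h x))"
        using r[of x] x False by (intro exec_Call) (simp add: init_store_def)
      then have "exec (Cond (Var 1) (Call 0 q (Var 0)) (Call 0 r (Var 0))) ?s1
          (1 + cost (Var 1) ?s1 + (1 + cost (Var 0) ?s1 + V x + val_size (h x))) (?s1(0 := h x))"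
        using False by (intro exec.CondFalse) auto
      from exec.Seq[OF 1 this] show ?thesis
        using False by - (intro exI conjI, assumption, auto simp: init_store_def floorlog_0)
    qed
  qed
qed

lemma ptime_subdomain:
  assumes "ptime D N e g" "D' \<subseteq> D"
  shows "ptime D' N e g"
  using ptime_reindex[OF assms(1), of D' "\<lambda>x. x" N] assms(2) by auto

lemma ptime_not:
  "ptime D N e (\<lambda>x. Atom (of_bool (P x))) \<Longrightarrow> ptime D N e (\<lambda>x. Atom (of_bool (\<not> P x)))"
  by (rule ptime_cong[OF ptime_diff[OF ptime_const[of _ _ _ 1]]]) auto

lemma ptime_conj:
  "ptime D N e (\<lambda>x. Atom (of_bool (P x))) \<Longrightarrow> ptime D N e (\<lambda>x. Atom (of_bool (Q x))) \<Longrightarrow>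
    ptime D N e (\<lambda>x. Atom (of_bool (P x \<and> Q x)))"
  by (rule ptime_cong, erule (1) ptime_mult) auto

lemma ptime_disj:
  assumes "ptime D N e (\<lambda>x. Atom (of_bool (P x)))" "ptime D N e (\<lambda>x. Atom (of_bool (Q x)))"
  shows "ptime D N e (\<lambda>x. Atom (of_bool (P x \<or> Q x)))"
  using ptime_not[OF ptime_conj[OF ptime_not[OF assms(1)] ptime_not[OF assms(2)]]] by simp

lemma ptime_eq:
  assumes "ptime D N e (\<lambda>x. Atom (a x))" "ptime D N e (\<lambda>x. Atom (b x))"
  shows "ptime D N e (\<lambda>x. Atom (of_bool (a x = b x)))"
  by (rule ptime_cong[OF ptime_conj[OF ptime_not[OF ptime_less[OF assms]] ptime_not[OF ptime_less[OF assms(2,1)]]]])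
    auto


lemma poly_bounded_poly: "poly_bounded D \<mu> g \<Longrightarrow> poly_bounded D \<mu> (\<lambda>x. poly F (g x))"
  by (rule poly_bounded_trans[of _ _ g]) (auto simp: poly_bounded_def)

section \<open>Bounded loops\<close>

text \<open>
  Iterating a polynomial-time step a polynomial number of times may produce values of
  exponential size; a bound \<open>B\<close> on all states that occur rules this out. The state
  sequence \<open>S\<close> is a parameter and takes the place of a loop invariant: the loop body maps
  \<open>S x i\<close> to \<open>S x (Suc i)\<close>, with environment, counter and state packed
  into one value. Variables 0 to 3 hold environment, number of rounds, counter and state.
\<close>

lemma ptime_loop:
  assumes len: "ptime D N e (\<lambda>x. Atom (int (len x)))" and len_le: "\<And>x. x \<in> D \<Longrightarrow> len x \<le> N x"
    and init: "ptime D N e (\<lambda>x. S x 0)"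
    and step: "ptime {y. fst y \<in> D \<and> snd y < len (fst y)} (\<lambda>y. N (fst y))
      (\<lambda>y. Cell (Cell (e (fst y)) (Atom (int (snd y)))) (S (fst y) (snd y)))
      (\<lambda>y. S (fst y) (Suc (snd y)))"
    and size: "poly_bounded D (\<lambda>x. N x + val_size (e x)) B"
      "\<And>x i. x \<in> D \<Longrightarrow> i \<le> len x \<Longrightarrow> val_size (S x i) \<le> B x"
  shows "ptime D N e (\<lambda>x. S x (len x))"
proof -
  let ?\<mu> = "\<lambda>x. N x + val_size (e x)"
  let ?\<sigma> = "\<lambda>x i. (init_store (e x))(1 := Atom (int (len x)), 2 := Atom (int i), 3 := S x i)"
  obtain pl Tl where Tl: "poly_bounded D ?\<mu> Tl"
    and pl: "\<And>x. x \<in> D \<Longrightarrow> \<exists>s. exec pl (init_store (e x)) (Tl x) s \<and> s 0 = Atom (int (len x))"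
    using len by (rule ptimeE) blast
  obtain pi Ti where Ti: "poly_bounded D ?\<mu> Ti"
    and pi: "\<And>x. x \<in> D \<Longrightarrow> \<exists>s. exec pi (init_store (e x)) (Ti x) s \<and> s 0 = S x 0"
    using init by (rule ptimeE) blast
  obtain q T F where
      F: "\<And>x i. x \<in> D \<Longrightarrow> i < len x \<Longrightarrow>
        T (x, i) \<le> poly F (N x + val_size (Cell (Cell (e x) (Atom (int i))) (S x i)))"
    and q: "\<And>x i. x \<in> D \<Longrightarrow> i < len x \<Longrightarrow>
        \<exists>s. exec q (init_store (Cell (Cell (e x) (Atom (int i))) (S x i))) (T (x, i)) s \<and> s 0 = S x (Suc i)"
  proof -
    obtain q T where T: "poly_bounded {y. fst y \<in> D \<and> snd y < len (fst y)}
        (\<lambda>y. N (fst y) + val_size (Cell (Cell (e (fst y)) (Atom (int (snd y)))) (S (fst y) (snd y)))) T"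
      and q: "\<And>y. y \<in> {y. fst y \<in> D \<and> snd y < len (fst y)} \<Longrightarrow>
        \<exists>s. exec q (init_store (Cell (Cell (e (fst y)) (Atom (int (snd y)))) (S (fst y) (snd y)))) (T y) s \<and>
          s 0 = S (fst y) (Suc (snd y))"
      using step by (rule ptimeE) blast
    obtain F where F: "\<forall>y\<in>{y. fst y \<in> D \<and> snd y < len (fst y)}.
        T y \<le> poly F (N (fst y) + val_size (Cell (Cell (e (fst y)) (Atom (int (snd y)))) (S (fst y) (snd y))))"
      using T unfolding poly_bounded_def by blast
    show ?thesis
    proof (rule that[of T F q])
      fix x i assume "x \<in> D" "i < len x"
      then have "(x, i) \<in> {y. fst y \<in> D \<and> snd y < len (fst y)}" by simp
      from F[rule_format, OF this] q[OF this]
      show "T (x, i) \<le> poly F (N x + val_size (Cell (Cell (e x) (Atom (int i))) (S x i)))"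
        "\<exists>s. exec q (init_store (Cell (Cell (e x) (Atom (int i))) (S x i))) (T (x, i)) s \<and> s 0 = S x (Suc i)"
        by (simp_all only: fst_conv snd_conv)
    qed
  qed
  let ?W = "\<lambda>x. 3 + 2 * ?\<mu> x + B x"
  \<comment> \<open>The environment of the body has size at most \<open>?W x\<close>; \<open>K x\<close> bounds the time of
    one round, with generous constants for the fixed overhead.\<close>
  define K where "K x = 30 + 10 * ?W x + poly F (?W x)" for x
  have bound: "\<And>a b c d s n w B p. (d :: nat) \<le> p \<Longrightarrow> a \<le> 2 * n + 4 \<Longrightarrow> b \<le> 2 * n + 6 \<Longrightarrow>
      c \<le> 3 * w + 3 * n + 2 * B + 9 \<Longrightarrow> s \<le> B \<Longrightarrow>
      1 + a + (1 + (1 + c + d + s) + (1 + b)) \<le> 30 + 10 * (3 + 2 * (n + w) + B) + p"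
    by simp
  let ?guard = "Less (Var 2) (Var 1)"
  let ?body = "Seq (Call 3 q (MkCell (MkCell (Var 0) (Var 2)) (Var 3))) (Assign 2 (Add (Var 2) (Const 1)))"
  have loop: "\<exists>t. exec (While ?guard ?body) (?\<sigma> x i) t (?\<sigma> x (len x)) \<and> t \<le> Suc (len x - i) * K x"
    if x: "x \<in> D" and "i \<le> len x" for x i
    using that(2)
  proof (induction "len x - i" arbitrary: i)
    case 0
    then have i: "i = len x" by simp
    have run: "exec (While ?guard ?body) (?\<sigma> x i) (1 + cost ?guard (?\<sigma> x i)) (?\<sigma> x (len x))"
      unfolding i by (rule exec.WhileFalse) simp
    have "val_size (Atom (int (len x))) \<le> N x + 1"
      using val_size_Atom_nat[of "len x"] len_le[OF x] by linarith
    then have "1 + cost ?guard (?\<sigma> x i) \<le> Suc (len x - i) * K x"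
      unfolding i by (simp add: floorlog_0 K_def)
    then show ?case using run by blast
  next
    case (Suc n)
    then have i: "i < len x" by simp
    have sizes: "val_size (Atom (int i)) \<le> N x + 1" "val_size (Atom (int (Suc i))) \<le> N x + 1"
        "val_size (Atom (int (len x))) \<le> N x + 1"
        "val_size (S x i) \<le> B x" "val_size (S x (Suc i)) \<le> B x"
      using val_size_Atom_nat[of i] val_size_Atom_nat[of "Suc i"] val_size_Atom_nat[of "len x"]
        len_le[OF x] size(2)[OF x] i by (simp_all del: of_nat_Suc val_size.simps)
    let ?s = "(?\<sigma> x i)(3 := S x (Suc i))"
    let ?a = "MkCell (MkCell (Var 0) (Var 2)) (Var 3)"
    have 1: "exec (Call 3 q ?a) (?\<sigma> x i) (1 + cost ?a (?\<sigma> x i) + T (x, i) + val_size (S x (Suc i))) ?s"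
      using q[OF x i] by (intro exec_Call) (simp add: init_store_def)
    have "exec (Assign 2 (Add (Var 2) (Const 1))) ?s (1 + cost (Add (Var 2) (Const 1)) ?s)
        (?s(2 := eval_expr (Add (Var 2) (Const 1)) ?s))"
      by (rule exec.Assign)
    moreover have "?s(2 := eval_expr (Add (Var 2) (Const 1)) ?s) = ?\<sigma> x (Suc i)"
      by (auto simp: fun_eq_iff)
    ultimately have 2: "exec (Assign 2 (Add (Var 2) (Const 1))) ?s (1 + cost (Add (Var 2) (Const 1)) ?s) (?\<sigma> x (Suc i))"
      by simp
    obtain t where t: "exec (While ?guard ?body) (?\<sigma> x (Suc i)) t (?\<sigma> x (len x))"
        "t \<le> Suc (len x - Suc i) * K x"
      using Suc.hyps(1)[of "Suc i"] Suc.hyps(2) i Suc_leI by fastforce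
    have run: "exec (While ?guard ?body) (?\<sigma> x i)
        (1 + cost ?guard (?\<sigma> x i) + (1 + (1 + cost ?a (?\<sigma> x i) + T (x, i) + val_size (S x (Suc i))) +
         (1 + cost (Add (Var 2) (Const 1)) ?s)) + t) (?\<sigma> x (len x))"
      using i by (intro exec.WhileTrue[OF _ exec.Seq[OF 1 2] t(1)]) simp
    have "N x + val_size (Cell (Cell (e x) (Atom (int i))) (S x i)) \<le> ?W x"
      using sizes by simp
    then have "T (x, i) \<le> poly F (?W x)"
      using F[OF x i] poly_nat_mono order_trans by blast
    moreover have "cost ?guard (?\<sigma> x i) \<le> 2 * N x + 4" "cost (Add (Var 2) (Const 1)) ?s \<le> 2 * N x + 6"
        "cost ?a (?\<sigma> x i) \<le> 3 * val_size (e x) + 3 * N x + 2 * B x + 9"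
      using sizes i by (simp_all add: init_store_def floorlog_1 add.commute)
    ultimately have "1 + cost ?guard (?\<sigma> x i) + (1 + (1 + cost ?a (?\<sigma> x i) + T (x, i) + val_size (S x (Suc i))) +
         (1 + cost (Add (Var 2) (Const 1)) ?s)) \<le> K x"
      using sizes(5) unfolding K_def by (intro bound)
    moreover have "Suc (len x - i) * K x = Suc (len x - Suc i) * K x + K x"
      using i by (cases "len x - i") auto
    ultimately show ?case using t(2)
      by (intro exI[where P = "\<lambda>t. exec _ _ t _ \<and> t \<le> _"] conjI) (rule run, simp)
  qed
  let ?prog = "Seq (Call 1 pl (Var 0)) (Seq (Call 3 pi (Var 0)) (Seq (Assign 2 (Const 0))
    (Seq (While ?guard ?body) (Assign 0 (Var 3)))))"
  show ?thesis
  proof (rule ptimeI)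
    show "poly_bounded D ?\<mu> (\<lambda>x. 20 + 5 * ?\<mu> x + 3 * B x + Tl x + Ti x + (1 + ?\<mu> x) * K x)"
      unfolding K_def by (intro poly_bounded_intros poly_bounded_poly Tl Ti size)
    fix x assume x: "x \<in> D"
    let ?s1 = "(init_store (e x))(1 := Atom (int (len x)))"
    let ?s2 = "?s1(3 := S x 0)"
    have 1: "exec (Call 1 pl (Var 0)) (init_store (e x))
        (1 + cost (Var 0) (init_store (e x)) + Tl x + val_size (Atom (int (len x)))) ?s1"
      using pl[OF x] by (intro exec_Call) (simp add: init_store_def)
    have 2: "exec (Call 3 pi (Var 0)) ?s1 (1 + cost (Var 0) ?s1 + Ti x + val_size (S x 0)) ?s2"
      using pi[OF x] by (intro exec_Call) (simp add: init_store_def)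
    have "exec (Assign 2 (Const 0)) ?s2 (1 + cost (Const 0) ?s2) (?s2(2 := eval_expr (Const 0) ?s2))"
      by (rule exec.Assign)
    moreover have "?s2(2 := eval_expr (Const 0) ?s2) = ?\<sigma> x 0"
      by (auto simp: fun_eq_iff)
    ultimately have 3: "exec (Assign 2 (Const 0)) ?s2 (1 + cost (Const 0) ?s2) (?\<sigma> x 0)"
      by simp
    obtain t where t: "exec (While ?guard ?body) (?\<sigma> x 0) t (?\<sigma> x (len x))" "t \<le> Suc (len x) * K x"
      using loop[OF x, of 0] unfolding diff_zero by blast
    have "exec ?prog (init_store (e x)) (1 + (1 + cost (Var 0) (init_store (e x)) + Tl x + val_size (Atom (int (len x)))) +
      (1 + (1 + cost (Var 0) ?s1 + Ti x + val_size (S x 0)) + (1 + (1 + cost (Const 0) ?s2) +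
       (1 + t + (1 + cost (Var 3) (?\<sigma> x (len x))))))) ((?\<sigma> x (len x))(0 := eval_expr (Var 3) (?\<sigma> x (len x))))"
      by (intro exec.Seq[OF 1] exec.Seq[OF 2] exec.Seq[OF 3] exec.Seq[OF t(1)] exec.Assign)
    moreover have "1 + (1 + cost (Var 0) (init_store (e x)) + Tl x + val_size (Atom (int (len x)))) +
      (1 + (1 + cost (Var 0) ?s1 + Ti x + val_size (S x 0)) + (1 + (1 + cost (Const 0) ?s2) +
       (1 + t + (1 + cost (Var 3) (?\<sigma> x (len x))))))
      \<le> 20 + 5 * ?\<mu> x + 3 * B x + Tl x + Ti x + (1 + ?\<mu> x) * K x"
    proof -
      have t_le: "t \<le> (1 + ?\<mu> x) * K x"
        by (rule order_trans[OF t(2)], rule mult_le_mono1) (use len_le[OF x] in linarith)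
      have sizes: "val_size (Atom (int (len x))) \<le> N x + 1"
        "val_size (S x 0) \<le> B x" "val_size (S x (len x)) \<le> B x"
        using val_size_Atom_nat[of "len x"] len_le[OF x] size(2)[OF x] by simp_all
      have costs: "cost (Var 0) (init_store (e x)) = val_size (e x)" "cost (Var 0) ?s1 = val_size (e x)"
        "cost (Const 0) ?s2 = 1" "cost (Var 3) (?\<sigma> x (len x)) = val_size (S x (len x))"
        by (simp_all add: init_store_def floorlog_0)
      show ?thesis
        unfolding costs by (intro order_trans[OF _ add_left_mono[OF t_le]]) (use sizes in simp)
    qed
    ultimately show "\<exists>t s. exec ?prog (init_store (e x)) t s \<and>
        t \<le> 20 + 5 * ?\<mu> x + 3 * B x + Tl x + Ti x + (1 + ?\<mu> x) * K x \<and> s 0 = S x (len x)"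
      by - (intro exI conjI, assumption, assumption, simp)
  qed
qed


text \<open>
  The instances inside a loop over \<open>i < len x\<close> are pairs of an instance and a
  counter, and the environment is extended by the counter. Nested loops nest these pairs to the
  left.
\<close>

abbreviation (input) "steps D len \<equiv> {y. fst y \<in> D \<and> snd y < len (fst y)}"

abbreviation (input) "step_env e \<equiv> (\<lambda>y. Cell (e (fst y)) (Atom (int (snd y))))"

lemma ptime_fst: "ptime D N (\<lambda>y. Cell (g y) (h y)) g"
  by (rule ptime_left[OF ptime_env])

lemma ptime_snd: "ptime D N (\<lambda>y. Cell (g y) (h y)) h"
  by (rule ptime_right[OF ptime_env])

text \<open>
  Counters are at most \<open>N x\<close>, so a bound on the results of a loop body can be made
  uniform over all rounds. This yields the bound on loop states when every round adds one
  result.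
\<close>

lemma ptime_size_steps:
  assumes "ptime D' (\<lambda>y. N (fst y)) (step_env e) g"
    "\<And>x i. (x, i) \<in> D' \<Longrightarrow> x \<in> D \<and> i \<le> N x"
  obtains B where "poly_bounded D (\<lambda>x. N x + val_size (e x)) B"
    "\<And>x i. (x, i) \<in> D' \<Longrightarrow> val_size (g (x, i)) \<le> B x"
proof -
  obtain F where F: "\<forall>y\<in>D'. val_size (g y) \<le> poly F (N (fst y) + val_size (step_env e y))"
    using ptime_size[OF assms(1)] unfolding poly_bounded_def by blast
  show ?thesis
  proof (rule that)
    show "poly_bounded D (\<lambda>x. N x + val_size (e x)) (\<lambda>x. poly F (2 + 2 * (N x + val_size (e x))))"
      by (intro poly_bounded_intros poly_bounded_poly)
    fix x i assume xi: "(x, i) \<in> D'"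
    then have "i \<le> N x" using assms(2) by blast
    then have "val_size (Atom (int i)) \<le> N x + 1"
      using val_size_Atom_nat[of i] by linarith
    then have "N x + val_size (step_env e (x, i)) \<le> 2 + 2 * (N x + val_size (e x))"
      by simp
    then show "val_size (g (x, i)) \<le> poly F (2 + 2 * (N x + val_size (e x)))"
      using F[rule_format, OF xi] poly_nat_mono order_trans by (metis (no_types, lifting) fst_conv snd_conv)
  qed
qed

text \<open>
  The list is built from its last entry to its first, because cells can only be prepended; round
  \<open>i\<close> treats the index \<open>len x - 1 - i\<close>.
\<close>

lemma ptime_filter:
  assumes len: "ptime D N e (\<lambda>x. Atom (int (len x)))" and len_le: "\<And>x. x \<in> D \<Longrightarrow> len x \<le> N x"
    and P: "ptime (steps D len) (\<lambda>y. N (fst y)) (step_env e) (\<lambda>y. Atom (of_bool (P (fst y) (snd y))))"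
    and h: "ptime {y \<in> steps D len. P (fst y) (snd y)} (\<lambda>y. N (fst y)) (step_env e) (\<lambda>y. h (fst y) (snd y))"
  shows "ptime D N e (\<lambda>x. enc_list (map (h x) (filter (P x) [0..<len x])))"
proof -
  obtain B where B: "poly_bounded D (\<lambda>x. N x + val_size (e x)) B"
    "\<And>x i. (x, i) \<in> {y \<in> steps D len. P (fst y) (snd y)} \<Longrightarrow> val_size (h x i) \<le> B x"
    by (rule ptime_size_steps[OF h]) (use len_le in force)+
  define S where "S x i = enc_list (map (h x) (filter (P x) [len x - i..<len x]))" for x i
  have S_Suc: "S x (Suc i) = (if P x (len x - 1 - i) then Cell (h x (len x - 1 - i)) (S x i) else S x i)"
    if "i < len x" for x i
  proof -
    have "[len x - Suc i..<len x] = (len x - Suc i) # [len x - i..<len x]"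
      using that by (subst upt_conv_Cons) (auto simp: Suc_diff_Suc)
    then show ?thesis by (simp add: S_def)
  qed
  let ?E = "\<lambda>y. Cell (Cell (e (fst y)) (Atom (int (snd y)))) (S (fst y) (snd y))"
  \<comment> \<open>the pair of instance and list index that is treated in round \<open>snd y\<close>\<close>
  let ?r = "\<lambda>y. (fst y, len (fst y) - 1 - snd y)"
  have env: "ptime (steps D len) (\<lambda>y. N (fst y)) ?E (\<lambda>y. e (fst y))"
    "ptime (steps D len) (\<lambda>y. N (fst y)) ?E (\<lambda>y. Atom (int (snd y)))"
    by (rule ptime_trans[OF ptime_fst], rule ptime_fst, rule ptime_trans[OF ptime_fst], rule ptime_snd)
  have "ptime (steps D len) (\<lambda>y. N (fst y)) ?E (\<lambda>y. Atom (int (len (fst y))))"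
    by (rule ptime_subst[OF len env(1)]) auto
  from ptime_diff[OF ptime_diff[OF this ptime_const[of _ _ _ 1]] env(2)]
  have "ptime (steps D len) (\<lambda>y. N (fst y)) ?E (\<lambda>y. Atom (int (len (fst y) - 1 - snd y)))"
    by (rule ptime_cong) auto
  from ptime_Cell[OF env(1) this]
  have rev: "ptime (steps D len) (\<lambda>y. N (fst y)) ?E (\<lambda>y. step_env e (?r y))"
    by simp
  have "ptime (steps D len) (\<lambda>y. N (fst y)) ?E (\<lambda>y. if P (fst (?r y)) (snd (?r y))
      then Cell (h (fst (?r y)) (snd (?r y))) (S (fst y) (snd y)) else S (fst y) (snd y))"
  proof (intro ptime_if ptime_Cell)
    show "ptime (steps D len) (\<lambda>y. N (fst y)) ?E (\<lambda>y. Atom (of_bool (P (fst (?r y)) (snd (?r y)))))"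
      by (rule ptime_subst[OF P rev]) auto
    show "ptime {y \<in> steps D len. P (fst (?r y)) (snd (?r y))} (\<lambda>y. N (fst y)) ?E
        (\<lambda>y. h (fst (?r y)) (snd (?r y)))"
      by (rule ptime_subst[OF h ptime_subdomain[OF rev]]) auto
  qed (rule ptime_snd)+
  then have step: "ptime (steps D len) (\<lambda>y. N (fst y)) ?E (\<lambda>y. S (fst y) (Suc (snd y)))"
    by (rule ptime_cong) (simp add: S_Suc)
  have size: "val_size (S x i) \<le> 1 + i * (1 + B x)" if "x \<in> D" "i \<le> len x" for x i
    using that(2)
  proof (induction i)
    case (Suc i)
    then have "val_size (h x (len x - 1 - i)) \<le> B x" if "P x (len x - 1 - i)"
      using B(2)[of x "len x - 1 - i"] that \<open>x \<in> D\<close> by simp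
    then show ?case using Suc by (auto simp: S_Suc)
  qed (simp add: S_def floorlog_0)
  have "ptime D N e (\<lambda>x. S x (len x))"
  proof (rule ptime_loop[OF len len_le _ step])
    show "ptime D N e (\<lambda>x. S x 0)"
      by (rule ptime_cong[OF ptime_const[of _ _ _ 0]]) (simp add: S_def)
    show "poly_bounded D (\<lambda>x. N x + val_size (e x)) (\<lambda>x. 1 + (N x + val_size (e x)) * (1 + B x))"
      by (intro poly_bounded_intros B)
    show "val_size (S x i) \<le> 1 + (N x + val_size (e x)) * (1 + B x)" if "x \<in> D" "i \<le> len x" for x i
      by (rule order_trans[OF size[OF that]], intro add_left_mono mult_le_mono1)
        (use len_le[OF that(1)] that(2) in linarith)
  qed
  then show ?thesis by (simp add: S_def)
qed

lemma ptime_tabulate: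
  assumes "ptime D N e (\<lambda>x. Atom (int (len x)))" "\<And>x. x \<in> D \<Longrightarrow> len x \<le> N x"
    and "ptime (steps D len) (\<lambda>y. N (fst y)) (step_env e) (\<lambda>y. h (fst y) (snd y))"
  shows "ptime D N e (\<lambda>x. enc_list (map (h x) [0..<len x]))"
proof -
  have "ptime D N e (\<lambda>x. enc_list (map (h x) (filter (\<lambda>_. True) [0..<len x])))"
    by (rule ptime_filter[where P = "\<lambda>_ _. True"])
      (use assms ptime_const[of "steps D len" "\<lambda>y. N (fst y)" "step_env e" 1] in auto)
  then show ?thesis by simp
qed

text \<open>
  The condition on \<open>f\<close> makes the size of the accumulator grow by at most the size
  of one entry per round. Sums and products of integers both satisfy it.
\<close>

lemma ptime_fold:
  assumes len: "ptime D N e (\<lambda>x. Atom (int (len x)))" and len_le: "\<And>x. x \<in> D \<Longrightarrow> len x \<le> N x"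
    and a: "ptime (steps D len) (\<lambda>y. N (fst y)) (step_env e) (\<lambda>y. Atom (a (fst y) (snd y)))"
    and S0: "\<And>x. S x 0 = c" and S_Suc: "\<And>x i. S x (Suc i) = f (S x i) (a x i)"
    and size_f: "\<And>u v. val_size (Atom (f u v)) \<le> val_size (Atom u) + val_size (Atom v)"
    and f: "\<And>E u v. ptime (steps D len) (\<lambda>y. N (fst y)) E (\<lambda>y. Atom (u y)) \<Longrightarrow>
      ptime (steps D len) (\<lambda>y. N (fst y)) E (\<lambda>y. Atom (v y)) \<Longrightarrow>
      ptime (steps D len) (\<lambda>y. N (fst y)) E (\<lambda>y. Atom (f (u y) (v y)))"
  shows "ptime D N e (\<lambda>x. Atom (S x (len x)))"
proof -
  obtain B where B: "poly_bounded D (\<lambda>x. N x + val_size (e x)) B"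
    "\<And>x i. (x, i) \<in> steps D len \<Longrightarrow> val_size (Atom (a x i)) \<le> B x"
    by (rule ptime_size_steps[OF a]) (use len_le in force)+
  let ?E = "\<lambda>y. Cell (Cell (e (fst y)) (Atom (int (snd y)))) (Atom (S (fst y) (snd y)))"
  have size: "val_size (Atom (S x i)) \<le> val_size (Atom c) + i * B x" if "x \<in> D" "i \<le> len x" for x i
    using that(2)
  proof (induction i)
    case (Suc i)
    then show ?case using B(2)[of x i] \<open>x \<in> D\<close> size_f[of "S x i" "a x i"]
      by (auto simp: S_Suc simp del: val_size.simps)
  qed (simp add: S0)
  have step: "ptime (steps D len) (\<lambda>y. N (fst y)) ?E (\<lambda>y. Atom (S (fst y) (Suc (snd y))))"
    unfolding S_Suc by (intro f ptime_snd ptime_trans[OF ptime_fst a])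
  show ?thesis
  proof (rule ptime_loop[where S = "\<lambda>x i. Atom (S x i)", OF len len_le _ step])
    show "ptime D N e (\<lambda>x. Atom (S x 0))"
      unfolding S0 by (rule ptime_const)
    show "poly_bounded D (\<lambda>x. N x + val_size (e x)) (\<lambda>x. val_size (Atom c) + (N x + val_size (e x)) * B x)"
      by (intro poly_bounded_intros B)
    show "val_size (Atom (S x i)) \<le> val_size (Atom c) + (N x + val_size (e x)) * B x"
      if "x \<in> D" "i \<le> len x" for x i
      by (rule order_trans[OF size[OF that]], intro add_left_mono mult_le_mono1)
        (use len_le[OF that(1)] that(2) in linarith)
  qed
qed

lemma ptime_sum:
  assumes "ptime D N e (\<lambda>x. Atom (int (len x)))" "\<And>x. x \<in> D \<Longrightarrow> len x \<le> N x"
    and "ptime (steps D len) (\<lambda>y. N (fst y)) (step_env e) (\<lambda>y. Atom (a (fst y) (snd y)))"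
  shows "ptime D N e (\<lambda>x. Atom (\<Sum>i<len x. a x i))"
  by (rule ptime_fold[OF assms, where f = "(+)" and S = "\<lambda>x i. \<Sum>j<i. a x j"])
    (simp_all add: val_size_Atom_add ptime_add del: val_size.simps)

lemma ptime_prod:
  assumes "ptime D N e (\<lambda>x. Atom (int (len x)))" "\<And>x. x \<in> D \<Longrightarrow> len x \<le> N x"
    and "ptime (steps D len) (\<lambda>y. N (fst y)) (step_env e) (\<lambda>y. Atom (a (fst y) (snd y)))"
  shows "ptime D N e (\<lambda>x. Atom (\<Prod>i<len x. a x i))"
  by (rule ptime_fold[OF assms, where f = "(*)" and S = "\<lambda>x i. \<Prod>j<i. a x j"])
    (simp_all add: val_size_Atom_mult ptime_mult del: val_size.simps)

lemma right_of_enc_list: "right_of (enc_list vs) = enc_list (tl vs)"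
  by (cases vs) auto

lemma val_size_enc_list_drop: "val_size (enc_list (drop i vs)) \<le> val_size (enc_list vs)"
proof (induction i)
  case (Suc i)
  have "val_size (enc_list (drop (Suc i) vs)) \<le> val_size (enc_list (drop i vs))"
    unfolding drop_Suc drop_tl right_of_enc_list[symmetric] by (rule val_size_right_of)
  then show ?case using Suc by simp
qed simp

text \<open>
  The entry is reached by dropping the head \<open>i x\<close> times, so the loop state only
  shrinks.
\<close>

lemma ptime_nth:
  assumes L: "ptime D N e (\<lambda>x. enc_list (L x))" and i: "ptime D N e (\<lambda>x. Atom (int (i x)))"
    and i_less: "\<And>x. x \<in> D \<Longrightarrow> i x < length (L x)" and i_le: "\<And>x. x \<in> D \<Longrightarrow> i x \<le> N x"
  shows "ptime D N e (\<lambda>x. L x ! i x)"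
proof -
  have "ptime D N e (\<lambda>x. enc_list (drop (i x) (L x)))"
  proof (rule ptime_loop[where S = "\<lambda>x i. enc_list (drop i (L x))", OF i i_le])
    show "ptime D N e (\<lambda>x. enc_list (drop 0 (L x)))"
      using L by simp
    show "poly_bounded D (\<lambda>x. N x + val_size (e x)) (\<lambda>x. val_size (enc_list (L x)))"
      by (rule ptime_size[OF L])
    show "val_size (enc_list (drop j (L x))) \<le> val_size (enc_list (L x))" for x j
      by (rule val_size_enc_list_drop)
    show "ptime (steps D i) (\<lambda>y. N (fst y))
      (\<lambda>y. Cell (Cell (e (fst y)) (Atom (int (snd y)))) (enc_list (drop (snd y) (L (fst y)))))
      (\<lambda>y. enc_list (drop (Suc (snd y)) (L (fst y))))"
      unfolding drop_Suc drop_tl right_of_enc_list[symmetric] by (rule ptime_right_of[OF ptime_snd])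
  qed
  then have "ptime D N e (\<lambda>x. Cell (L x ! i x) (enc_list (drop (Suc (i x)) (L x))))"
    by (rule ptime_cong) (simp add: i_less flip: Cons_nth_drop_Suc)
  then show ?thesis by (rule ptime_left)
qed

lemma ptime_vec_nth:
  assumes "ptime D N e (\<lambda>x. enc_vec (E x) (n x) (v x))" "ptime D N e (\<lambda>x. Atom (int (i x)))"
    and "\<And>x. x \<in> D \<Longrightarrow> i x < n x" "\<And>x. x \<in> D \<Longrightarrow> n x \<le> N x"
  shows "ptime D N e (\<lambda>x. E x (v x (i x)))"
proof -
  have "ptime D N e (\<lambda>x. map (\<lambda>j. E x (v x j)) [0..<n x] ! i x)"
    by (rule ptime_nth) (use assms in \<open>auto simp: enc_vec_def intro: less_imp_le less_le_trans\<close>)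
  then show ?thesis by (rule ptime_cong) (simp add: assms(3))
qed

lemma ptime_vec:
  assumes "ptime D N e (\<lambda>x. Atom (int (n x)))" "\<And>x. x \<in> D \<Longrightarrow> n x \<le> N x"
    and "ptime (steps D n) (\<lambda>y. N (fst y)) (step_env e) (\<lambda>y. E (v (fst y) (snd y)))"
  shows "ptime D N e (\<lambda>x. enc_vec E (n x) (v x))"
  unfolding enc_vec_def by (rule ptime_tabulate[OF assms])

lemma ptime_step: "ptime D N e g \<Longrightarrow> ptime (steps D len) (\<lambda>y. N (fst y)) (step_env e) (\<lambda>y. g (fst y))"
  by (rule ptime_subst[OF _ ptime_fst]) auto

section \<open>Binary points of a binary polytope\<close>

text \<open>
  Among the finite sets whose convex hull is the polytope, take one of least cardinality. Each of its
  elements lies outside the hull of the others and is therefore extreme, and a linear function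
  on the hull is at least its minimum over that set.
\<close>

lemma linear_min_at_extreme_point:
  fixes f :: "'a::real_vector \<Rightarrow> real"
  assumes "linear f" "polytope Q" "Q \<noteq> {}"
  shows "\<exists>v. v extreme_point_of Q \<and> (\<forall>q\<in>Q. f v \<le> f q)"
proof -
  obtain V where "finite V" "Q = convex hull V"
    using assms(2) unfolding polytope_def by blast
  then obtain W where W: "finite W" "Q = convex hull W"
    and least: "\<And>W'. finite W' \<Longrightarrow> Q = convex hull W' \<Longrightarrow> card W \<le> card W'"
    using ex_has_least_nat[of "\<lambda>W. finite W \<and> Q = convex hull W" V card] by auto
  have "W \<noteq> {}" using W(2) assms(3) by auto
  then obtain w where w: "w \<in> W" "\<And>v. v \<in> W \<Longrightarrow> f w \<le> f v"
    using arg_min_if_finite[OF W(1), of f] not_le by blast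
  have "convex {x. f w \<le> f x}"
  proof (rule convexI)
    fix x y and u v :: real
    assume *: "x \<in> {x. f w \<le> f x}" "y \<in> {x. f w \<le> f x}" "0 \<le> u" "0 \<le> v" "u + v = 1"
    have "f w = u * f w + v * f w" using *(5) by (simp flip: distrib_right)
    also have "\<dots> \<le> u * f x + v * f y" using * by (intro add_mono mult_left_mono) auto
    also have "\<dots> = f (u *\<^sub>R x + v *\<^sub>R y)" using assms(1) by (simp add: linear_add linear_scale)
    finally show "u *\<^sub>R x + v *\<^sub>R y \<in> {x. f w \<le> f x}" by simp
  qed
  then have min: "Q \<subseteq> {x. f w \<le> f x}"
    unfolding W(2) using w(2) by (intro hull_minimal) auto
  have "w \<notin> convex hull (W - {w})"
  proof
    assume "w \<in> convex hull (W - {w})"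
    then have "convex hull (insert w (W - {w})) = convex hull (W - {w})"
      by (rule hull_redundant)
    then have "Q = convex hull (W - {w})" using W(2) w(1) by (simp add: insert_absorb)
    then have "card W \<le> card (W - {w})" using least W(1) by blast
    then show False using card_Diff1_less[OF W(1) w(1)] by simp
  qed
  then have "w extreme_point_of Q"
    using extreme_point_of_convex_hull_insert[of "W - {w}" w] W w(1) by (simp add: insert_absorb)
  then show ?thesis using min by blast
qed

lemma linear_dot: "linear (dot m c :: (nat \<Rightarrow> real) \<Rightarrow> real)"
  by (rule linearI) (simp_all add: dot_def scaleR_fun_def sum.distrib algebra_simps sum_distrib_left)

definition binary_points :: "nat \<Rightarrow> (nat \<Rightarrow> real) set \<Rightarrow> (nat \<Rightarrow> nat) set"
  where "binary_points m Q = {z \<in> vecs m. (\<forall>j<m. z j \<in> {0, 1}) \<and> (\<lambda>j. real (z j)) \<in> Q}"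

lemma finite_binary_points: "finite (binary_points m Q)"
proof (rule finite_imageD)
  let ?f = "\<lambda>z :: nat \<Rightarrow> nat. {j. z j = 1} \<inter> {..<m}"
  show "finite (?f ` binary_points m Q)"
    by (rule finite_subset[of _ "Pow {..<m}"]) auto
  show "inj_on ?f (binary_points m Q)"
  proof (rule inj_onI, rule ext)
    fix u v j assume uv: "u \<in> binary_points m Q" "v \<in> binary_points m Q" "?f u = ?f v"
    show "u j = v j"
    proof (cases "j < m")
      case True
      then have "u j = 1 \<longleftrightarrow> v j = 1" using uv(3) by blast
      moreover have "u j \<in> {0, 1}" "v j \<in> {0, 1}"
        using uv(1,2) True unfolding binary_points_def by blast+
      ultimately show ?thesis by auto
    next
      case False
      then show ?thesis using uv(1,2) unfolding binary_points_def vecs_def by simp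
    qed
  qed
qed

text \<open>
  This is where the polytope being binary enters: optimizing over \<open>Q\<close> and
  optimizing over its binary points give the same value, for every objective.
\<close>

lemma min_at_binary_point:
  assumes "binary_polytope m Q" "Q \<noteq> {}"
  shows "\<exists>z\<in>binary_points m Q. \<forall>q\<in>Q. dot m c (\<lambda>j. real (z j)) \<le> dot m c q"
proof -
  obtain v where v: "v extreme_point_of Q" "\<And>q. q \<in> Q \<Longrightarrow> dot m c v \<le> dot m c q"
    using linear_min_at_extreme_point[OF linear_dot _ assms(2)] assms(1)
    unfolding binary_polytope_def by blast
  then have v01: "v \<in> vecs m" "\<forall>j<m. v j \<in> {0, 1}"
    using assms(1) unfolding binary_polytope_def vert_def by blast+
  define z where "z = (\<lambda>j. if v j = 0 then 0 else 1 :: nat)"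
  have z: "(\<lambda>j. real (z j)) = v"
  proof
    show "real (z j) = v j" for j
      using v01 unfolding z_def vecs_def by (cases "j < m") auto
  qed
  have "z \<in> binary_points m Q"
  proof -
    have "z j \<in> {0, 1}" for j unfolding z_def by simp
    moreover have "z \<in> vecs m" using v01(1) unfolding z_def vecs_def by simp
    moreover have "(\<lambda>j. real (z j)) \<in> Q" using v(1) unfolding z extreme_point_of_def by blast
    ultimately show ?thesis unfolding binary_points_def by blast
  qed
  then show ?thesis using v(2) z by auto
qed

section \<open>Row sums of lexicographically ordered matrices\<close>

text \<open>
  The number of predecessors numbers the elements of a finite strict linear order consecutively.
  It is used both to list a set of vectors in lexicographic order and to pick out the
  \<open>k\<close> best candidates without sorting.
\<close>

lemma bij_betw_rank:
  assumes fin: "finite F"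
    and irrefl: "\<And>l. l \<in> F \<Longrightarrow> \<not> R l l"
    and trans: "\<And>a b c. a \<in> F \<Longrightarrow> b \<in> F \<Longrightarrow> c \<in> F \<Longrightarrow> R a b \<Longrightarrow> R b c \<Longrightarrow> R a c"
    and total: "\<And>a b. a \<in> F \<Longrightarrow> b \<in> F \<Longrightarrow> a \<noteq> b \<Longrightarrow> R a b \<or> R b a"
  shows "bij_betw (\<lambda>l. card {l' \<in> F. R l' l}) F {..<card F}"
    and "\<And>a b. a \<in> F \<Longrightarrow> b \<in> F \<Longrightarrow> R a b \<longleftrightarrow> card {l' \<in> F. R l' a} < card {l' \<in> F. R l' b}"
proof -
  let ?rank = "\<lambda>l. card {l' \<in> F. R l' l}"
  have mono: "?rank a < ?rank b" if "a \<in> F" "b \<in> F" "R a b" for a b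
  proof (rule psubset_card_mono)
    show "finite {l' \<in> F. R l' b}" using fin by simp
    have "{l' \<in> F. R l' a} \<subseteq> {l' \<in> F. R l' b}" using trans that by blast
    moreover have "a \<in> {l' \<in> F. R l' b}" "a \<notin> {l' \<in> F. R l' a}" using irrefl that by auto
    ultimately show "{l' \<in> F. R l' a} \<subset> {l' \<in> F. R l' b}" by blast
  qed
  show iff: "R a b \<longleftrightarrow> ?rank a < ?rank b" if "a \<in> F" "b \<in> F" for a b
  proof
    assume "?rank a < ?rank b"
    then have "a \<noteq> b" "\<not> R b a" using mono[of b a] that by auto
    then show "R a b" using total that by blast
  next
    assume "R a b"
    then show "?rank a < ?rank b" by (rule mono[OF that])
  qed
  have inj: "inj_on ?rank F"
  proof (rule inj_onI, rule ccontr)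
    fix a b assume ab: "a \<in> F" "b \<in> F" "?rank a = ?rank b" "a \<noteq> b"
    then show False using total[OF ab(1,2,4)] mono[OF ab(1,2)] mono[OF ab(2,1)] by auto
  qed
  have "?rank ` F \<subseteq> {..<card F}"
  proof
    fix r assume "r \<in> ?rank ` F"
    then obtain l where l: "l \<in> F" "r = ?rank l" by blast
    have "{l' \<in> F. R l' l} \<subset> F" using irrefl l(1) by blast
    then show "r \<in> {..<card F}" using psubset_card_mono[OF fin] l(2) by simp
  qed
  moreover have "card (?rank ` F) = card {..<card F}" using inj by (simp add: card_image)
  ultimately have "?rank ` F = {..<card F}" by (intro card_subset_eq) auto
  then show "bij_betw ?rank F {..<card F}" using inj by (simp add: bij_betw_def)
qed

text \<open>
  Lexicographic ordering of the rows merely selects one listing of every set of \<open>k\<close>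
  distinct vectors, so it can be forgotten when only the sum of the rows matters.
\<close>

lemma Y_Q_iff:
  "y \<in> Y_Q k m Q \<longleftrightarrow> (\<exists>T \<subseteq> binary_points m Q. card T = k \<and> y = (\<lambda>j. \<Sum>z\<in>T. z j))"
proof
  assume "y \<in> Y_Q k m Q"
  then obtain z where z: "z \<in> L_Q k m Q" and y: "\<And>j. y j = (\<Sum>i<k. z i j)"
    unfolding Y_Q_def by blast
  have "inj_on z {..<k}"
  proof (rule inj_onI)
    fix a b assume ab: "a \<in> {..<k}" "b \<in> {..<k}" "z a = z b"
    have mono: "\<And>i i'. i < i' \<and> i' < k \<Longrightarrow> less_fun (z i) (z i')"
      using z unfolding L_Q_def L_mats_def by blast
    show "a = b"
      using ab mono[of a b] mono[of b a] less_fun_irrefl[of "z b"]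
      by (cases a b rule: linorder_cases) auto
  qed
  then have "card (z ` {..<k}) = k" "(\<Sum>v\<in>z ` {..<k}. v j) = y j" for j
    by (simp_all add: card_image sum.reindex y)
  moreover have "z ` {..<k} \<subseteq> binary_points m Q"
    using z unfolding L_Q_def L_mats_def mats_def binary_points_def vecs_def by auto
  ultimately show "\<exists>T \<subseteq> binary_points m Q. card T = k \<and> y = (\<lambda>j. \<Sum>z\<in>T. z j)"
    by (intro exI[of _ "z ` {..<k}"]) auto
next
  assume "\<exists>T \<subseteq> binary_points m Q. card T = k \<and> y = (\<lambda>j. \<Sum>z\<in>T. z j)"
  then obtain T where T: "T \<subseteq> binary_points m Q" "card T = k" "y = (\<lambda>j. \<Sum>z\<in>T. z j)"
    by blast
  have fin: "finite T" using T(1) finite_binary_points finite_subset by blast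
  have T_vecs: "T \<subseteq> vecs m" using T(1) unfolding binary_points_def by blast
  have total: "less_fun u v \<or> less_fun v u" if "u \<in> T" "v \<in> T" "u \<noteq> v" for u v
  proof -
    have "{j. u j \<noteq> v j} \<subseteq> {..<m}"
    proof
      fix j assume j: "j \<in> {j. u j \<noteq> v j}"
      have "u \<in> vecs m" "v \<in> vecs m" using that(1,2) T_vecs by blast+
      then show "j \<in> {..<m}" using j unfolding vecs_def by (cases "j < m") auto
    qed
    then show ?thesis using less_fun_trichotomy[of u v] that(3) finite_subset by blast
  qed
  let ?rank = "\<lambda>u. card {v \<in> T. less_fun v u}"
  have bij: "bij_betw ?rank T {..<k}"
    and rank: "\<And>u v. u \<in> T \<Longrightarrow> v \<in> T \<Longrightarrow> less_fun u v \<longleftrightarrow> ?rank u < ?rank v"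
    unfolding T(2)[symmetric]
    by (rule bij_betw_rank[OF fin less_fun_irrefl less_fun_trans total]; assumption)+
  define z where "z i = (if i < k then inv_into T ?rank i else (\<lambda>_. 0))" for i
  have bz: "bij_betw z {..<k} T"
    using bij_betw_inv_into[OF bij] by (rule bij_betw_cong[THEN iffD1, rotated]) (simp add: z_def)
  have zT: "z i \<in> T" and rank_z: "?rank (z i) = i" if "i < k" for i
    using that bz bij_betw_inv_into_right[OF bij, of i] by (auto simp: z_def bij_betw_def)
  have "z \<in> L_Q k m Q"
    unfolding L_Q_def L_mats_def
  proof (intro CollectI conjI allI impI)
    have "z i j = 0" if "i \<ge> k \<or> j \<ge> m" for i j
    proof (cases "i < k")
      case True
      then show ?thesis using that zT[OF True] T_vecs unfolding vecs_def by force
    qed (simp add: z_def)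
    then show "z \<in> mats k m" unfolding mats_def by blast
    show "less_fun (z i) (z i')" if "i < i' \<and> i' < k" for i i'
      using that rank[of "z i" "z i'"] zT rank_z by simp
  qed (use zT T(1) in \<open>auto simp: binary_points_def subset_iff\<close>)
  moreover have "y j = (\<Sum>i<k. z i j)" for j
    unfolding T(3) using sum.reindex_bij_betw[OF bz, of "\<lambda>v. v j"] by simp
  moreover have "y \<in> vecs m"
  proof -
    have "z i = 0" if "z \<in> T" "i \<ge> m" for z i
      using T_vecs that unfolding vecs_def by blast
    then show ?thesis unfolding T(3) vecs_def by (intro CollectI allI impI sum.neutral ballI)
  qed
  ultimately show "y \<in> Y_Q k m Q" unfolding Y_Q_def by blast
qed

section \<open>Beam search\<close>

definition linear_cost :: "nat \<Rightarrow> (nat \<Rightarrow> int) \<Rightarrow> (nat \<Rightarrow> nat) \<Rightarrow> int"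
  where "linear_cost m c z = (\<Sum>j<m. c j * int (z j))"

definition abs_sum :: "nat \<Rightarrow> (nat \<Rightarrow> int) \<Rightarrow> int"
  where "abs_sum m c = (\<Sum>j<m. \<bar>c j\<bar>)"

text \<open>
  A node is a prefix of length \<open>j\<close>, given as a vector \<open>p\<close> of which the
  first \<open>j\<close> entries count. Among binary points a deviation from the prefix in some
  coordinate costs \<open>2 * abs_sum m c + 1\<close>, more than any difference in linear cost,
  so the minimum prefers points that extend the prefix. The value is a minimum over all of
  \<open>P\<close>, which makes it accessible to a single optimization.
\<close>

definition node_value :: "nat \<Rightarrow> (nat \<Rightarrow> int) \<Rightarrow> (nat \<Rightarrow> nat) set \<Rightarrow> nat \<Rightarrow> (nat \<Rightarrow> nat) \<Rightarrow> int"
  where "node_value m c P j p =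
    Min ((\<lambda>z. linear_cost m c z + (2 * abs_sum m c + 1) * (\<Sum>i<j. of_bool (z i \<noteq> p i))) ` P)"

text \<open>
  The sublist of (at most) \<open>k\<close> entries of least value among those of value at most
  \<open>b\<close>, in their original order; ties are broken by position. The sum counts the
  predecessors of entry \<open>l\<close>, in a form that can be evaluated by one loop.
\<close>

definition select :: "nat \<Rightarrow> int \<Rightarrow> ('a \<Rightarrow> int) \<Rightarrow> 'a list \<Rightarrow> 'a list"
  where "select k b V T = map ((!) T) (filter
    (\<lambda>l. V (T ! l) \<le> b \<and> (\<Sum>l'<length T. of_bool (V (T ! l') \<le> b \<and>
      (V (T ! l') < V (T ! l) \<or> V (T ! l') = V (T ! l) \<and> l' < l))) < int k)
    [0..<length T])"

text \<open>
  Nodes are padded by zeros, so a node doubles as its own child with next entry 0.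
\<close>

definition children :: "nat \<Rightarrow> (nat \<Rightarrow> nat) list \<Rightarrow> (nat \<Rightarrow> nat) list"
  where "children j T = T @ map (\<lambda>p. p(j := 1)) T"

fun beam :: "nat \<Rightarrow> (nat \<Rightarrow> int) \<Rightarrow> (nat \<Rightarrow> nat) set \<Rightarrow> nat \<Rightarrow> nat \<Rightarrow> (nat \<Rightarrow> nat) list"
  where
    "beam m c P k 0 = [\<lambda>_. 0]"
  | "beam m c P k (Suc j) =
      select k (abs_sum m c) (node_value m c P (Suc j)) (children j (beam m c P k j))"

definition extensions :: "(nat \<Rightarrow> nat) set \<Rightarrow> nat \<Rightarrow> (nat \<Rightarrow> nat) \<Rightarrow> (nat \<Rightarrow> nat) set"
  where "extensions P j p = {z \<in> P. \<forall>i<j. z i = p i}"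

text \<open>
  Membership is decided by rank below \<open>k\<close>. Hence either nothing of value at most
  \<open>b\<close> is discarded, or exactly \<open>k\<close> entries are kept and none of the
  discarded ones is cheaper than a kept one.
\<close>

lemma select_spec:
  assumes "distinct T"
  shows "set (select k b V T) \<subseteq> {p \<in> set T. V p \<le> b}" "distinct (select k b V T)"
    "length (select k b V T) \<le> k"
    "set (select k b V T) = {p \<in> set T. V p \<le> b} \<or>
      length (select k b V T) = k \<and>
      (\<forall>p\<in>set (select k b V T). \<forall>q\<in>{p \<in> set T. V p \<le> b} - set (select k b V T). V p \<le> V q)"
proof -
  let ?n = "length T"
  define R where "R a c \<longleftrightarrow> V (T ! a) < V (T ! c) \<or> V (T ! a) = V (T ! c) \<and> a < c" for a c
  define F where "F = {l. l < ?n \<and> V (T ! l) \<le> b}"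
  define rank where "rank l = card {l' \<in> F. R l' l}" for l
  have finF: "finite F" unfolding F_def by simp
  have bij: "bij_betw rank F {..<card F}"
    and R_iff: "\<And>a c. a \<in> F \<Longrightarrow> c \<in> F \<Longrightarrow> R a c \<longleftrightarrow> rank a < rank c"
    unfolding rank_def by (rule bij_betw_rank[OF finF]; force simp: R_def)+
  define K where "K = {l \<in> F. rank l < k}"
  have count: "(\<Sum>l'<?n. of_bool (V (T ! l') \<le> b \<and>
      (V (T ! l') < V (T ! l) \<or> V (T ! l') = V (T ! l) \<and> l' < l))) = int (rank l)" for l
    by (simp add: sum.If_cases of_bool_def rank_def F_def R_def Int_def conj_ac)
  define ls where "ls = filter (\<lambda>l. V (T ! l) \<le> b \<and> rank l < k) [0..<?n]"
  have sel: "select k b V T = map ((!) T) ls"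
    unfolding select_def count ls_def by simp
  have ls: "distinct ls" "set ls = K" unfolding ls_def K_def F_def by auto
  have inj: "inj_on ((!) T) F"
    using assms unfolding F_def by (auto simp: inj_on_def nth_eq_iff_index_eq)
  have KF: "K \<subseteq> F" unfolding K_def by blast
  have F_image: "(!) T ` F = {p \<in> set T. V p \<le> b}"
    unfolding F_def by (auto simp: in_set_conv_nth)
  have set_sel: "set (select k b V T) = (!) T ` K" unfolding sel by (simp add: ls(2))
  show "set (select k b V T) \<subseteq> {p \<in> set T. V p \<le> b}"
    unfolding set_sel F_image[symmetric] using KF by blast
  show "distinct (select k b V T)"
    unfolding sel distinct_map using ls inj KF inj_on_subset by blast
  have len: "length (select k b V T) = card K"
    unfolding sel using ls distinct_card by fastforce
  have rank_K: "rank ` K = {..<card F} \<inter> {..<k}"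
    using bij unfolding K_def bij_betw_def by auto
  have "card K = card (rank ` K)"
    using bij KF by (metis bij_betw_def card_image inj_on_subset)
  then have card_K: "card K = min (card F) k"
    unfolding rank_K by (simp add: min_def Int_absorb1 Int_absorb2 lessThan_subset_iff)
  then show "length (select k b V T) \<le> k" unfolding len by simp
  show "set (select k b V T) = {p \<in> set T. V p \<le> b} \<or>
      length (select k b V T) = k \<and>
      (\<forall>p\<in>set (select k b V T). \<forall>q\<in>{p \<in> set T. V p \<le> b} - set (select k b V T). V p \<le> V q)"
  proof (cases "card F \<le> k")
    case True
    then have "K = F" using card_K KF finF by (intro card_subset_eq) auto
    then show ?thesis unfolding set_sel F_image[symmetric] by blast
  next
    case False
    have "V (T ! a) \<le> V (T ! c)" if "a \<in> K" "c \<in> F" "c \<notin> K" for a c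
    proof -
      have "rank a < rank c" "a \<in> F" using that unfolding K_def by auto
      then have "R a c" using R_iff that(2) by blast
      then show ?thesis unfolding R_def by auto
    qed
    then show ?thesis using False card_K unfolding len set_sel F_image[symmetric] by fastforce
  qed
qed

lemma abs_linear_cost_le:
  assumes "\<And>j. j < m \<Longrightarrow> z j \<in> {0, 1}"
  shows "\<bar>linear_cost m c z\<bar> \<le> abs_sum m c"
  unfolding linear_cost_def abs_sum_def
proof (rule order_trans[OF sum_abs], rule sum_mono)
  show "\<bar>c j * int (z j)\<bar> \<le> \<bar>c j\<bar>" if "j \<in> {..<m}" for j
    using assms[of j] that by auto
qed

text \<open>
  The threshold \<open>abs_sum m c\<close> separates feasible from infeasible prefixes: points
  that extend the prefix cost at most that much, while any other point pays at least once the
  penalty \<open>2 * abs_sum m c + 1\<close> on top of a cost of at least \<open>- abs_sum m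
  c\<close>.
\<close>

lemma node_value_extensions:
  assumes P: "finite P" "P \<noteq> {}" "\<forall>z\<in>P. \<forall>j<m. z j \<in> {0, 1}"
  shows "node_value m c P j p \<le> abs_sum m c \<longleftrightarrow> extensions P j p \<noteq> {}"
    and "z \<in> extensions P j p \<Longrightarrow> node_value m c P j p \<le> linear_cost m c z"
    and "extensions P j p \<noteq> {} \<Longrightarrow> \<exists>z\<in>extensions P j p. node_value m c P j p = linear_cost m c z"
proof -
  let ?b = "abs_sum m c"
  let ?f = "\<lambda>z. linear_cost m c z + (2 * ?b + 1) * (\<Sum>i<j. of_bool (z i \<noteq> p i))"
  have bound: "\<bar>linear_cost m c z\<bar> \<le> ?b" if "z \<in> P" for z
    by (rule abs_linear_cost_le) (use P(3) that in blast)
  have b: "?b \<ge> 0" unfolding abs_sum_def by (simp add: sum_nonneg)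
  have f_ext: "?f z = linear_cost m c z" if "z \<in> extensions P j p" for z
    using that unfolding extensions_def by simp
  have f_other: "?f z > ?b" if z: "z \<in> P" "z \<notin> extensions P j p" for z
  proof -
    obtain i where i: "i < j" "z i \<noteq> p i" using z unfolding extensions_def by blast
    have "1 = (of_bool (z i \<noteq> p i) :: int)" using i by simp
    also have "\<dots> \<le> (\<Sum>i<j. of_bool (z i \<noteq> p i))" using i by (intro member_le_sum) auto
    finally have "(2 * ?b + 1) * 1 \<le> (2 * ?b + 1) * (\<Sum>i<j. of_bool (z i \<noteq> p i))"
      using b by (intro mult_left_mono) auto
    then have "2 * ?b + 1 \<le> (2 * ?b + 1) * (\<Sum>i<j. of_bool (z i \<noteq> p i))" by simp
    moreover have "?b < linear_cost m c z + (2 * ?b + 1)" using bound[OF z(1)] by linarith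
    ultimately show ?thesis using less_le_trans add_left_mono by blast
  qed
  have value_le: "node_value m c P j p \<le> ?f z" if "z \<in> P" for z
    unfolding node_value_def using that P(1) by (intro Min_le) auto
  have "node_value m c P j p \<in> ?f ` P"
    unfolding node_value_def using P(1,2) by (intro Min_in) auto
  then obtain z0 where z0: "z0 \<in> P" "node_value m c P j p = ?f z0" by blast
  have ext_P: "extensions P j p \<subseteq> P" unfolding extensions_def by blast
  show *: "node_value m c P j p \<le> linear_cost m c z" if "z \<in> extensions P j p" for z
    using value_le[of z] that ext_P f_ext[OF that] by auto
  show iff: "node_value m c P j p \<le> ?b \<longleftrightarrow> extensions P j p \<noteq> {}"
  proof
    assume "node_value m c P j p \<le> ?b"
    then show "extensions P j p \<noteq> {}" using f_other[OF z0(1)] z0(2) by fastforce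
  next
    assume "extensions P j p \<noteq> {}"
    then obtain z where z: "z \<in> extensions P j p" by blast
    then show "node_value m c P j p \<le> ?b" using *[OF z] bound[of z] ext_P by fastforce
  qed
  show "\<exists>z\<in>extensions P j p. node_value m c P j p = linear_cost m c z" if "extensions P j p \<noteq> {}"
    using that iff f_other[OF z0(1)] f_ext z0 by (metis not_le)
qed

text \<open>
  There are at least as many elements of \<open>W\<close> outside \<open>S - B\<close> as
  elements of \<open>B\<close>, by counting, so the elements of \<open>B\<close> can be traded
  one for one.
\<close>

lemma exchange_cheaper:
  fixes f :: "'a \<Rightarrow> int"
  assumes S: "finite S" "card S = k" and W: "finite W" "card W = k"
    and B: "B \<subseteq> S" "\<And>w b. w \<in> W \<Longrightarrow> b \<in> B \<Longrightarrow> f w \<le> f b"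
  obtains S' where "card S' = k" "(S - B) \<subseteq> S'" "S' \<subseteq> (S - B) \<union> W" "sum f S' \<le> sum f S"
proof -
  let ?G = "S - B"
  have finB: "finite B" using B(1) S(1) finite_subset by blast
  have card_G: "card ?G + card B = k"
    using B(1) S by (metis card_Diff_subset card_mono finB le_add_diff_inverse2)
  have "card B \<le> card (W - ?G)"
  proof -
    have "card B = card W - card ?G" using card_G W(2) by simp
    also have "\<dots> \<le> card (W - ?G)" using S(1) by (intro diff_card_le_card_Diff) simp
    finally show ?thesis .
  qed
  then obtain B' where B': "B' \<subseteq> W - ?G" "card B' = card B" "finite B'"
    by (meson obtain_subset_with_card_n)
  obtain h where h: "bij_betw h B' B"
    using B'(2,3) finB finite_same_card_bij by blast
  have "sum f B' \<le> (\<Sum>w\<in>B'. f (h w))"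
    using B(2) B'(1) h by (intro sum_mono) (auto simp: bij_betw_def)
  also have "\<dots> = sum f B"
    by (rule sum.reindex_bij_betw[OF h])
  finally have le: "sum f B' \<le> sum f B" .
  have disj: "?G \<inter> B' = {}" using B'(1) by blast
  show ?thesis
  proof (rule that[of "?G \<union> B'"])
    show "card (?G \<union> B') = k" using disj S(1) B'(2,3) card_G by (simp add: card_Un_disjoint)
    have "sum f (?G \<union> B') = sum f ?G + sum f B'" using disj S(1) B'(3) by (simp add: sum.union_disjoint)
    also have "\<dots> \<le> sum f ?G + sum f B" using le by simp
    also have "\<dots> = sum f S" using B(1) S(1) by (metis sum.subset_diff)
    finally show "sum f (?G \<union> B') \<le> sum f S" .
  qed (use B'(1) in blast)+
qed


text \<open>
  The last conjunct is the point: restricting attention to the kept nodes does not raise the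
  least cost of \<open>k\<close> distinct points. If a step discards a node that an optimal
  selection uses, then \<open>k\<close> nodes of no greater value were kept. Each of them is
  extended by a point that attains its value, these \<open>k\<close> points are distinct since
  they have distinct prefixes, and each is at most as expensive as every point below a discarded
  node. By \<open>exchange_cheaper\<close> they can replace the points below discarded nodes.
\<close>

lemma beam_invariant:
  assumes P: "finite P" "P \<noteq> {}" "\<forall>z\<in>P. \<forall>j<m. z j \<in> {0, 1}"
    and k: "k \<ge> 1" and "j \<le> m"
  shows "distinct (beam m c P k j) \<and> length (beam m c P k j) \<le> k \<and>
    (\<forall>p\<in>set (beam m c P k j). (\<forall>i\<ge>j. p i = 0) \<and> extensions P j p \<noteq> {}) \<and>
    (\<forall>S\<subseteq>P. card S = k \<longrightarrow> (\<exists>S'\<subseteq>P. card S' = k \<and>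
      sum (linear_cost m c) S' \<le> sum (linear_cost m c) S \<and>
      (\<forall>z\<in>S'. \<exists>p\<in>set (beam m c P k j). z \<in> extensions P j p)))"
  using \<open>j \<le> m\<close>
proof (induction j)
  case 0
  have "extensions P 0 p = P" for p unfolding extensions_def by simp
  then have "\<exists>S'\<subseteq>P. card S' = k \<and> sum (linear_cost m c) S' \<le> sum (linear_cost m c) S \<and>
      (\<forall>z\<in>S'. \<exists>p\<in>set (beam m c P k 0). z \<in> extensions P 0 p)" if "S \<subseteq> P" "card S = k" for S
    using that by (intro exI[of _ S]) auto
  then show ?case using k P(2) \<open>\<And>p. extensions P 0 p = P\<close> by simp
next
  case (Suc j)
  define T where "T = beam m c P k j"
  define C where "C = children j T"
  define V where "V = node_value m c P (Suc j)"
  define T' where "T' = select k (abs_sum m c) V C"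
  let ?ext = "extensions P (Suc j)"
  let ?cost = "linear_cost m c"
  have beam_Suc: "beam m c P k (Suc j) = T'"
    by (simp add: T'_def C_def T_def V_def)
  note inv = Suc.IH[OF Suc_leD[OF Suc.prems], folded T_def]
  have dist: "distinct T" by (rule inv[THEN conjunct1])
  have padded: "p i = 0" if "p \<in> set T" "i \<ge> j" for p i
    using inv[THEN conjunct2, THEN conjunct2, THEN conjunct1] that by blast
  note IH = inv[THEN conjunct2, THEN conjunct2, THEN conjunct2, rule_format]
  have "inj_on (\<lambda>p. p(j := 1)) (set T)"
  proof (rule inj_onI)
    fix p q assume pq: "p \<in> set T" "q \<in> set T" "p(j := 1) = q(j := 1)"
    then have "p j = 0" "q j = 0" using padded by auto
    then show "p = q" using pq(3) by (metis fun_upd_triv fun_upd_upd)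
  qed
  moreover have "p(j := 1) \<notin> set T" for p
    using padded[of "p(j := 1)" j] by auto
  ultimately have dist_C: "distinct C"
    unfolding C_def children_def using dist by (auto simp: distinct_map)
  have padded_C: "q i = 0" if "q \<in> set C" "i \<ge> Suc j" for q i
    using that padded unfolding C_def children_def by auto
  have cover: "\<exists>q\<in>set C. z \<in> ?ext q" if z: "z \<in> extensions P j p" and p: "p \<in> set T" for z p
  proof -
    have "z j \<in> {0, 1}" using z P(3) Suc.prems unfolding extensions_def by auto
    then have "z \<in> ?ext p \<or> z \<in> ?ext (p(j := 1))"
      using z padded[OF p, of j] unfolding extensions_def by (auto simp: less_Suc_eq)
    then show ?thesis using p unfolding C_def children_def by auto
  qed
  have feasible: "V q \<le> abs_sum m c \<longleftrightarrow> ?ext q \<noteq> {}" for q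
    unfolding V_def by (rule node_value_extensions(1)[OF P])
  have V_le: "V q \<le> ?cost z" if "z \<in> ?ext q" for q z
    unfolding V_def using that by (rule node_value_extensions(2)[OF P])
  have T'_sub: "set T' \<subseteq> {q \<in> set C. V q \<le> abs_sum m c}" and dist_T': "distinct T'"
    and len_T': "length T' \<le> k"
    and T'_best: "set T' = {q \<in> set C. V q \<le> abs_sum m c} \<or> length T' = k \<and>
      (\<forall>p\<in>set T'. \<forall>q\<in>{q \<in> set C. V q \<le> abs_sum m c} - set T'. V p \<le> V q)"
    unfolding T'_def by (rule select_spec[OF dist_C])+
  have "\<exists>S''\<subseteq>P. card S'' = k \<and> sum ?cost S'' \<le> sum ?cost S \<and> (\<forall>z\<in>S''. \<exists>p\<in>set T'. z \<in> ?ext p)"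
    if S: "S \<subseteq> P" "card S = k" for S
  proof -
    obtain S' where S': "S' \<subseteq> P" "card S' = k" "sum ?cost S' \<le> sum ?cost S"
      "\<forall>z\<in>S'. \<exists>p\<in>set T. z \<in> extensions P j p"
      using IH[OF S] by (elim exE conjE)
    have fin: "finite S'" using S'(1) P(1) finite_subset by blast
    have child: "\<exists>q\<in>{q \<in> set C. V q \<le> abs_sum m c}. z \<in> ?ext q" if "z \<in> S'" for z
      using S'(4) cover that feasible by blast
    from T'_best show ?thesis
    proof
      assume "set T' = {q \<in> set C. V q \<le> abs_sum m c}"
      then show ?thesis using S'(1-3) child by (intro exI[of _ S']) simp
    next
      assume best: "length T' = k \<and>
        (\<forall>p\<in>set T'. \<forall>q\<in>{q \<in> set C. V q \<le> abs_sum m c} - set T'. V p \<le> V q)"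
      \<comment> \<open>the points of the selection that lie below discarded children only\<close>
      define B where "B = {z \<in> S'. \<not> (\<exists>p\<in>set T'. z \<in> ?ext p)}"
      have "\<forall>q\<in>set T'. \<exists>z\<in>?ext q. V q = ?cost z"
        unfolding V_def using node_value_extensions(3)[OF P] T'_sub feasible by blast
      then obtain w where w: "\<And>q. q \<in> set T' \<Longrightarrow> w q \<in> ?ext q"
        "\<And>q. q \<in> set T' \<Longrightarrow> V q = ?cost (w q)"
        by metis
      have "inj_on w (set T')"
      proof (rule inj_onI, rule ext)
        fix p q i assume pq: "p \<in> set T'" "q \<in> set T'" "w p = w q"
        have pq_C: "p \<in> set C" "q \<in> set C" using pq(1,2) T'_sub by blast+
        show "p i = q i"
        proof (cases "i < Suc j")
          case True
          then show ?thesis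
            using w(1)[OF pq(1)] w(1)[OF pq(2)] pq(3) unfolding extensions_def by simp
        next
          case False
          then have "Suc j \<le> i" by simp
          then show ?thesis using padded_C[OF pq_C(1)] padded_C[OF pq_C(2)] by simp
        qed
      qed
      then have card_W: "card (w ` set T') = k"
        using best dist_T' by (simp add: card_image distinct_card)
      have cheap: "?cost a \<le> ?cost b" if "a \<in> w ` set T'" "b \<in> B" for a b
      proof -
        obtain p where p: "p \<in> set T'" "a = w p" using \<open>a \<in> w ` set T'\<close> by blast
        obtain q where q: "q \<in> {q \<in> set C. V q \<le> abs_sum m c}" "b \<in> ?ext q"
          using child \<open>b \<in> B\<close> unfolding B_def by blast
        then have "q \<notin> set T'" using \<open>b \<in> B\<close> unfolding B_def by blast
        then have "V p \<le> V q" using best p(1) q(1) by blast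
        then show ?thesis using w(2)[OF p(1)] p(2) V_le[OF q(2)] by simp
      qed
      obtain S'' where S'': "card S'' = k" "S'' \<subseteq> (S' - B) \<union> w ` set T'" "sum ?cost S'' \<le> sum ?cost S'"
      proof (rule exchange_cheaper[OF fin S'(2) _ card_W, of B ?cost])
        show "finite (w ` set T')" "B \<subseteq> S'" unfolding B_def by auto
      qed (use cheap in blast)+
      have "\<exists>p\<in>set T'. z \<in> ?ext p" if "z \<in> S''" for z
        using that S''(2) w(1) unfolding B_def by blast
      moreover from this have "S'' \<subseteq> P" unfolding extensions_def by blast
      ultimately show ?thesis using S''(1) order_trans[OF S''(3) S'(3)] by (intro exI[of _ S'']) simp
    qed
  qed
  moreover have "(\<forall>i\<ge>Suc j. p i = 0) \<and> ?ext p \<noteq> {}" if "p \<in> set T'" for p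
    using that T'_sub padded_C feasible by blast
  ultimately show ?case unfolding beam_Suc using dist_T' len_T' by simp
qed

text \<open>
  At the last level a node has only itself as an extension, so the nodes are points; a set of
  \<open>k\<close> points among at most \<open>k\<close> nodes must consist of all of them.
\<close>

lemma beam_best:
  fixes c :: "nat \<Rightarrow> int"
  assumes P: "finite P" "P \<noteq> {}" "\<forall>z\<in>P. \<forall>j<m. z j \<in> {0, 1}" "P \<subseteq> vecs m"
    and k: "k \<ge> 1"
  defines "T \<equiv> beam m c P k m"
  shows "set T \<subseteq> P" "distinct T" "length T \<le> k"
    and "S \<subseteq> P \<Longrightarrow> card S = k \<Longrightarrow> length T = k"
    and "S \<subseteq> P \<Longrightarrow> card S = k \<Longrightarrow> sum (linear_cost m c) (set T) \<le> sum (linear_cost m c) S"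
proof -
  note inv = beam_invariant[of P m k m c, OF P(1-3) k order_refl, folded T_def]
  have dist: "distinct T" by (rule inv[THEN conjunct1])
  have len: "length T \<le> k" by (rule inv[THEN conjunct2, THEN conjunct1])
  note nodes = inv[THEN conjunct2, THEN conjunct2, THEN conjunct1, rule_format]
  note dominate = inv[THEN conjunct2, THEN conjunct2, THEN conjunct2, rule_format]
  have leaf: "z = p" if "p \<in> set T" "z \<in> extensions P m p" for p z
  proof
    fix i
    have "z \<in> vecs m" using that(2) P(4) unfolding extensions_def by blast
    then show "z i = p i"
      using that(2) nodes[OF that(1)] unfolding extensions_def vecs_def by (cases "i < m") auto
  qed
  have *: "length T = k \<and> sum (linear_cost m c) (set T) \<le> sum (linear_cost m c) S"
    if S: "S \<subseteq> P" "card S = k" for S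
  proof -
    obtain S' where S': "card S' = k" "sum (linear_cost m c) S' \<le> sum (linear_cost m c) S"
      "\<forall>z\<in>S'. \<exists>p\<in>set T. z \<in> extensions P m p"
      using dominate[OF S] by (elim exE conjE)
    then have sub: "S' \<subseteq> set T" using leaf by blast
    have "card (set T) \<le> k" using len dist distinct_card by metis
    then have "S' = set T" using sub S'(1) by (intro card_seteq) auto
    then show ?thesis using S'(1,2) distinct_card[OF dist] by simp
  qed
  show "set T \<subseteq> P" 
  proof
    fix p assume p: "p \<in> set T"
    obtain z where z: "z \<in> extensions P m p" using nodes[OF p] by blast
    then have "z = p" by (rule leaf[OF p])
    then show "p \<in> P" using z unfolding extensions_def by blast
  qed
  show "distinct T" by (rule dist)
  show "length T \<le> k" by (rule len)
  show "S \<subseteq> P \<Longrightarrow> card S = k \<Longrightarrow> length T = k"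
    and "S \<subseteq> P \<Longrightarrow> card S = k \<Longrightarrow> sum (linear_cost m c) (set T) \<le> sum (linear_cost m c) S"
    using * by blast+
qed

section \<open>The optimization oracle and the input\<close>

datatype 'd input = Input (idx: 'd) (n_of: nat) (k_of: nat) (A_of: "nat \<Rightarrow> nat \<Rightarrow> rat")
  (a_of: "nat \<Rightarrow> rat") (b_of: rat) (x_of: "nat \<Rightarrow> rat")

definition numer :: "rat \<Rightarrow> int"
  where "numer r = fst (quotient_of r)"

definition denom :: "rat \<Rightarrow> int"
  where "denom r = snd (quotient_of r)"

lemma enc_rat_numer_denom: "enc_rat r = Cell (Atom (numer r)) (Atom (denom r))"
  by (simp add: enc_rat_def numer_def denom_def)

lemma denom_pos: "denom r > 0"
  unfolding denom_def by (rule quotient_of_denom_pos')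

lemma numer_div_denom: "r = of_int (numer r) / of_int (denom r)"
  unfolding numer_def denom_def by (rule quotient_of_div) simp

lemma enc_rat_of_int: "enc_rat (of_int z) = Cell (Atom z) (Atom 1)"
proof -
  have "quotient_of (of_int z) = (z, 1)"
    using quotient_of_int[of z] unfolding Rat.of_int_def of_int_rat[symmetric] by simp
  then show ?thesis unfolding enc_rat_def by simp
qed

lemma ptime_numer: "ptime D N e (\<lambda>x. enc_rat (r x)) \<Longrightarrow> ptime D N e (\<lambda>x. Atom (numer (r x)))"
  unfolding enc_rat_numer_denom by (rule ptime_left)

lemma ptime_denom: "ptime D N e (\<lambda>x. enc_rat (r x)) \<Longrightarrow> ptime D N e (\<lambda>x. Atom (denom (r x)))"
  unfolding enc_rat_numer_denom by (rule ptime_right)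

text \<open>
  The oracle as a function of the query, a pair of a family index and an objective. The answer
  is the deterministic output of the given program, and \<open>minimizer\<close> is the vector
  encoded in it.
\<close>

locale optimization_oracle =
  fixes Q :: "'d \<Rightarrow> (nat \<Rightarrow> real) set" and m :: "'d \<Rightarrow> nat" and code :: "'d \<Rightarrow> val"
    and answer :: "'d \<times> (nat \<Rightarrow> rat) \<Rightarrow> val" and minimizer :: "'d \<times> (nat \<Rightarrow> rat) \<Rightarrow> nat \<Rightarrow> rat"
  assumes binary: "\<And>d. binary_polytope (m d) (Q d)"
    and ptime_answer: "ptime {q. snd q \<in> vecs (m (fst q))} (\<lambda>q. m (fst q))
      (\<lambda>q. enc_list [code (fst q), enc_vec enc_rat (m (fst q)) (snd q)]) answer"
    and answer_empty: "\<And>d c. c \<in> vecs (m d) \<Longrightarrow> Q d = {} \<Longrightarrow> answer (d, c) = Atom 0"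
    and answer_nonempty: "\<And>d c. c \<in> vecs (m d) \<Longrightarrow> Q d \<noteq> {} \<Longrightarrow>
      answer (d, c) = Cell (Atom 1) (enc_vec enc_rat (m d) (minimizer (d, c)))"
    and minimizer_mem: "\<And>d c. c \<in> vecs (m d) \<Longrightarrow> Q d \<noteq> {} \<Longrightarrow> real_vec (minimizer (d, c)) \<in> Q d"
    and minimizer_le: "\<And>d c q. c \<in> vecs (m d) \<Longrightarrow> q \<in> Q d \<Longrightarrow>
      dot (m d) (real_vec c) (real_vec (minimizer (d, c))) \<le> dot (m d) (real_vec c) q"
begin

abbreviation "cols x \<equiv> m (idx x)"

definition enc_input :: "'d input \<Rightarrow> val"
  where "enc_input x = enc_list [code (idx x), enc_nat (n_of x), enc_nat (cols x), enc_nat (k_of x),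
    enc_mat enc_rat (n_of x) (cols x) (A_of x), enc_vec enc_rat (n_of x) (a_of x), enc_rat (b_of x),
    enc_vec enc_rat (n_of x) (x_of x)]"

text \<open>
  The environment \<open>e\<close> determines the input \<open>r y\<close> and leaves a budget
  that suffices for loops over rows, columns and nodes. All further computations are stated for
  arbitrary such environments, so that they can be repeated inside any loop. The factor 2 is
  there for lists of children, which have up to twice \<open>k_of (r y)\<close> entries.
\<close>

definition reads_input :: "'x set \<Rightarrow> ('x \<Rightarrow> nat) \<Rightarrow> ('x \<Rightarrow> val) \<Rightarrow> ('x \<Rightarrow> 'd input) \<Rightarrow> bool"
  where "reads_input D N e r \<longleftrightarrow> ptime D N e (\<lambda>y. enc_input (r y)) \<and>
    (\<forall>y\<in>D. k_of (r y) \<ge> 1 \<and> 2 * (k_of (r y) + cols (r y) + n_of (r y)) \<le> N y)"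

lemma reads_input_ptime: "reads_input D N e r \<Longrightarrow> ptime D N e (\<lambda>y. enc_input (r y))"
  unfolding reads_input_def by blast

lemma reads_input_bounds:
  assumes "reads_input D N e r" "y \<in> D"
  shows "k_of (r y) \<ge> 1" "n_of (r y) \<le> N y" "cols (r y) \<le> N y" "Suc (cols (r y)) \<le> N y" "2 * k_of (r y) \<le> N y"
    "k_of (r y) \<le> N y"
  using assms unfolding reads_input_def by force+

lemma reads_input_step:
  "reads_input D N e r \<Longrightarrow> reads_input (steps D len) (\<lambda>y. N (fst y)) (step_env e) (\<lambda>y. r (fst y))"
  unfolding reads_input_def using ptime_step by fastforce

lemma reads_input_subdomain: "reads_input D N e r \<Longrightarrow> D' \<subseteq> D \<Longrightarrow> reads_input D' N e r"
  unfolding reads_input_def using ptime_subdomain by blast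

lemma reads_input_Cell: "reads_input D N e r \<Longrightarrow> reads_input D N (\<lambda>y. Cell (e y) (f y)) r"
  unfolding reads_input_def using ptime_trans[OF ptime_fst] by blast

lemma ptime_fields:
  assumes "reads_input D N e r"
  shows ptime_code: "ptime D N e (\<lambda>y. code (idx (r y)))"
    and ptime_n: "ptime D N e (\<lambda>y. Atom (int (n_of (r y))))"
    and ptime_cols: "ptime D N e (\<lambda>y. Atom (int (cols (r y))))"
    and ptime_k: "ptime D N e (\<lambda>y. Atom (int (k_of (r y))))"
    and ptime_A: "ptime D N e (\<lambda>y. enc_mat enc_rat (n_of (r y)) (cols (r y)) (A_of (r y)))"
    and ptime_a: "ptime D N e (\<lambda>y. enc_vec enc_rat (n_of (r y)) (a_of (r y)))"
    and ptime_b: "ptime D N e (\<lambda>y. enc_rat (b_of (r y)))"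
    and ptime_x: "ptime D N e (\<lambda>y. enc_vec enc_rat (n_of (r y)) (x_of (r y)))"
proof -
  note 0 = reads_input_ptime[OF assms, unfolded enc_input_def enc_list.simps enc_nat_def]
  note 1 = ptime_right[OF 0]
  note 2 = ptime_right[OF 1]
  note 3 = ptime_right[OF 2]
  note 4 = ptime_right[OF 3]
  note 5 = ptime_right[OF 4]
  note 6 = ptime_right[OF 5]
  note 7 = ptime_right[OF 6]
  show "ptime D N e (\<lambda>y. code (idx (r y)))" by (rule ptime_left[OF 0])
  show "ptime D N e (\<lambda>y. Atom (int (n_of (r y))))" by (rule ptime_left[OF 1])
  show "ptime D N e (\<lambda>y. Atom (int (cols (r y))))" by (rule ptime_left[OF 2])
  show "ptime D N e (\<lambda>y. Atom (int (k_of (r y))))" by (rule ptime_left[OF 3])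
  show "ptime D N e (\<lambda>y. enc_mat enc_rat (n_of (r y)) (cols (r y)) (A_of (r y)))" by (rule ptime_left[OF 4])
  show "ptime D N e (\<lambda>y. enc_vec enc_rat (n_of (r y)) (a_of (r y)))" by (rule ptime_left[OF 5])
  show "ptime D N e (\<lambda>y. enc_rat (b_of (r y)))" by (rule ptime_left[OF 6])
  show "ptime D N e (\<lambda>y. enc_vec enc_rat (n_of (r y)) (x_of (r y)))" by (rule ptime_left[OF 7])
qed

section \<open>Integral cost coefficients\<close>

text \<open>
  The vector \<open>a_of x\<close> is treated as an additional last column of the matrix, with
  index \<open>cols x\<close>; the constant term of the inequality then is one more coefficient.
\<close>

definition col :: "'d input \<Rightarrow> nat \<Rightarrow> nat \<Rightarrow> rat"
  where "col x j i = (if j < cols x then A_of x i j else a_of x i)"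

definition term_num :: "'d input \<Rightarrow> nat \<Rightarrow> nat \<Rightarrow> int"
  where "term_num x i j = numer (x_of x i) * numer (col x j i)"

definition term_den :: "'d input \<Rightarrow> nat \<Rightarrow> nat \<Rightarrow> int"
  where "term_den x i j = denom (x_of x i) * denom (col x j i)"

definition scale :: "'d input \<Rightarrow> int"
  where "scale x = (\<Prod>i<n_of x. \<Prod>j<Suc (cols x). term_den x i j)"

text \<open>
  The coefficient of \<open>y j\<close> multiplied by the common denominator \<open>scale
  x\<close>. The language has no division, so the product of all denominators but one is
  computed directly, skipping the entry \<open>(i, j)\<close>.
\<close>

definition coef :: "'d input \<Rightarrow> nat \<Rightarrow> int"
  where "coef x j = (\<Sum>i<n_of x. term_num x i j *
    (\<Prod>i'<n_of x. \<Prod>j'<Suc (cols x). if i' = i \<and> j' = j then 1 else term_den x i' j'))"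

lemma prod_remove_entry:
  fixes q :: "nat \<Rightarrow> nat \<Rightarrow> 'a::comm_monoid_mult"
  assumes "i < n" "j < l"
  shows "(\<Prod>i'<n. \<Prod>j'<l. if i' = i \<and> j' = j then 1 else q i' j') * q i j = (\<Prod>i'<n. \<Prod>j'<l. q i' j')"
proof -
  have "(\<Prod>j'<l. if i' = i \<and> j' = j then q i j else 1) = (if i' = i then q i j else 1)" for i'
    using assms(2) by (cases "i' = i") (simp_all add: prod.delta)
  then have "q i j = (\<Prod>i'<n. \<Prod>j'<l. if i' = i \<and> j' = j then q i j else 1)"
    using assms(1) by (simp add: prod.delta)
  then have "(\<Prod>i'<n. \<Prod>j'<l. if i' = i \<and> j' = j then 1 else q i' j') * q i j =
      (\<Prod>i'<n. \<Prod>j'<l. (if i' = i \<and> j' = j then 1 else q i' j') * (if i' = i \<and> j' = j then q i j else 1))"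
    by (simp only: prod.distrib)
  also have "\<dots> = (\<Prod>i'<n. \<Prod>j'<l. q i' j')"
    by (intro prod.cong) auto
  finally show ?thesis .
qed

lemma term_den_pos: "term_den x i j > 0"
  unfolding term_den_def using denom_pos by simp

lemma scale_pos: "scale x > 0"
  unfolding scale_def by (intro prod_pos ballI term_den_pos)

lemma coef_eq:
  assumes "j \<le> cols x"
  shows "of_int (coef x j) = (of_int (scale x) * (\<Sum>i<n_of x. x_of x i * col x j i) :: rat)"
proof -
  let ?R = "\<lambda>i. \<Prod>i'<n_of x. \<Prod>j'<Suc (cols x). if i' = i \<and> j' = j then 1 else term_den x i' j'"
  have "of_int (term_num x i j * ?R i) = of_int (scale x) * (x_of x i * col x j i)" if "i < n_of x" for i
  proof -
    have "scale x = ?R i * term_den x i j"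
      unfolding scale_def using prod_remove_entry[of i "n_of x" j "Suc (cols x)" "term_den x"] assms that by simp
    moreover have "x_of x i * col x j i * of_int (term_den x i j) = of_int (term_num x i j)"
    proof -
      have nz: "of_int (denom (x_of x i)) \<noteq> (0 :: rat)" "of_int (denom (col x j i)) \<noteq> (0 :: rat)"
        using denom_pos[of "x_of x i"] denom_pos[of "col x j i"] by simp_all
      have "x_of x i * of_int (denom (x_of x i)) = of_int (numer (x_of x i))"
        using numer_div_denom[of "x_of x i"] nz(1) by (simp add: eq_divide_eq)
      moreover have "col x j i * of_int (denom (col x j i)) = of_int (numer (col x j i))"
        using numer_div_denom[of "col x j i"] nz(2) by (simp add: eq_divide_eq)
      moreover have "x_of x i * col x j i * of_int (term_den x i j) =
          (x_of x i * of_int (denom (x_of x i))) * (col x j i * of_int (denom (col x j i)))"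
        unfolding term_den_def of_int_mult by (simp only: mult_ac)
      ultimately show ?thesis unfolding term_num_def of_int_mult by simp
    qed
    ultimately have "of_int (term_num x i j * ?R i) = x_of x i * col x j i * of_int (term_den x i j) * of_int (?R i)"
      "of_int (scale x) * (x_of x i * col x j i) = of_int (?R i) * of_int (term_den x i j) * (x_of x i * col x j i)"
      by (simp_all only: of_int_mult)
    then show ?thesis by (simp only: mult_ac)
  qed
  then show ?thesis unfolding coef_def by (simp add: sum_distrib_left)
qed

lemma ptime_col:
  assumes r: "reads_input D N e r"
    and ij: "ptime D N e (\<lambda>y. Atom (int (i y)))" "ptime D N e (\<lambda>y. Atom (int (j y)))"
    and i: "\<And>y. y \<in> D \<Longrightarrow> i y < n_of (r y)"
  shows "ptime D N e (\<lambda>y. enc_rat (col (r y) (j y) (i y)))"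
proof -
  have "ptime D N e (\<lambda>y. Atom (of_bool (int (j y) < int (cols (r y)))))"
    by (rule ptime_less[OF ij(2) ptime_cols[OF r]])
  then have c: "ptime D N e (\<lambda>y. Atom (of_bool (j y < cols (r y))))" by simp
  have "ptime D N e (\<lambda>y. if j y < cols (r y) then enc_rat (A_of (r y) (i y) (j y)) else enc_rat (a_of (r y) (i y)))"
  proof (rule ptime_if[OF c])
    let ?D = "{y \<in> D. j y < cols (r y)}"
    have r': "reads_input ?D N e r" by (rule reads_input_subdomain[OF r]) blast
    have "ptime ?D N e (\<lambda>y. enc_vec enc_rat (cols (r y)) (A_of (r y) (i y)))"
      by (rule ptime_vec_nth[OF ptime_A[OF r', unfolded enc_mat_def] ptime_subdomain[OF ij(1)]])
        (use i reads_input_bounds[OF r] in auto)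
    then show "ptime ?D N e (\<lambda>y. enc_rat (A_of (r y) (i y) (j y)))"
      by (rule ptime_vec_nth[OF _ ptime_subdomain[OF ij(2)]]) (use reads_input_bounds[OF r] in auto)
    have "ptime D N e (\<lambda>y. enc_rat (a_of (r y) (i y)))"
      by (rule ptime_vec_nth[OF ptime_a[OF r] ij(1)]) (use i reads_input_bounds[OF r] in auto)
    then show "ptime {y \<in> D. \<not> j y < cols (r y)} N e (\<lambda>y. enc_rat (a_of (r y) (i y)))"
      by (rule ptime_subdomain) blast
  qed
  then show ?thesis by (rule ptime_cong) (simp add: col_def)
qed

lemma ptime_term:
  assumes r: "reads_input D N e r"
    and ij: "ptime D N e (\<lambda>y. Atom (int (i y)))" "ptime D N e (\<lambda>y. Atom (int (j y)))"
    and i: "\<And>y. y \<in> D \<Longrightarrow> i y < n_of (r y)"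
  shows "ptime D N e (\<lambda>y. Atom (term_num (r y) (i y) (j y)))"
    and "ptime D N e (\<lambda>y. Atom (term_den (r y) (i y) (j y)))"
proof -
  have x: "ptime D N e (\<lambda>y. enc_rat (x_of (r y) (i y)))"
    by (rule ptime_vec_nth[OF ptime_x[OF r] ij(1)]) (use i reads_input_bounds[OF r] in auto)
  note c = ptime_col[OF assms]
  show "ptime D N e (\<lambda>y. Atom (term_num (r y) (i y) (j y)))"
    unfolding term_num_def by (rule ptime_mult[OF ptime_numer[OF x] ptime_numer[OF c]])
  show "ptime D N e (\<lambda>y. Atom (term_den (r y) (i y) (j y)))"
    unfolding term_den_def by (rule ptime_mult[OF ptime_denom[OF x] ptime_denom[OF c]])
qed

lemma ptime_Suc_cols:
  assumes "reads_input D N e r"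
  shows "ptime D N e (\<lambda>y. Atom (int (Suc (cols (r y)))))"
  using ptime_add[OF ptime_const[of _ _ _ 1] ptime_cols[OF assms]] by simp

lemma ptime_scale:
  assumes r: "reads_input D N e r"
  shows "ptime D N e (\<lambda>y. Atom (scale (r y)))"
  unfolding scale_def
proof (rule ptime_prod[OF ptime_n[OF r]])
  note r1 = reads_input_step[OF r, of "\<lambda>y. n_of (r y)"]
  show "ptime (steps D (\<lambda>y. n_of (r y))) (\<lambda>y. N (fst y)) (step_env e)
      (\<lambda>y. Atom (\<Prod>j<Suc (cols (r (fst y))). term_den (r (fst y)) (snd y) j))"
  proof (rule ptime_prod[OF ptime_Suc_cols[OF r1]])
    show "ptime (steps (steps D (\<lambda>y. n_of (r y))) (\<lambda>y. Suc (cols (r (fst y))))) (\<lambda>y. N (fst (fst y)))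
        (step_env (step_env e)) (\<lambda>y. Atom (term_den (r (fst (fst y))) (snd (fst y)) (snd y)))"
      by (rule ptime_term[OF reads_input_step[OF r1] ptime_step[OF ptime_snd] ptime_snd]) auto
  qed (use reads_input_bounds[OF r] in auto)
qed (use reads_input_bounds[OF r] in auto)

lemma ptime_coef:
  assumes r: "reads_input D N e r" and j: "ptime D N e (\<lambda>y. Atom (int (j y)))"
  shows "ptime D N e (\<lambda>y. Atom (coef (r y) (j y)))"
  unfolding coef_def
proof (rule ptime_sum[OF ptime_n[OF r]], rule_tac [2] ptime_mult)
  note r1 = reads_input_step[OF r, of "\<lambda>y. n_of (r y)"]
  note j1 = ptime_step[OF j, of "\<lambda>y. n_of (r y)"]
  let ?D1 = "steps D (\<lambda>y. n_of (r y))"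
  show "ptime ?D1 (\<lambda>y. N (fst y)) (step_env e) (\<lambda>y. Atom (term_num (r (fst y)) (snd y) (j (fst y))))"
    by (rule ptime_term[OF r1 ptime_snd j1]) auto
  note r2 = reads_input_step[OF r1, of "\<lambda>y. n_of (r (fst y))"]
  note j2 = ptime_step[OF j1, of "\<lambda>y. n_of (r (fst y))"]
  let ?D2 = "steps ?D1 (\<lambda>y. n_of (r (fst y)))"
  note r3 = reads_input_step[OF r2, of "\<lambda>y. Suc (cols (r (fst (fst y))))"]
  note j3 = ptime_step[OF j2, of "\<lambda>y. Suc (cols (r (fst (fst y))))"]
  let ?D3 = "steps ?D2 (\<lambda>y. Suc (cols (r (fst (fst y)))))"
  let ?e3 = "step_env (step_env (step_env e))"
  let ?N3 = "\<lambda>y. N (fst (fst (fst y)))"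
  show "ptime ?D1 (\<lambda>y. N (fst y)) (step_env e) (\<lambda>y. Atom (\<Prod>i'<n_of (r (fst y)). \<Prod>j'<Suc (cols (r (fst y))).
      if i' = snd y \<and> j' = j (fst y) then 1 else term_den (r (fst y)) i' j'))"
  proof (rule ptime_prod[OF ptime_n[OF r1]], rule_tac [2] ptime_prod[OF ptime_Suc_cols[OF r2]])
    have i: "ptime ?D3 ?N3 ?e3 (\<lambda>y. Atom (int (snd (fst (fst y)))))"
      by (rule ptime_step[OF ptime_step[OF ptime_snd]])
    have i': "ptime ?D3 ?N3 ?e3 (\<lambda>y. Atom (int (snd (fst y))))"
      by (rule ptime_step[OF ptime_snd])
    have "ptime ?D3 ?N3 ?e3 (\<lambda>y. Atom (of_bool
        (int (snd (fst y)) = int (snd (fst (fst y))) \<and> int (snd y) = int (j (fst (fst (fst y)))))))"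
      by (rule ptime_conj[OF ptime_eq[OF i' i] ptime_eq[OF ptime_snd j3]])
    then have c: "ptime ?D3 ?N3 ?e3 (\<lambda>y. Atom (of_bool
        (snd (fst y) = snd (fst (fst y)) \<and> snd y = j (fst (fst (fst y))))))"
      by simp
    have t: "ptime ?D3 ?N3 ?e3 (\<lambda>y. Atom (term_den (r (fst (fst (fst y)))) (snd (fst y)) (snd y)))"
      by (rule ptime_term[OF r3 i' ptime_snd]) auto
    have "ptime ?D3 ?N3 ?e3 (\<lambda>y. if snd (fst y) = snd (fst (fst y)) \<and> snd y = j (fst (fst (fst y)))
        then Atom 1 else Atom (term_den (r (fst (fst (fst y)))) (snd (fst y)) (snd y)))"
      by (rule ptime_if[OF c ptime_const ptime_subdomain[OF t]]) blast
    then show "ptime ?D3 ?N3 ?e3 (\<lambda>y. Atom (if snd (fst y) = snd (fst (fst y)) \<and> snd y = j (fst (fst (fst y)))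
        then 1 else term_den (r (fst (fst (fst y)))) (snd (fst y)) (snd y)))"
      by (rule ptime_cong) simp
  qed (use reads_input_bounds[OF r] in auto)
qed (use reads_input_bounds[OF r] in auto)

end

section \<open>Computing one step of the beam search\<close>

lemma length_filter_upt: "int (length (filter P [0..<n])) = (\<Sum>l<n. of_bool (P l))"
  by (induction n) auto

text \<open>
  The values \<open>V x l\<close> are available only as fractions with numerator \<open>a x
  l\<close> and positive denominator \<open>b x l\<close>, not necessarily reduced. Comparing
  them by cross multiplication suffices, since \<open>select\<close> uses nothing but
  comparisons.
\<close>

lemma ptime_select_indices:
  assumes n: "ptime D N e (\<lambda>x. Atom (int (n x)))" and n_le: "\<And>x. x \<in> D \<Longrightarrow> n x \<le> N x"
    and L: "ptime D N e (\<lambda>x. enc_list (map (\<lambda>l. Cell (f x l) (Cell (Atom (a x l)) (Atom (b x l)))) [0..<n x]))"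
    and V: "\<And>x l. x \<in> D \<Longrightarrow> l < n x \<Longrightarrow> a x l = b x l * V x l" "\<And>x l. x \<in> D \<Longrightarrow> l < n x \<Longrightarrow> b x l > 0"
    and u: "ptime D N e (\<lambda>x. Atom (u x))" and k: "ptime D N e (\<lambda>x. Atom (int (k x)))"
  defines "sel \<equiv> \<lambda>x. filter (\<lambda>l. V x l \<le> u x \<and> (\<Sum>l'<n x. of_bool (V x l' \<le> u x \<and>
      (V x l' < V x l \<or> V x l' = V x l \<and> l' < l))) < int (k x)) [0..<n x]"
  shows "ptime D N e (\<lambda>x. Cell (Atom (int (length (sel x)))) (enc_list (map (f x) (sel x))))"
proof -
  have entry: "ptime D' N' e' (\<lambda>y. Cell (f (r y) (i y)) (Cell (Atom (a (r y) (i y))) (Atom (b (r y) (i y)))))"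
    if L': "ptime D' N' e' (\<lambda>y. enc_list (map (\<lambda>l. Cell (f (r y) l) (Cell (Atom (a (r y) l)) (Atom (b (r y) l)))) [0..<n (r y)]))"
      and i: "ptime D' N' e' (\<lambda>y. Atom (int (i y)))"
      and bounds: "\<And>y. y \<in> D' \<Longrightarrow> i y < n (r y)" "\<And>y. y \<in> D' \<Longrightarrow> i y \<le> N' y"
    for D' :: "'y set" and N' e' i and r :: "'y \<Rightarrow> 'a"
    by (rule ptime_cong[OF ptime_nth[OF L' i]]) (use bounds in simp_all)
  let ?D1 = "steps D n" and ?N1 = "\<lambda>y. N (fst y)" and ?e1 = "step_env e"
  let ?D2 = "steps ?D1 (\<lambda>y. n (fst y))" and ?N2 = "\<lambda>y. N (fst (fst y))" and ?e2 = "step_env ?e1"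
  note L1 = ptime_step[OF L, of n]
  note L2 = ptime_step[OF L1, of "\<lambda>y. n (fst y)"]
  have idx2: "ptime ?D2 ?N2 ?e2 (\<lambda>y. Atom (int (snd (fst y))))" "ptime ?D2 ?N2 ?e2 (\<lambda>y. Atom (int (snd y)))"
    by (rule ptime_step[OF ptime_snd], rule ptime_snd)
  have E1: "ptime ?D1 ?N1 ?e1 (\<lambda>y. Cell (f (fst y) (snd y)) (Cell (Atom (a (fst y) (snd y))) (Atom (b (fst y) (snd y)))))"
    by (rule entry[OF L1 ptime_snd]) (use n_le in force)+
  have E2: "ptime ?D2 ?N2 ?e2 (\<lambda>y. Cell (f (fst (fst y)) (snd (fst y)))
      (Cell (Atom (a (fst (fst y)) (snd (fst y)))) (Atom (b (fst (fst y)) (snd (fst y))))))"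
    by (rule ptime_step[OF E1])
  have E2': "ptime ?D2 ?N2 ?e2 (\<lambda>y. Cell (f (fst (fst y)) (snd y))
      (Cell (Atom (a (fst (fst y)) (snd y))) (Atom (b (fst (fst y)) (snd y)))))"
    by (rule entry[OF L2 idx2(2)]) (use n_le in force)+
  note a1 = ptime_left[OF ptime_right[OF E1]] and b1 = ptime_right[OF ptime_right[OF E1]]
  note a2 = ptime_left[OF ptime_right[OF E2]] and b2 = ptime_right[OF ptime_right[OF E2]]
  note a2' = ptime_left[OF ptime_right[OF E2']] and b2' = ptime_right[OF ptime_right[OF E2']]
  note u1 = ptime_step[OF u, of n]
  have le1: "ptime ?D1 ?N1 ?e1 (\<lambda>y. Atom (of_bool (V (fst y) (snd y) \<le> u (fst y))))"
  proof (rule ptime_cong[OF ptime_not[OF ptime_less[OF ptime_mult[OF b1 u1] a1]]])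
    fix y assume "y \<in> ?D1"
    then show "Atom (of_bool (\<not> b (fst y) (snd y) * u (fst y) < a (fst y) (snd y))) =
        Atom (of_bool (V (fst y) (snd y) \<le> u (fst y)))"
      using V[of "fst y" "snd y"] by (simp add: not_less)
  qed
  have le2: "ptime ?D2 ?N2 ?e2 (\<lambda>y. Atom (of_bool (V (fst (fst y)) (snd y) \<le> u (fst (fst y)))))"
    by (rule ptime_subst[OF le1, of _ _ _ "\<lambda>y. (fst (fst y), snd y)", simplified fst_conv snd_conv],
        rule ptime_Cell[OF ptime_step[OF ptime_fst] ptime_snd]) auto
  have V_less: "V x l < V x l' \<longleftrightarrow> a x l * b x l' < a x l' * b x l" if "x \<in> D" "l < n x" "l' < n x" for x l l'
  proof -
    have "a x l * b x l' = (b x l * b x l') * V x l" "a x l' * b x l = (b x l * b x l') * V x l'"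
      using V(1) that by simp_all
    moreover have "b x l * b x l' > 0" using V(2) that by simp
    ultimately show ?thesis by (simp only: mult_less_cancel_left_pos)
  qed
  have less: "ptime ?D2 ?N2 ?e2 (\<lambda>y. Atom (of_bool (V (fst (fst y)) (snd y) < V (fst (fst y)) (snd (fst y)))))"
    by (rule ptime_cong[OF ptime_less[OF ptime_mult[OF a2' b2] ptime_mult[OF a2 b2']]]) (simp add: V_less)
  have greater: "ptime ?D2 ?N2 ?e2 (\<lambda>y. Atom (of_bool (V (fst (fst y)) (snd (fst y)) < V (fst (fst y)) (snd y))))"
    by (rule ptime_cong[OF ptime_less[OF ptime_mult[OF a2 b2'] ptime_mult[OF a2' b2]]]) (simp add: V_less)
  have before: "ptime ?D2 ?N2 ?e2 (\<lambda>y. Atom (of_bool (snd y < snd (fst y))))"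
    using ptime_less[OF idx2(2,1)] by simp
  have "ptime ?D2 ?N2 ?e2 (\<lambda>y. Atom (of_bool (V (fst (fst y)) (snd y) \<le> u (fst (fst y)) \<and>
      (V (fst (fst y)) (snd y) < V (fst (fst y)) (snd (fst y)) \<or>
       V (fst (fst y)) (snd y) = V (fst (fst y)) (snd (fst y)) \<and> snd y < snd (fst y)))))"
    by (rule ptime_cong[OF ptime_conj[OF le2 ptime_disj[OF less
          ptime_conj[OF ptime_conj[OF ptime_not[OF less] ptime_not[OF greater]] before]]]]) auto
  from ptime_sum[OF ptime_step[OF n] _ this]
  have rank: "ptime ?D1 ?N1 ?e1 (\<lambda>y. Atom (\<Sum>l'<n (fst y). of_bool (V (fst y) l' \<le> u (fst y) \<and>
      (V (fst y) l' < V (fst y) (snd y) \<or> V (fst y) l' = V (fst y) (snd y) \<and> l' < snd y))))"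
    using n_le by simp
  note keep = ptime_conj[OF le1 ptime_less[OF rank ptime_step[OF k]]]
  have "ptime D N e (\<lambda>x. enc_list (map (f x) (sel x)))"
    unfolding sel_def by (rule ptime_filter[OF n n_le keep ptime_subdomain[OF ptime_left[OF E1]]]) blast+
  moreover have "ptime D N e (\<lambda>x. Atom (int (length (sel x))))"
    unfolding sel_def length_filter_upt by (rule ptime_sum[OF n n_le keep])
  ultimately show ?thesis by (intro ptime_Cell)
qed

context optimization_oracle
begin

definition points :: "'d input \<Rightarrow> (nat \<Rightarrow> nat) set"
  where "points x = binary_points (cols x) (Q (idx x))"

definition big :: "'d input \<Rightarrow> int"
  where "big x = 2 * abs_sum (cols x) (coef x) + 1"

text \<open>
  On binary points the penalty for deviating from the prefix is affine: the deviation in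
  coordinate \<open>i\<close> is \<open>p i + (1 - 2 * int (p i)) * z i\<close>. Its linear part
  goes into the objective, its constant part is added in \<open>node_num\<close>.
\<close>

definition obj :: "'d input \<Rightarrow> nat \<Rightarrow> (nat \<Rightarrow> nat) \<Rightarrow> nat \<Rightarrow> int"
  where "obj x j p i = coef x i + (if i < j then big x * (1 - 2 * int (p i)) else 0)"

definition objective :: "'d input \<Rightarrow> nat \<Rightarrow> (nat \<Rightarrow> nat) \<Rightarrow> nat \<Rightarrow> rat"
  where "objective x j p = (\<lambda>i. if i < cols x then of_int (obj x j p i) else 0)"

definition node_min :: "'d input \<Rightarrow> nat \<Rightarrow> (nat \<Rightarrow> nat) \<Rightarrow> nat \<Rightarrow> rat"
  where "node_min x j p = minimizer (idx x, objective x j p)"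

definition node_den :: "'d input \<Rightarrow> nat \<Rightarrow> (nat \<Rightarrow> nat) \<Rightarrow> int"
  where "node_den x j p = (\<Prod>i<cols x. denom (node_min x j p i))"

text \<open>
  The value of a node as a fraction over \<open>node_den\<close>, read off from whichever
  minimizer the oracle returns.
\<close>

definition node_num :: "'d input \<Rightarrow> nat \<Rightarrow> (nat \<Rightarrow> nat) \<Rightarrow> int"
  where "node_num x j p = (\<Sum>i<cols x. obj x j p i * numer (node_min x j p i) *
      (\<Prod>i'<cols x. if i' = i then 1 else denom (node_min x j p i'))) +
    node_den x j p * (big x * (\<Sum>i<j. int (p i)))"

lemma objective_vecs: "objective x j p \<in> vecs (cols x)"
  unfolding objective_def vecs_def by simp

lemma node_den_pos: "node_den x j p > 0"
  unfolding node_den_def by (intro prod_pos ballI denom_pos)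

lemma points_binary: "\<forall>z\<in>points x. \<forall>j<cols x. z j \<in> {0, 1}"
  and points_vecs: "points x \<subseteq> vecs (cols x)"
  and finite_points: "finite (points x)"
  unfolding points_def using finite_binary_points by (auto simp: binary_points_def)

lemma points_nonempty: "Q (idx x) \<noteq> {} \<Longrightarrow> points x \<noteq> {}"
  unfolding points_def using min_at_binary_point[OF binary] by blast

lemma sum_obj:
  assumes "j \<le> cols x" "\<forall>i<j. p i \<in> {0, 1}" "z \<in> points x"
  shows "(\<Sum>i<cols x. obj x j p i * int (z i)) + big x * (\<Sum>i<j. int (p i)) =
    linear_cost (cols x) (coef x) z + big x * (\<Sum>i<j. of_bool (z i \<noteq> p i))"
proof -
  have "(\<Sum>i<cols x. obj x j p i * int (z i)) = linear_cost (cols x) (coef x) z +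
      (\<Sum>i<cols x. if i < j then big x * (1 - 2 * int (p i)) * int (z i) else 0)"
    unfolding linear_cost_def obj_def sum.distrib[symmetric] by (intro sum.cong) (auto simp: algebra_simps)
  also have "(\<Sum>i<cols x. if i < j then big x * (1 - 2 * int (p i)) * int (z i) else 0) =
      (\<Sum>i<j. big x * (1 - 2 * int (p i)) * int (z i))"
  proof -
    have "{..<cols x} \<inter> {i. i < j} = {..<j}" using assms(1) by auto
    then show ?thesis by (simp add: sum.If_cases)
  qed
  also have "\<dots> = (\<Sum>i<j. big x * of_bool (z i \<noteq> p i) - big x * int (p i))"
  proof (rule sum.cong)
    fix i assume i: "i \<in> {..<j}"
    then have "p i \<in> {0, 1}" "z i \<in> {0, 1}" using assms points_binary by auto
    then show "big x * (1 - 2 * int (p i)) * int (z i) = big x * of_bool (z i \<noteq> p i) - big x * int (p i)"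
      by auto
  qed simp
  finally show ?thesis by (simp add: sum_subtractf sum_distrib_left)
qed

lemma prod_remove:
  fixes q :: "nat \<Rightarrow> 'a::comm_monoid_mult"
  assumes "i < n"
  shows "(\<Prod>i'<n. if i' = i then 1 else q i') * q i = (\<Prod>i'<n. q i')"
  using prod_remove_entry[of i n 0 1 "\<lambda>i _. q i"] assms by simp

text \<open>
  The minimizer may be any point of the optimal face, and its coordinates may be fractions. Its
  objective value nevertheless equals that of an optimal binary point, hence it is the integer
  \<open>node_value\<close> up to the constant part of the penalty.
\<close>

lemma node_num_eq:
  assumes Q: "Q (idx x) \<noteq> {}" and j: "j \<le> cols x" and p: "\<forall>i<j. p i \<in> {0, 1}"
  shows "node_num x j p = node_den x j p * node_value (cols x) (coef x) (points x) j p"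
proof -
  let ?u = "node_min x j p" and ?c = "objective x j p" and ?m = "cols x"
  let ?val = "\<lambda>z. \<Sum>i<?m. obj x j p i * int (z i)"
  have dot_int: "dot ?m (real_vec ?c) (\<lambda>i. real (z i)) = of_int (?val z)" for z
    unfolding dot_def real_vec_def objective_def by simp
  obtain z where z: "z \<in> points x"
    and min: "\<And>q. q \<in> Q (idx x) \<Longrightarrow> dot ?m (real_vec ?c) (\<lambda>i. real (z i)) \<le> dot ?m (real_vec ?c) q"
    unfolding points_def using min_at_binary_point[OF binary Q] by blast
  have in_Q: "(\<lambda>i. real (w i)) \<in> Q (idx x)" if "w \<in> points x" for w
    using that unfolding points_def binary_points_def by blast
  have "dot ?m (real_vec ?c) (real_vec ?u) = of_int (?val z)"
    unfolding dot_int[symmetric] node_min_def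
    by (intro antisym minimizer_le[OF objective_vecs in_Q[OF z]] min minimizer_mem[OF objective_vecs Q])
  moreover have "dot ?m (real_vec ?c) (real_vec ?u) = of_rat (\<Sum>i<?m. of_int (obj x j p i) * ?u i)"
    unfolding dot_def real_vec_def objective_def by (simp add: of_rat_sum of_rat_mult)
  ultimately have "of_rat (\<Sum>i<?m. of_int (obj x j p i) * ?u i) = (of_rat (of_int (?val z)) :: real)"
    by (simp only: of_rat_of_int_eq)
  then have val_u: "(\<Sum>i<?m. of_int (obj x j p i) * ?u i) = of_int (?val z)"
    by (simp only: of_rat_eq_iff)
  let ?R = "\<lambda>i. \<Prod>i'<?m. if i' = i then 1 else denom (?u i')"
  have summand: "of_int (obj x j p i * numer (?u i) * ?R i) = of_int (node_den x j p) * (of_int (obj x j p i) * ?u i)"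
    if "i < ?m" for i
  proof -
    have "node_den x j p = ?R i * denom (?u i)"
      unfolding node_den_def using prod_remove[OF that, of "\<lambda>i. denom (?u i)"] by simp
    moreover have "?u i * of_int (denom (?u i)) = of_int (numer (?u i))"
      using numer_div_denom[of "?u i"] denom_pos[of "?u i"] by (simp add: eq_divide_eq)
    ultimately have "of_int (obj x j p i * numer (?u i) * ?R i) =
        of_int (obj x j p i) * (?u i * of_int (denom (?u i))) * of_int (?R i)"
      "of_int (node_den x j p) * (of_int (obj x j p i) * ?u i) =
        (of_int (?R i) * of_int (denom (?u i))) * (of_int (obj x j p i) * ?u i)"
      by (simp_all only: of_int_mult)
    then show ?thesis by (simp only: mult_ac)
  qed
  have "rat_of_int (\<Sum>i<?m. obj x j p i * numer (?u i) * ?R i) =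
      of_int (node_den x j p) * (\<Sum>i<?m. of_int (obj x j p i) * ?u i)"
    unfolding of_int_sum sum_distrib_left by (rule sum.cong[OF refl], rule summand) simp
  also have "\<dots> = of_int (node_den x j p * ?val z)"
    unfolding val_u by simp
  finally have "(\<Sum>i<?m. obj x j p i * numer (?u i) * ?R i) = node_den x j p * ?val z"
    by (simp only: of_int_eq_iff)
  then have num: "node_num x j p = node_den x j p * (?val z + big x * (\<Sum>i<j. int (p i)))"
    unfolding node_num_def by (simp add: distrib_left)
  let ?f = "\<lambda>z. linear_cost ?m (coef x) z + big x * (\<Sum>i<j. of_bool (z i \<noteq> p i))"
  have "node_value ?m (coef x) (points x) j p = ?f z"
    unfolding node_value_def big_def[symmetric]
  proof (rule Min_eqI)
    show "finite (?f ` points x)" using finite_points by simp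
    show "?f z \<in> ?f ` points x" using z by blast
    fix v assume "v \<in> ?f ` points x"
    then obtain w where w: "w \<in> points x" "v = ?f w" by blast
    have "(of_int (?val z) :: real) \<le> of_int (?val w)"
      unfolding dot_int[symmetric] by (rule min[OF in_Q[OF w(1)]])
    then have "?val z \<le> ?val w" by (simp only: of_int_le_iff)
    then show "?f z \<le> v" using sum_obj[OF j p z] sum_obj[OF j p w(1)] w(2) by simp
  qed
  then show ?thesis using num sum_obj[OF j p z] by simp
qed

lemma ptime_big:
  assumes r: "reads_input D N e r"
  shows "ptime D N e (\<lambda>y. Atom (abs_sum (cols (r y)) (coef (r y))))" "ptime D N e (\<lambda>y. Atom (big (r y)))"
proof -
  note r1 = reads_input_step[OF r, of "\<lambda>y. cols (r y)"]
  let ?D = "steps D (\<lambda>y. cols (r y))"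
  note c = ptime_coef[OF r1 ptime_snd]
  have "ptime ?D (\<lambda>y. N (fst y)) (step_env e)
      (\<lambda>y. if coef (r (fst y)) (snd y) < 0 then Atom (0 - coef (r (fst y)) (snd y)) else Atom (coef (r (fst y)) (snd y)))"
    by (rule ptime_if[OF ptime_less[OF c ptime_const] ptime_subdomain[OF ptime_diff[OF ptime_const c]] ptime_subdomain[OF c]]) auto
  then have "ptime ?D (\<lambda>y. N (fst y)) (step_env e) (\<lambda>y. Atom \<bar>coef (r (fst y)) (snd y)\<bar>)"
    by (rule ptime_cong) auto
  from ptime_sum[OF ptime_cols[OF r] _ this]
  show 1: "ptime D N e (\<lambda>y. Atom (abs_sum (cols (r y)) (coef (r y))))"
    unfolding abs_sum_def using reads_input_bounds[OF r] by blast
  show "ptime D N e (\<lambda>y. Atom (big (r y)))"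
    unfolding big_def by (intro ptime_add ptime_mult ptime_const 1)
qed

lemma ptime_node:
  assumes r: "reads_input D N e r" and Q: "\<And>y. y \<in> D \<Longrightarrow> Q (idx (r y)) \<noteq> {}"
    and j: "ptime D N e (\<lambda>y. Atom (int (j y)))" "\<And>y. y \<in> D \<Longrightarrow> j y \<le> cols (r y)"
    and p: "ptime D N e (\<lambda>y. enc_vec enc_nat (cols (r y)) (p y))"
  shows "ptime D N e (\<lambda>y. Cell (Atom (node_num (r y) (j y) (p y))) (Atom (node_den (r y) (j y) (p y))))"
proof -
  note bounds = reads_input_bounds[OF r]
  let ?D1 = "steps D (\<lambda>y. cols (r y))" and ?N1 = "\<lambda>y. N (fst y)" and ?e1 = "step_env e"
  note r1 = reads_input_step[OF r, of "\<lambda>y. cols (r y)"]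
  have obj: "ptime ?D1 ?N1 ?e1 (\<lambda>y. Atom (obj (r (fst y)) (j (fst y)) (p (fst y)) (snd y)))"
  proof -
    note c = ptime_coef[OF r1 ptime_snd]
    have pi: "ptime ?D1 ?N1 ?e1 (\<lambda>y. Atom (int (p (fst y) (snd y))))"
    proof -
      have "ptime ?D1 ?N1 ?e1 (\<lambda>y. enc_nat (p (fst y) (snd y)))"
        by (rule ptime_vec_nth[OF ptime_step[OF p] ptime_snd]) (use bounds(3) in auto)
      then show ?thesis by (simp add: enc_nat_def)
    qed
    have less: "ptime ?D1 ?N1 ?e1 (\<lambda>y. Atom (of_bool (snd y < j (fst y))))"
      using ptime_less[OF ptime_snd ptime_step[OF j(1)]] by simp
    have "ptime ?D1 ?N1 ?e1 (\<lambda>y. if snd y < j (fst y)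
        then Atom (coef (r (fst y)) (snd y) + big (r (fst y)) * (1 - 2 * int (p (fst y) (snd y))))
        else Atom (coef (r (fst y)) (snd y)))"
      by (rule ptime_if[OF less], rule_tac [!] ptime_subdomain[of ?D1],
          intro ptime_add ptime_mult ptime_diff ptime_const c pi ptime_big(2)[OF r1]) (use c in auto)
    then show ?thesis by (rule ptime_cong) (simp add: obj_def)
  qed
  have entry: "ptime ?D1 ?N1 ?e1 (\<lambda>y. enc_rat (objective (r (fst y)) (j (fst y)) (p (fst y)) (snd y)))"
    by (rule ptime_cong[OF ptime_Cell[OF obj ptime_const[of _ _ _ 1]]]) (simp add: objective_def enc_rat_of_int)
  have "ptime D N e (\<lambda>y. enc_vec enc_rat (cols (r y)) (objective (r y) (j y) (p y)))"
    by (rule ptime_vec[OF ptime_cols[OF r]]) (use bounds(3) in blast, rule entry)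
  from ptime_Cell[OF ptime_code[OF r] ptime_Cell[OF this ptime_const[of _ _ _ 0]]]
  have "ptime D N e (\<lambda>y. answer (idx (r y), objective (r y) (j y) (p y)))"
    by (intro ptime_subst[OF ptime_answer, of _ _ _ "\<lambda>y. (idx (r y), objective (r y) (j y) (p y))"])
      (use bounds(3) objective_vecs in auto)
  then have "ptime D N e (\<lambda>y. Cell (Atom 1) (enc_vec enc_rat (cols (r y)) (node_min (r y) (j y) (p y))))"
    by (rule ptime_cong) (simp add: answer_nonempty Q objective_vecs node_min_def)
  note u = ptime_right[OF this]
  note u1 = ptime_step[OF u, of "\<lambda>y. cols (r y)"]
  have ui: "ptime ?D1 ?N1 ?e1 (\<lambda>y. enc_rat (node_min (r (fst y)) (j (fst y)) (p (fst y)) (snd y)))"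
    by (rule ptime_vec_nth[OF u1 ptime_snd]) (use bounds(3) in auto)
  have den: "ptime D N e (\<lambda>y. Atom (node_den (r y) (j y) (p y)))"
    unfolding node_den_def by (rule ptime_prod[OF ptime_cols[OF r] bounds(3) ptime_denom[OF ui]])
  let ?D2 = "steps ?D1 (\<lambda>y. cols (r (fst y)))" and ?N2 = "\<lambda>y. N (fst (fst y))" and ?e2 = "step_env ?e1"
  have "ptime ?D2 ?N2 ?e2 (\<lambda>y. enc_rat (node_min (r (fst (fst y))) (j (fst (fst y))) (p (fst (fst y))) (snd y)))"
    by (rule ptime_vec_nth[OF ptime_step[OF u1] ptime_snd]) (use bounds(3) in auto)
  note d2 = ptime_denom[OF this]
  have eq: "ptime ?D2 ?N2 ?e2 (\<lambda>y. Atom (of_bool (snd y = snd (fst y))))"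
  proof -
    have "ptime ?D2 ?N2 ?e2 (\<lambda>y. Atom (of_bool (int (snd y) = int (snd (fst y)))))"
      by (rule ptime_eq[OF ptime_snd ptime_step[OF ptime_snd]])
    then show ?thesis by simp
  qed
  have "ptime ?D2 ?N2 ?e2 (\<lambda>y. if snd y = snd (fst y) then Atom 1
      else Atom (denom (node_min (r (fst (fst y))) (j (fst (fst y))) (p (fst (fst y))) (snd y))))"
    by (rule ptime_if[OF eq ptime_const ptime_subdomain[OF d2]]) blast
  then have "ptime ?D2 ?N2 ?e2 (\<lambda>y. Atom (if snd y = snd (fst y) then 1
      else denom (node_min (r (fst (fst y))) (j (fst (fst y))) (p (fst (fst y))) (snd y))))"
    by (rule ptime_cong) simp
  from ptime_prod[OF ptime_cols[OF r1] _ this]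
  have R: "ptime ?D1 ?N1 ?e1 (\<lambda>y. Atom (\<Prod>i'<cols (r (fst y)). if i' = snd y then 1
      else denom (node_min (r (fst y)) (j (fst y)) (p (fst y)) i')))"
    using bounds(3) by simp
  note num = ptime_sum[OF ptime_cols[OF r] bounds(3) ptime_mult[OF ptime_mult[OF obj ptime_numer[OF ui]] R]]
  have "ptime (steps D j) ?N1 ?e1 (\<lambda>y. Atom (int (p (fst y) (snd y))))"
  proof -
    have "ptime (steps D j) ?N1 ?e1 (\<lambda>y. enc_nat (p (fst y) (snd y)))"
      by (rule ptime_vec_nth[OF ptime_step[OF p] ptime_snd]) (use bounds(3) j(2) in force)+
    then show ?thesis by (simp add: enc_nat_def)
  qed
  from ptime_sum[OF j(1) _ this]
  have "ptime D N e (\<lambda>y. Atom (\<Sum>i<j y. int (p y i)))"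
    using bounds(3) j(2) by (meson order_trans)
  then have "ptime D N e (\<lambda>y. Atom (node_num (r y) (j y) (p y)))"
    unfolding node_num_def by (intro ptime_add[OF num] ptime_mult[OF den] ptime_mult[OF ptime_big(2)[OF r]])
  then show ?thesis using den by (rule ptime_Cell)
qed


definition enc_nodes :: "'d input \<Rightarrow> (nat \<Rightarrow> nat) list \<Rightarrow> val"
  where "enc_nodes x T = Cell (Atom (int (length T))) (enc_list (map (enc_vec enc_nat (cols x)) T))"

lemma ptime_nodes_nth:
  assumes r: "reads_input D N e r" and T: "ptime D N e (\<lambda>y. enc_nodes (r y) (T y))"
    and i: "ptime D N e (\<lambda>y. Atom (int (i y)))" "\<And>y. y \<in> D \<Longrightarrow> i y < length (T y)"
      "\<And>y. y \<in> D \<Longrightarrow> length (T y) \<le> k_of (r y)"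
  shows "ptime D N e (\<lambda>y. enc_vec enc_nat (cols (r y)) (T y ! i y))"
proof -
  have "i y \<le> N y" if "y \<in> D" for y
    using i(2,3)[OF that] reads_input_bounds(6)[OF r that] by linarith
  then have "ptime D N e (\<lambda>y. map (enc_vec enc_nat (cols (r y))) (T y) ! i y)"
    by (intro ptime_nth[OF ptime_right[OF T[unfolded enc_nodes_def]] i(1)]) (use i(2) in simp_all)
  then show ?thesis by (rule ptime_cong) (simp add: i(2))
qed

lemma ptime_children_nth:
  assumes r: "reads_input D N e r" and T: "ptime D N e (\<lambda>y. enc_nodes (r y) (T y))"
    and i: "ptime D N e (\<lambda>y. Atom (int (i y)))" "\<And>y. y \<in> D \<Longrightarrow> i y < length (children (j y) (T y))"
      "\<And>y. y \<in> D \<Longrightarrow> length (T y) \<le> k_of (r y)"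
    and j: "ptime D N e (\<lambda>y. Atom (int (j y)))"
  shows "ptime D N e (\<lambda>y. enc_vec enc_nat (cols (r y)) (children (j y) (T y) ! i y))"
proof -
  let ?L = "\<lambda>y. length (T y)"
  let ?new = "\<lambda>y. (T y ! (i y - ?L y))(j y := 1)"
  let ?D = "{y \<in> D. \<not> i y < ?L y}"
  note L = ptime_left[OF T[unfolded enc_nodes_def]]
  have c: "ptime D N e (\<lambda>y. Atom (of_bool (i y < ?L y)))"
    using ptime_less[OF i(1) L] by simp
  have r': "reads_input ?D N e r" by (rule reads_input_subdomain[OF r]) blast
  have old: "ptime {y \<in> D. i y < ?L y} N e (\<lambda>y. enc_vec enc_nat (cols (r y)) (T y ! i y))"
    by (rule ptime_nodes_nth[OF reads_input_subdomain[OF r] ptime_subdomain[OF T] ptime_subdomain[OF i(1)]])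
      (use i(3) in auto)
  have new_less: "i y - ?L y < ?L y" if "y \<in> ?D" for y
    using i(2)[of y] that by (auto simp: children_def)
  have "ptime ?D N e (\<lambda>y. Atom (int (i y) - int (?L y)))"
    by (rule ptime_subdomain[OF ptime_diff[OF i(1) L]]) blast
  then have "ptime ?D N e (\<lambda>y. Atom (int (i y - ?L y)))"
    by (rule ptime_cong) auto
  then have parent: "ptime ?D N e (\<lambda>y. enc_vec enc_nat (cols (r y)) (T y ! (i y - ?L y)))"
    by (intro ptime_nodes_nth[OF r' ptime_subdomain[OF T]]) (use i(3) new_less in auto)
  let ?D1 = "steps ?D (\<lambda>y. cols (r y))" and ?N1 = "\<lambda>y. N (fst y)" and ?e1 = "step_env e"
  have old_entry: "ptime ?D1 ?N1 ?e1 (\<lambda>y. enc_nat ((T (fst y) ! (i (fst y) - ?L (fst y))) (snd y)))"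
    by (rule ptime_vec_nth[OF ptime_step[OF parent] ptime_snd]) (use reads_input_bounds(3)[OF r] in auto)
  have eq: "ptime ?D1 ?N1 ?e1 (\<lambda>y. Atom (of_bool (snd y = j (fst y))))"
    using ptime_eq[OF ptime_snd ptime_step[OF ptime_subdomain[OF j]], of ?D "\<lambda>y. cols (r y)"] by simp
  have "ptime ?D1 ?N1 ?e1 (\<lambda>y. if snd y = j (fst y) then Atom 1
      else enc_nat ((T (fst y) ! (i (fst y) - ?L (fst y))) (snd y)))"
    by (rule ptime_if[OF eq ptime_const ptime_subdomain[OF old_entry]]) blast
  then have new_entry: "ptime ?D1 ?N1 ?e1 (\<lambda>y. enc_nat (?new (fst y) (snd y)))"
    by (rule ptime_cong) (simp add: enc_nat_def)
  have "ptime ?D N e (\<lambda>y. enc_vec enc_nat (cols (r y)) (?new y))"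
    by (rule ptime_vec[OF ptime_cols[OF r']]) (use reads_input_bounds(3)[OF r] in blast, rule new_entry)
  from ptime_if[OF c old this] show ?thesis
    by (rule ptime_cong) (use new_less in \<open>auto simp: children_def nth_append\<close>)
qed

text \<open>
  The value of each child takes one oracle call. The table of children with their values is the list from
  which \<open>ptime_select_indices\<close> picks the new nodes.
\<close>

lemma ptime_beam_step:
  assumes r: "reads_input D N e r" and Q: "\<And>y. y \<in> D \<Longrightarrow> Q (idx (r y)) \<noteq> {}"
    and T: "ptime D N e (\<lambda>y. enc_nodes (r y) (T y))" "\<And>y. y \<in> D \<Longrightarrow> length (T y) \<le> k_of (r y)"
      "\<And>y p i. y \<in> D \<Longrightarrow> p \<in> set (T y) \<Longrightarrow> p i \<in> {0, 1}"
    and j: "ptime D N e (\<lambda>y. Atom (int (j y)))" "\<And>y. y \<in> D \<Longrightarrow> j y < cols (r y)"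
  shows "ptime D N e (\<lambda>y. enc_nodes (r y) (select (k_of (r y)) (abs_sum (cols (r y)) (coef (r y)))
    (node_value (cols (r y)) (coef (r y)) (points (r y)) (Suc (j y))) (children (j y) (T y))))"
proof -
  let ?C = "\<lambda>y. children (j y) (T y)"
  let ?n = "\<lambda>y. length (?C y)"
  let ?num = "\<lambda>y l. node_num (r y) (Suc (j y)) (?C y ! l)"
  let ?den = "\<lambda>y l. node_den (r y) (Suc (j y)) (?C y ! l)"
  let ?V = "\<lambda>y l. node_value (cols (r y)) (coef (r y)) (points (r y)) (Suc (j y)) (?C y ! l)"
  let ?f = "\<lambda>y l. enc_vec enc_nat (cols (r y)) (?C y ! l)"
  note L = ptime_left[OF T(1)[unfolded enc_nodes_def]]
  have n: "ptime D N e (\<lambda>y. Atom (int (?n y)))"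
    using ptime_add[OF L L] by (simp add: children_def)
  have n_le: "?n y \<le> N y" if "y \<in> D" for y
    using T(2)[OF that] reads_input_bounds(5)[OF r that] by (simp add: children_def)
  let ?D1 = "steps D ?n" and ?N1 = "\<lambda>y. N (fst y)" and ?e1 = "step_env e"
  note r1 = reads_input_step[OF r, of ?n]
  have C: "ptime ?D1 ?N1 ?e1 (\<lambda>y. ?f (fst y) (snd y))"
    by (rule ptime_children_nth[OF r1 ptime_step[OF T(1)] ptime_snd _ _ ptime_step[OF j(1)]]) (use T(2) in auto)
  have "ptime ?D1 ?N1 ?e1 (\<lambda>y. Atom (int (Suc (j (fst y)))))"
    using ptime_add[OF ptime_const[of _ _ _ 1] ptime_step[OF j(1)]] by simp
  then have "ptime ?D1 ?N1 ?e1 (\<lambda>y. Cell (Atom (?num (fst y) (snd y))) (Atom (?den (fst y) (snd y))))"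
    by (intro ptime_node[OF r1 _ _ _ C]) (use Q j(2) in \<open>auto simp: Suc_le_eq\<close>)
  note entries = ptime_tabulate[OF n n_le ptime_Cell[OF C this]]
  have V: "?num y l = ?den y l * ?V y l" if y: "y \<in> D" and l: "l < ?n y" for y l
  proof (rule node_num_eq[OF Q[OF y]])
    show "Suc (j y) \<le> cols (r y)" using j(2)[OF y] by simp
    have "q i \<in> {0, 1}" if q: "q \<in> set (?C y)" for q i
    proof -
      obtain p where "p \<in> set (T y)" "q = p \<or> q = p(j y := 1)"
        using q unfolding children_def by auto
      then show ?thesis using T(3)[OF y, of p i] by (auto split: if_splits)
    qed
    then show "\<forall>i<Suc (j y). (?C y ! l) i \<in> {0, 1}" using nth_mem[OF l] by blast
  qed
  have "ptime D N e (\<lambda>y. Cell (Atom (int (length (select (k_of (r y)) (abs_sum (cols (r y)) (coef (r y)))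
      (node_value (cols (r y)) (coef (r y)) (points (r y)) (Suc (j y))) (?C y)))))
    (enc_list (map (enc_vec enc_nat (cols (r y))) (select (k_of (r y)) (abs_sum (cols (r y)) (coef (r y)))
      (node_value (cols (r y)) (coef (r y)) (points (r y)) (Suc (j y))) (?C y)))))"
    by (rule ptime_cong[OF ptime_select_indices[OF n n_le entries V node_den_pos ptime_big(1)[OF r] ptime_k[OF r]]])
      (simp_all add: select_def comp_def)
  then show ?thesis unfolding enc_nodes_def .
qed

definition nodes :: "'d input \<Rightarrow> nat \<Rightarrow> (nat \<Rightarrow> nat) list"
  where "nodes x j = beam (cols x) (coef x) (points x) (k_of x) j"

lemma nodes_Suc: "nodes x (Suc j) = select (k_of x) (abs_sum (cols x) (coef x))
    (node_value (cols x) (coef x) (points x) (Suc j)) (children j (nodes x j))"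
  by (simp add: nodes_def)

lemma nodes_length_binary:
  assumes "Q (idx x) \<noteq> {}" "k_of x \<ge> 1" "j \<le> cols x"
  shows "length (nodes x j) \<le> k_of x" and "p \<in> set (nodes x j) \<Longrightarrow> p i \<in> {0, 1}"
proof -
  note inv = beam_invariant[of "points x" "cols x" "k_of x" j "coef x",
      OF finite_points points_nonempty[OF assms(1)] points_binary assms(2,3), folded nodes_def]
  show "length (nodes x j) \<le> k_of x" by (rule inv[THEN conjunct2, THEN conjunct1])
  show "p i \<in> {0, 1}" if "p \<in> set (nodes x j)" for p i
  proof -
    have p: "(\<forall>i\<ge>j. p i = 0) \<and> extensions (points x) j p \<noteq> {}"
      using inv[THEN conjunct2, THEN conjunct2, THEN conjunct1] that by blast
    show ?thesis
    proof (cases "i < j")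
      case True
      obtain z where "z \<in> points x" "\<forall>i<j. z i = p i" using p unfolding extensions_def by blast
      then show ?thesis using points_binary True assms(3) by (metis order_less_le_trans)
    qed (use p in simp)
  qed
qed

lemma val_size_enc_list_le:
  assumes "\<And>v. v \<in> set vs \<Longrightarrow> val_size v \<le> b"
  shows "val_size (enc_list vs) \<le> 1 + length vs * (1 + b)"
  using assms
proof (induction vs)
  case (Cons v vs)
  have "val_size v \<le> b" "val_size (enc_list vs) \<le> 1 + length vs * (1 + b)"
    using Cons by auto
  then show ?case by simp
qed (simp add: floorlog_0)

text \<open>
  The states of the outer loop stay small because there are at most \<open>k\<close> nodes and
  all their entries are 0 or 1.
\<close>

lemma val_size_enc_nodes:
  assumes "length T \<le> k" "\<And>p i. p \<in> set T \<Longrightarrow> p i \<in> {0, 1}"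
  shows "val_size (enc_nodes x T) \<le> 3 + k + k * (2 + 3 * cols x)"
proof -
  have "val_size (enc_vec enc_nat (cols x) p) \<le> 1 + cols x * (1 + 2)" if "p \<in> set T" for p
  proof -
    have entry: "val_size (enc_nat (p i)) \<le> 2" for i
      using assms(2)[OF that, of i] by (auto simp: enc_nat_def floorlog_0 floorlog_1)
    show ?thesis
      using val_size_enc_list_le[of "map (\<lambda>i. enc_nat (p i)) [0..<cols x]" 2] entry by (auto simp: enc_vec_def)
  qed
  then have "val_size (enc_list (map (enc_vec enc_nat (cols x)) T)) \<le>
      1 + length (map (enc_vec enc_nat (cols x)) T) * (1 + (1 + cols x * (1 + 2)))"
    by (intro val_size_enc_list_le) auto
  also have "\<dots> \<le> 1 + k * (2 + 3 * cols x)"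
    using assms(1) by (intro add_left_mono mult_le_mono) auto
  finally show ?thesis
    using val_size_Atom_nat[of "length T"] assms(1) unfolding enc_nodes_def val_size.simps(2) by linarith
qed

lemma ptime_nodes:
  assumes r: "reads_input D N e r" and Q: "\<And>y. y \<in> D \<Longrightarrow> Q (idx (r y)) \<noteq> {}"
  shows "ptime D N e (\<lambda>y. enc_nodes (r y) (nodes (r y) (cols (r y))))"
proof (rule ptime_loop[where S = "\<lambda>y j. enc_nodes (r y) (nodes (r y) j)", OF ptime_cols[OF r]])
  note bounds = reads_input_bounds[OF r]
  show "cols (r y) \<le> N y" if "y \<in> D" for y by (rule bounds(3)[OF that])
  have "ptime D N e (\<lambda>y. enc_vec enc_nat (cols (r y)) (\<lambda>_. 0))"
    by (rule ptime_vec[OF ptime_cols[OF r] bounds(3)]) (simp_all add: enc_nat_def ptime_const)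
  then have "ptime D N e (\<lambda>y. Cell (Atom 1) (Cell (enc_vec enc_nat (cols (r y)) (\<lambda>_. 0)) (Atom 0)))"
    by (intro ptime_Cell ptime_const)
  then show "ptime D N e (\<lambda>y. enc_nodes (r y) (nodes (r y) 0))"
    by (simp add: nodes_def enc_nodes_def)
  let ?D = "steps D (\<lambda>y. cols (r y))" and ?N = "\<lambda>y. N (fst y)"
  let ?e = "\<lambda>y. Cell (step_env e y) (enc_nodes (r (fst y)) (nodes (r (fst y)) (snd y)))"
  have r': "reads_input ?D ?N ?e (\<lambda>y. r (fst y))"
    by (rule reads_input_Cell[OF reads_input_step[OF r]])
  have j: "ptime ?D ?N ?e (\<lambda>y. Atom (int (snd y)))"
    by (rule ptime_trans[OF ptime_fst ptime_snd])
  show "ptime ?D ?N ?e (\<lambda>y. enc_nodes (r (fst y)) (nodes (r (fst y)) (Suc (snd y))))"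
    unfolding nodes_Suc
  proof (rule ptime_beam_step[OF r' _ ptime_snd _ _ j])
    fix y assume y: "y \<in> ?D"
    then show "Q (idx (r (fst y))) \<noteq> {}" "snd y < cols (r (fst y))" using Q by auto
    have "Q (idx (r (fst y))) \<noteq> {}" "k_of (r (fst y)) \<ge> 1" "snd y \<le> cols (r (fst y))"
      using Q bounds(1) y by auto
    note * = nodes_length_binary[OF this]
    show "length (nodes (r (fst y)) (snd y)) \<le> k_of (r (fst y))" by (rule *(1))
    show "p i \<in> {0, 1}" if "p \<in> set (nodes (r (fst y)) (snd y))" for p i by (rule *(2)[OF that])
  qed
  let ?B = "\<lambda>y. 3 + (N y + val_size (e y)) + (N y + val_size (e y)) * (2 + 3 * (N y + val_size (e y)))"
  show "poly_bounded D (\<lambda>y. N y + val_size (e y)) ?B"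
    by (intro poly_bounded_intros)
  show "val_size (enc_nodes (r y) (nodes (r y) j)) \<le> ?B y" if y: "y \<in> D" and j: "j \<le> cols (r y)" for y j
  proof -
    have "val_size (enc_nodes (r y) (nodes (r y) j)) \<le> 3 + k_of (r y) + k_of (r y) * (2 + 3 * cols (r y))"
      using nodes_length_binary[OF Q[OF y] bounds(1)[OF y] j] by (intro val_size_enc_nodes)
    also have "\<dots> \<le> ?B y"
      using bounds(3,6)[OF y] by (intro add_mono mult_le_mono) auto
    finally show ?thesis .
  qed
qed


section \<open>The separation procedure\<close>

definition leaves :: "'d input \<Rightarrow> (nat \<Rightarrow> nat) list"
  where "leaves x = nodes x (cols x)"

definition cheapest :: "'d input \<Rightarrow> nat \<Rightarrow> nat"
  where "cheapest x = (\<lambda>i. \<Sum>l<k_of x. (leaves x ! l) i)"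

text \<open>
  Left-hand side minus right-hand side of the inequality for \<open>y\<close>, multiplied by the
  positive integer \<open>scale x * denom (b_of x)\<close>.
\<close>

definition excess :: "'d input \<Rightarrow> (nat \<Rightarrow> nat) \<Rightarrow> int"
  where "excess x y = (linear_cost (cols x) (coef x) y + int (k_of x) * coef x (cols x)) * denom (b_of x) -
    int (k_of x) * numer (b_of x) * scale x"

definition separate :: "'d input \<Rightarrow> val"
  where "separate x =
    (if Q (idx x) \<noteq> {} \<and> length (leaves x) = k_of x \<and> excess x (cheapest x) < 0
     then Cell (Atom 1) (enc_vec enc_nat (cols x) (cheapest x)) else Atom 0)"

lemma satisfies_ineq_iff_excess:
  "satisfies_ineq (n_of x) (cols x) (k_of x) (A_of x) (a_of x) (b_of x) (x_of x) y \<longleftrightarrow> 0 \<le> excess x y"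
proof -
  let ?W = "linear_cost (cols x) (coef x) y + int (k_of x) * coef x (cols x)"
  let ?lhs = "dot (n_of x) (x_of x) (mat_vec (cols x) (A_of x) (\<lambda>j. of_nat (y j))) +
    of_nat (k_of x) * dot (n_of x) (a_of x) (x_of x)"
  have "of_int (linear_cost (cols x) (coef x) y) =
      (\<Sum>j<cols x. of_int (scale x) * (\<Sum>i<n_of x. x_of x i * A_of x i j) * of_nat (y j))"
    unfolding linear_cost_def of_int_sum by (rule sum.cong) (simp_all add: coef_eq col_def)
  also have "\<dots> = of_int (scale x) * (\<Sum>j<cols x. \<Sum>i<n_of x. x_of x i * A_of x i j * of_nat (y j))"
    by (simp add: sum_distrib_left sum_distrib_right mult.assoc)
  also have "(\<Sum>j<cols x. \<Sum>i<n_of x. x_of x i * A_of x i j * of_nat (y j)) =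
      dot (n_of x) (x_of x) (mat_vec (cols x) (A_of x) (\<lambda>j. of_nat (y j)))"
    unfolding dot_def mat_vec_def by (subst sum.swap) (simp add: sum_distrib_left mult.assoc)
  finally have lin: "of_int (linear_cost (cols x) (coef x) y) = of_int (scale x) *
      dot (n_of x) (x_of x) (mat_vec (cols x) (A_of x) (\<lambda>j. of_nat (y j)))" .
  have "of_int (coef x (cols x)) = of_int (scale x) * dot (n_of x) (a_of x) (x_of x)"
    unfolding dot_def by (simp add: coef_eq col_def mult.commute)
  then have W: "of_int ?W = of_int (scale x) * ?lhs"
    using lin by (simp add: algebra_simps)
  have "of_int (excess x y) = of_int (scale x * denom (b_of x)) * (?lhs - of_nat (k_of x) * b_of x)"
  proof -
    have "of_int (numer (b_of x)) = b_of x * of_int (denom (b_of x))"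
      using numer_div_denom[of "b_of x"] denom_pos[of "b_of x"] by (simp add: eq_divide_eq)
    moreover have "rat_of_int (excess x y) = of_int ?W * of_int (denom (b_of x)) -
        of_nat (k_of x) * of_int (numer (b_of x)) * of_int (scale x)"
      unfolding excess_def by simp
    ultimately have "of_int (excess x y) = of_int (scale x) * ?lhs * of_int (denom (b_of x)) -
        of_nat (k_of x) * (b_of x * of_int (denom (b_of x))) * of_int (scale x)"
      by (simp only: W)
    then show ?thesis by (simp only: of_int_mult right_diff_distrib mult_ac)
  qed
  moreover have "(0 :: rat) < of_int (scale x * denom (b_of x))"
    using scale_pos denom_pos by simp
  ultimately have "0 \<le> (of_int (excess x y) :: rat) \<longleftrightarrow> 0 \<le> ?lhs - of_nat (k_of x) * b_of x"
    by (simp only: zero_le_mult_iff) auto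
  then show ?thesis unfolding satisfies_ineq_def by simp
qed

lemma ptime_excess_cheapest:
  assumes r: "reads_input D N e r" and len: "\<And>y. y \<in> D \<Longrightarrow> length (leaves (r y)) = k_of (r y)"
    and Q: "\<And>y. y \<in> D \<Longrightarrow> Q (idx (r y)) \<noteq> {}"
  shows "ptime D N e (\<lambda>y. enc_vec enc_nat (cols (r y)) (cheapest (r y)))"
    and "ptime D N e (\<lambda>y. Atom (excess (r y) (cheapest (r y))))"
proof -
  note bounds = reads_input_bounds[OF r]
  let ?D1 = "steps D (\<lambda>y. cols (r y))" and ?N1 = "\<lambda>y. N (fst y)" and ?e1 = "step_env e"
  let ?D2 = "steps ?D1 (\<lambda>y. k_of (r (fst y)))" and ?N2 = "\<lambda>y. N (fst (fst y))" and ?e2 = "step_env ?e1"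
  note r1 = reads_input_step[OF r, of "\<lambda>y. cols (r y)"]
  note r2 = reads_input_step[OF r1, of "\<lambda>y. k_of (r (fst y))"]
  have T: "ptime ?D2 ?N2 ?e2 (\<lambda>y. enc_nodes (r (fst (fst y))) (leaves (r (fst (fst y)))))"
    unfolding leaves_def by (rule ptime_nodes[OF r2]) (use Q in auto)
  have "ptime ?D2 ?N2 ?e2 (\<lambda>y. enc_vec enc_nat (cols (r (fst (fst y)))) (leaves (r (fst (fst y))) ! snd y))"
    by (rule ptime_nodes_nth[OF r2 T ptime_snd]) (use len in auto)
  from ptime_vec_nth[OF this ptime_step[OF ptime_snd]]
  have "ptime ?D2 ?N2 ?e2 (\<lambda>y. enc_nat ((leaves (r (fst (fst y))) ! snd y) (snd (fst y))))"
    using bounds(3) by simp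
  then have "ptime ?D2 ?N2 ?e2 (\<lambda>y. Atom (int ((leaves (r (fst (fst y))) ! snd y) (snd (fst y)))))"
    by (simp add: enc_nat_def)
  from ptime_sum[OF ptime_k[OF r1] _ this]
  have "ptime ?D1 ?N1 ?e1 (\<lambda>y. Atom (\<Sum>l<k_of (r (fst y)). int ((leaves (r (fst y)) ! l) (snd y))))"
    using bounds(6) by simp
  then have entry: "ptime ?D1 ?N1 ?e1 (\<lambda>y. Atom (int (cheapest (r (fst y)) (snd y))))"
    by (simp add: cheapest_def)
  show "ptime D N e (\<lambda>y. enc_vec enc_nat (cols (r y)) (cheapest (r y)))"
    by (rule ptime_vec[OF ptime_cols[OF r]]) (use bounds(3) in blast, use entry in \<open>simp add: enc_nat_def\<close>)
  have "ptime D N e (\<lambda>y. Atom (linear_cost (cols (r y)) (coef (r y)) (cheapest (r y))))"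
    unfolding linear_cost_def
    by (rule ptime_sum[OF ptime_cols[OF r] bounds(3) ptime_mult[OF ptime_coef[OF r1 ptime_snd] entry]])
  then show "ptime D N e (\<lambda>y. Atom (excess (r y) (cheapest (r y))))"
    unfolding excess_def
    by (intro ptime_diff ptime_mult ptime_add ptime_k[OF r] ptime_coef[OF r ptime_cols[OF r]]
        ptime_denom[OF ptime_b[OF r]] ptime_numer[OF ptime_b[OF r]] ptime_scale[OF r])
qed

lemma ptime_Q_nonempty:
  assumes r: "reads_input D N e r"
  shows "ptime D N e (\<lambda>y. Atom (of_bool (Q (idx (r y)) \<noteq> {})))"
proof -
  have "ptime D N e (\<lambda>y. enc_vec enc_rat (cols (r y)) (\<lambda>_. 0))"
    by (rule ptime_vec[OF ptime_cols[OF r] reads_input_bounds(3)[OF r]])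
      (use enc_rat_of_int[of 0] in \<open>simp_all add: ptime_Cell ptime_const\<close>)
  from ptime_Cell[OF ptime_code[OF r] ptime_Cell[OF this ptime_const[of _ _ _ 0]]]
  have "ptime D N e (\<lambda>y. answer (idx (r y), \<lambda>_. 0))"
    by (intro ptime_subst[OF ptime_answer, of _ _ _ "\<lambda>y. (idx (r y), \<lambda>_. 0)"])
      (use reads_input_bounds(3)[OF r] in \<open>auto simp: vecs_def\<close>)
  \<comment> \<open>The zero objective suffices: the oracle answers with an atom exactly for an empty polytope.\<close>
  from ptime_is_cell[OF this] show ?thesis
  proof (rule ptime_cong)
    fix y
    have "(\<lambda>_. 0) \<in> vecs (cols (r y))" unfolding vecs_def by simp
    then show "Atom (of_bool (\<exists>u v. answer (idx (r y), \<lambda>_. 0) = Cell u v)) = Atom (of_bool (Q (idx (r y)) \<noteq> {}))"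
      using answer_empty[of "\<lambda>_. 0" "idx (r y)"] answer_nonempty[of "\<lambda>_. 0" "idx (r y)"]
      by (cases "Q (idx (r y)) = {}") auto
  qed
qed

lemma ptime_separate:
  assumes r: "reads_input D N e r"
  shows "ptime D N e (\<lambda>y. separate (r y))"
proof -
  let ?D1 = "{y \<in> D. Q (idx (r y)) \<noteq> {}}"
  let ?D2 = "{y \<in> ?D1. length (leaves (r y)) = k_of (r y)}"
  have r1: "reads_input ?D1 N e r" and r2: "reads_input ?D2 N e r"
    by (rule reads_input_subdomain[OF r]; blast)+
  have "ptime ?D1 N e (\<lambda>y. enc_nodes (r y) (leaves (r y)))"
    unfolding leaves_def by (rule ptime_nodes[OF r1]) auto
  from ptime_eq[OF ptime_left[OF this[unfolded enc_nodes_def]] ptime_k[OF r1]]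
  have len: "ptime ?D1 N e (\<lambda>y. Atom (of_bool (length (leaves (r y)) = k_of (r y))))"
    by simp
  have cheap: "ptime ?D2 N e (\<lambda>y. enc_vec enc_nat (cols (r y)) (cheapest (r y)))"
    and excess: "ptime ?D2 N e (\<lambda>y. Atom (excess (r y) (cheapest (r y))))"
    by (rule ptime_excess_cheapest[OF r2]; simp)+
  note inner = ptime_if[OF ptime_less[OF excess ptime_const]
      ptime_subdomain[OF ptime_Cell[OF ptime_const[of _ _ _ 1] cheap]] ptime_const[of _ _ _ 0]]
  have "ptime D N e (\<lambda>y. if Q (idx (r y)) \<noteq> {} then
      if length (leaves (r y)) = k_of (r y) then
        if excess (r y) (cheapest (r y)) < 0 then Cell (Atom 1) (enc_vec enc_nat (cols (r y)) (cheapest (r y)))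
        else Atom 0
      else Atom 0 else Atom 0)"
    by (rule ptime_if[OF ptime_Q_nonempty[OF r] ptime_if[OF len inner ptime_const] ptime_const]) blast
  then show ?thesis by (rule ptime_cong) (simp add: separate_def)
qed

lemma Y_Q_points:
  "y \<in> Y_Q (k_of x) (cols x) (Q (idx x)) \<longleftrightarrow> (\<exists>T \<subseteq> points x. card T = k_of x \<and> y = (\<lambda>j. \<Sum>z\<in>T. z j))"
  unfolding points_def by (rule Y_Q_iff)

text \<open>
  The sum \<open>cheapest x\<close> of the \<open>k\<close> cheapest binary points minimizes the
  excess over all of \<open>Y_Q\<close>, so some inequality is violated exactly when this one
  is. If fewer than \<open>k\<close> nodes remain, then \<open>Y_Q\<close> is empty.
\<close>

lemma separate_correct:
  assumes k: "k_of x \<ge> 1"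
  defines "sat \<equiv> satisfies_ineq (n_of x) (cols x) (k_of x) (A_of x) (a_of x) (b_of x) (x_of x)"
  shows "if \<forall>y \<in> Y_Q (k_of x) (cols x) (Q (idx x)). sat y then separate x = enc_option None
    else \<exists>y \<in> Y_Q (k_of x) (cols x) (Q (idx x)).
      separate x = enc_option (Some (enc_vec enc_nat (cols x) y)) \<and> \<not> sat y"
proof -
  have sat: "sat y \<longleftrightarrow> 0 \<le> excess x y" for y
    unfolding sat_def by (rule satisfies_ineq_iff_excess)
  note Y = Y_Q_points[of _ x]
  let ?cost = "linear_cost (cols x) (coef x)"
  have cost_sum: "?cost (\<lambda>j. \<Sum>z\<in>T. z j) = sum ?cost T" for T
  proof -
    have "?cost (\<lambda>j. \<Sum>z\<in>T. z j) = (\<Sum>j<cols x. \<Sum>z\<in>T. coef x j * int (z j))"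
      unfolding linear_cost_def by (rule sum.cong) (simp_all add: sum_distrib_left)
    also have "\<dots> = (\<Sum>z\<in>T. \<Sum>j<cols x. coef x j * int (z j))" by (rule sum.swap)
    also have "\<dots> = sum ?cost T" by (rule sum.cong) (simp_all add: linear_cost_def)
    finally show ?thesis .
  qed
  show ?thesis
  proof (cases "Q (idx x) \<noteq> {} \<and> length (leaves x) = k_of x")
    case True
    have nonempty: "Q (idx x) \<noteq> {}" using True by blast
    have len: "length (leaves x) = k_of x" using True by blast
    have best: "set (leaves x) \<subseteq> points x" "distinct (leaves x)"
      "\<And>T. T \<subseteq> points x \<Longrightarrow> card T = k_of x \<Longrightarrow> sum ?cost (set (leaves x)) \<le> sum ?cost T"
      unfolding leaves_def nodes_def
      by (rule beam_best[OF finite_points points_nonempty[OF nonempty] points_binary points_vecs k]; assumption)+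
    have "(\<Sum>z\<in>set (leaves x). z j) = cheapest x j" for j
    proof -
      have "(\<Sum>z\<in>set (leaves x). z j) = sum_list (map (\<lambda>z. z j) (leaves x))"
        using best(2) by (simp add: sum_list_distinct_conv_sum_set)
      then show ?thesis
        by (simp add: cheapest_def sum_list_sum_nth atLeast0LessThan len)
    qed
    then have cheapest: "cheapest x = (\<lambda>j. \<Sum>z\<in>set (leaves x). z j)" by simp
    have in_Y: "cheapest x \<in> Y_Q (k_of x) (cols x) (Q (idx x))"
      unfolding Y cheapest
      by (intro exI[of _ "set (leaves x)"] conjI best(1) refl)
        (use distinct_card[OF best(2)] len in simp)
    have *: "excess x (cheapest x) \<le> excess x y" if y: "y \<in> Y_Q (k_of x) (cols x) (Q (idx x))" for y
    proof -
      obtain T where T: "T \<subseteq> points x" "card T = k_of x" "y = (\<lambda>j. \<Sum>z\<in>T. z j)"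
        using iffD1[OF Y y] by blast
      have "?cost (cheapest x) \<le> ?cost y"
        unfolding cheapest T(3) cost_sum using best(3)[OF T(1,2)] .
      then show ?thesis
        unfolding excess_def using denom_pos[of "b_of x"] by (simp add: mult_right_mono)
    qed
    have all_sat: "(\<forall>y \<in> Y_Q (k_of x) (cols x) (Q (idx x)). sat y) \<longleftrightarrow> 0 \<le> excess x (cheapest x)"
      unfolding sat
    proof (intro iffI ballI)
      fix y assume "0 \<le> excess x (cheapest x)" "y \<in> Y_Q (k_of x) (cols x) (Q (idx x))"
      then show "0 \<le> excess x y" using * order_trans by blast
    qed (use in_Y in blast)
    show ?thesis
    proof (cases "0 \<le> excess x (cheapest x)")
      case nonneg: True
      then show ?thesis using all_sat by (simp add: separate_def)
    next
      case neg: False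
      then have "separate x = enc_option (Some (enc_vec enc_nat (cols x) (cheapest x)))"
        using True by (simp add: separate_def)
      moreover have "\<not> sat (cheapest x)" using neg unfolding sat .
      ultimately show ?thesis using in_Y by auto
    qed
  next
    case False
    have none: "\<not> (\<exists>T \<subseteq> points x. card T = k_of x)"
    proof (cases "Q (idx x) = {}")
      case True
      then have "points x = {}" unfolding points_def binary_points_def by simp
      then show ?thesis using k by auto
    next
      case nonempty: False
      then show ?thesis
      proof -
        have "length (leaves x) \<noteq> k_of x" using False nonempty by simp
        moreover have "length (leaves x) = k_of x" if "T \<subseteq> points x" "card T = k_of x" for T
          unfolding leaves_def nodes_def
          by (rule beam_best(4)[OF finite_points points_nonempty[OF nonempty] points_binary points_vecs k that])
        ultimately show ?thesis by blast
      qed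
    qed
    have "Y_Q (k_of x) (cols x) (Q (idx x)) = {}"
    proof (rule equals0I)
      fix y assume "y \<in> Y_Q (k_of x) (cols x) (Q (idx x))"
      from iffD1[OF Y this] obtain T where "T \<subseteq> points x" "card T = k_of x" by (elim exE conjE)
      then show False using none by blast
    qed
    moreover have "separate x = enc_option None" using False unfolding separate_def by auto
    ultimately show ?thesis by simp
  qed
qed

end

section \<open>From the tractable family to the separation procedure\<close>

text \<open>
  A solution of a search problem yields a function, namely the output of the solving program,
  that is defined on all admissible inputs.
\<close>

lemma poly_time_solvable_ptime:
  assumes "poly_time_solvable P"
    and mem: "\<And>x. x \<in> D \<Longrightarrow> (e x, M x, R x) \<in> P"
    and M: "\<And>x. x \<in> D \<Longrightarrow> M x \<le> N x + val_size (e x)"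
  obtains g where "ptime D N e g" "\<And>x. x \<in> D \<Longrightarrow> g x \<in> R x"
proof -
  obtain p f where pf: "\<forall>(v, n, R) \<in> P. \<exists>t s. exec p (init_store v) t s \<and> t \<le> poly f n \<and> s 0 \<in> R"
    using assms(1) unfolding poly_time_solvable_def by blast
  have *: "\<exists>t s. exec p (init_store (e x)) t s \<and> t \<le> poly f (M x) \<and> s 0 \<in> R x" if "x \<in> D" for x
    using pf mem[OF that] by blast
  define s where "s x = (SOME s. \<exists>t. exec p (init_store (e x)) t s \<and> t \<le> poly f (M x) \<and> s 0 \<in> R x)" for x
  have s: "\<exists>t. exec p (init_store (e x)) t (s x) \<and> t \<le> poly f (M x) \<and> s x 0 \<in> R x" if "x \<in> D" for x
  proof -
    have "\<exists>s. \<exists>t. exec p (init_store (e x)) t s \<and> t \<le> poly f (M x) \<and> s 0 \<in> R x"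
      using *[OF that] by blast
    then show ?thesis unfolding s_def by (rule someI_ex)
  qed
  show ?thesis
  proof (rule that[of "\<lambda>x. s x 0"])
    show "ptime D N e (\<lambda>x. s x 0)"
    proof (rule ptimeI)
      show "poly_bounded D (\<lambda>x. N x + val_size (e x)) (\<lambda>x. poly f (N x + val_size (e x)))"
        by (intro poly_bounded_poly poly_bounded_measure)
      fix x assume x: "x \<in> D"
      obtain t where "exec p (init_store (e x)) t (s x)" "t \<le> poly f (M x)"
        using s[OF x] by blast
      then show "\<exists>t s'. exec p (init_store (e x)) t s' \<and> t \<le> poly f (N x + val_size (e x)) \<and> s' 0 = s x 0"
        using order_trans[OF _ poly_nat_mono[OF M[OF x], of f]] by blast
    qed
  qed (use s in blast)
qed

theorem proposition2:
  fixes Q :: "'d \<Rightarrow> (nat \<Rightarrow> real) set" and m :: "'d \<Rightarrow> nat" and code :: "'d \<Rightarrow> val"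
  assumes "\<And>d. binary_polytope (m d) (Q d)"
    and "tractable Q m code"
  shows "poly_time_solvable (family_separation Q m code)"
proof -
  obtain g where g: "\<And>d. val_size (code d) \<le> poly g (m d)"
    using assms(2) unfolding tractable_def by blast
  have opt: "poly_time_solvable (polytope_optimization Q m code)"
    using assms(2) unfolding tractable_def by blast
  let ?D = "{q. snd q \<in> vecs (m (fst q))}"
  let ?e = "\<lambda>q. enc_list [code (fst q), enc_vec enc_rat (m (fst q)) (snd q)]"
  let ?M = "\<lambda>q. m (fst q) + val_size (enc_vec enc_rat (m (fst q)) (snd q))"
  let ?min = "\<lambda>q u w. u \<in> vecs (m (fst q)) \<and> w = enc_option (Some (enc_vec enc_rat (m (fst q)) u)) \<and>
    real_vec u \<in> Q (fst q) \<and>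
    (\<forall>v \<in> Q (fst q). dot (m (fst q)) (real_vec (snd q)) (real_vec u) \<le> dot (m (fst q)) (real_vec (snd q)) v)"
  let ?R = "\<lambda>q. {w. if Q (fst q) = {} then w = enc_option None else \<exists>u. ?min q u w}"
  have mem: "(?e q, ?M q, ?R q) \<in> polytope_optimization Q m code" if "q \<in> ?D" for q
    unfolding polytope_optimization_def
    by (rule CollectI, rule exI[of _ "fst q"], rule exI[of _ "snd q"]) (use that in \<open>simp add: Bex_def\<close>)
  have size: "?M q \<le> m (fst q) + val_size (?e q)" for q
    by simp
  obtain answer where answer: "ptime ?D (\<lambda>q. m (fst q)) ?e answer"
    and R: "\<And>q. q \<in> ?D \<Longrightarrow> answer q \<in> ?R q"
    by (rule poly_time_solvable_ptime[OF opt, of ?D ?e ?M ?R "\<lambda>q. m (fst q)"]) (use mem size in blast)+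
  define minimizer where "minimizer q = (SOME u. ?min q u (answer q))" for q
  have minimizer: "?min (d, c) (minimizer (d, c)) (answer (d, c))" if "c \<in> vecs (m d)" "Q d \<noteq> {}" for d c
  proof -
    have "\<exists>u. ?min (d, c) u (answer (d, c))" using R[of "(d, c)"] that by simp
    then show ?thesis unfolding minimizer_def by (rule someI_ex)
  qed
  interpret optimization_oracle Q m code answer minimizer
  proof
    show "answer (d, c) = Atom 0" if "c \<in> vecs (m d)" "Q d = {}" for d c
      using R[of "(d, c)"] that by simp
    show "real_vec (minimizer (d, c)) \<in> Q d" if "c \<in> vecs (m d)" "Q d \<noteq> {}" for d c
      using minimizer[OF that] by simp
    show "answer (d, c) = Cell (Atom 1) (enc_vec enc_rat (m d) (minimizer (d, c)))"
      if "c \<in> vecs (m d)" "Q d \<noteq> {}" for d c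
      using minimizer[OF that] by simp
    show "dot (m d) (real_vec c) (real_vec (minimizer (d, c))) \<le> dot (m d) (real_vec c) q"
      if "c \<in> vecs (m d)" "q \<in> Q d" for d c q
      using minimizer[of c d] that by auto
  qed (rule assms(1), rule answer)
  let ?I = "{x :: 'd input. k_of x \<ge> 1}"
  let ?N = "\<lambda>x. 2 * (k_of x + cols x + n_of x)"
  have "ptime ?I ?N enc_input separate"
    by (rule ptime_separate) (simp add: reads_input_def ptime_env)
  then obtain p T where T: "poly_bounded ?I (\<lambda>x. ?N x + val_size (enc_input x)) T"
    and p: "\<And>x. x \<in> ?I \<Longrightarrow> \<exists>s. exec p (init_store (enc_input x)) (T x) s \<and> s 0 = separate x"
    by (rule ptimeE) blast
  obtain F where F: "\<And>x. x \<in> ?I \<Longrightarrow> T x \<le> poly F (?N x + val_size (enc_input x))"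
    using T unfolding poly_bounded_def by blast
  show ?thesis
    unfolding poly_time_solvable_def
  proof (intro exI ballI)
    fix P assume "P \<in> family_separation Q m code"
    then obtain d n k A a b v where P: "P =
       (enc_list [code d, enc_nat n, enc_nat (m d), enc_nat k,
          enc_mat enc_rat n (m d) A, enc_vec enc_rat n a, enc_rat b, enc_vec enc_rat n v],
        k + m d + n + val_size (enc_list
          [enc_mat enc_rat n (m d) A, enc_vec enc_rat n a, enc_rat b, enc_vec enc_rat n v]),
        {w. if \<forall>y \<in> Y_Q k (m d) (Q d). satisfies_ineq n (m d) k A a b v y
            then w = enc_option None
            else \<exists>y \<in> Y_Q k (m d) (Q d).
              w = enc_option (Some (enc_vec enc_nat (m d) y)) \<and>
              \<not> satisfies_ineq n (m d) k A a b v y})" and k: "k \<ge> 1"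
      unfolding family_separation_def by blast
    define x where "x = Input d n k A a b v"
    have x: "x \<in> ?I" using k by (simp add: x_def)
    let ?data = "enc_list [enc_mat enc_rat n (m d) A, enc_vec enc_rat n a, enc_rat b, enc_vec enc_rat n v]"
    let ?n = "k + m d + n + val_size ?data"
    have enc: "enc_input x = enc_list [code d, enc_nat n, enc_nat (m d), enc_nat k,
        enc_mat enc_rat n (m d) A, enc_vec enc_rat n a, enc_rat b, enc_vec enc_rat n v]"
      by (simp add: enc_input_def x_def)
    \<comment> \<open>The code word and the binary numbers are not part of the data that measure the input, but
      they are polynomially bounded by the dimension and by the numbers themselves.\<close>
    have "val_size (enc_input x) = 4 + val_size (code d) + val_size (enc_nat n) + val_size (enc_nat (m d)) +
        val_size (enc_nat k) + val_size ?data"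
      unfolding enc by simp
    moreover have "val_size (code d) \<le> poly g ?n"
      by (rule order_trans[OF g poly_nat_mono]) simp
    moreover have "val_size (enc_nat n) \<le> n + 1" "val_size (enc_nat (m d)) \<le> m d + 1" "val_size (enc_nat k) \<le> k + 1"
      unfolding enc_nat_def by (rule val_size_Atom_nat)+
    ultimately have "?N x + val_size (enc_input x) \<le> 7 + 3 * ?n + poly g ?n"
      by (simp add: x_def)
    also have "\<dots> = poly ([:7, 3:] + g) ?n"
      by simp
    finally have "T x \<le> poly F (poly ([:7, 3:] + g) ?n)"
      by (rule order_trans[OF F[OF x] poly_nat_mono])
    then have le: "T x \<le> poly (F \<circ>\<^sub>p ([:7, 3:] + g)) ?n"
      by (simp only: poly_pcompose)
    obtain s where s: "exec p (init_store (enc_input x)) (T x) s" "s 0 = separate x"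
      using p[OF x] by blast
    have fields: "idx x = d" "n_of x = n" "k_of x = k" "A_of x = A" "a_of x = a" "b_of x = b" "x_of x = v"
      by (simp_all add: x_def)
    have "k_of x \<ge> 1" using x by simp
    from separate_correct[OF this]
    have "s 0 \<in> {w. if \<forall>y \<in> Y_Q k (m d) (Q d). satisfies_ineq n (m d) k A a b v y
            then w = enc_option None
            else \<exists>y \<in> Y_Q k (m d) (Q d).
              w = enc_option (Some (enc_vec enc_nat (m d) y)) \<and>
              \<not> satisfies_ineq n (m d) k A a b v y}"
      unfolding fields s(2) mem_Collect_eq .
    then show "case P of (v, N, R) \<Rightarrow> \<exists>t s. exec p (init_store v) t s \<and>
        t \<le> poly (F \<circ>\<^sub>p ([:7, 3:] + g)) N \<and> s 0 \<in> R"
      unfolding P prod.case enc[symmetric] using s(1) le by blast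
  qed
qed

end
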